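(* Assume full participation, $\mathcal S_t=[n]$ for every $t\ge0$. Let $$u_0\in[g_0,\bar f],\qquad \chi_0\ge\max_{1\le i\le n}\mathbb E\|e_{i,0}\|^2.$$ For every $t\ge0$, let $$(w_t^{\mathrm{id}},\theta_t^{\mathrm{id}})\in\arg\min_{w\in\Delta_n,\ \theta\in[\underline\theta,\bar\theta]^n}\mathfrak J_t^{\mathrm{id}}(w,\theta;u_t,\chi_t)$$ (the controls with which the algorithm is run at round $t$), and define $$u_{t+1}:=\min\bigl\{\bar f,\ \mathfrak J_t^{\mathrm{id}}(w_t^{\mathrm{id}},\theta_t^{\mathrm{id}};u_t,\chi_t)\bigr\},\qquad \chi_{t+1}:=A_\chi+B_\chi u_t+C_\chi\chi_t,$$ where $A_\chi:=6\max_{1\le i\le n}\frac{v_i^2}{H_ib_i}$, $B_\chi:=144L\bar\theta^2$, $C_\chi:=288\bar\theta^2$. Then $(u_t,\chi_t)$ is a deterministic surrogate upper state for every $t\ge0$, i.e. $$g_t\le u_t\le\bar f,\qquad \max_{1\le i\le n}\mathbb E\|e_{i,t}\|^2\le\chi_t.$$ The same upper-state domination holds if the idealized surrogate objective $\mathfrak J_t^{\mathrm{id}}$ is replaced by the executable surrogate objective $\mathfrak J_t^{\mathrm{ex}}$ (in the choice of controls and in the recursion for $u_t$).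
   Context: Problem: $F(x)=\frac1n\sum_{i=1}^nF_i(x)$, $F_i(x)=\frac1{m_i}\sum_{j=1}^{m_i}\phi_{ij}(x)$, each $\phi_{ij}:\mathbb R^d\to\mathbb R$ convex and $L$-smooth ($L$-Lipschitz gradient). There are $x_\star\in\arg\min F$ and $R>0$; $B(x_\star,R)=\{x:\|x-x_\star\|\le R\}$, $F_\star:=F(x_\star)$, $\bar f:=LR^2/2$. Node $i$ has horizon $H_i\ge1$ and minibatch size $b_i$ (fixed across rounds), and $v_i^2:=\sup_{x\in B(x_\star,R)}\frac1{m_i}\sum_j\|\nabla\phi_{ij}(x)-\nabla F_i(x)\|^2$. Algorithm (HEW-Local SGD, full participation). $c_0=\frac1n\sum_ic_{i,0}$. At round $t$, with weights $w_t\in\Delta_n:=\{w\in\mathbb R_+^n:\sum_iw_i=1\}$ and amplitudes $\theta_{i,t}\in[\underline\theta,\bar\theta]$, $0<\underline\theta\le\bar\theta\le1$: each $i\in[n]$ sets $\eta_{i,t}=\theta_{i,t}/(LH_i)$, $y_{i,t}^{(0)}=x_t$, and for $\ell=0,\dots,H_i-1$ draws a minibatch $\mathcal B_{i,t,\ell}\subseteq[m_i]$ of size $b_i$, computes $g_{i,t,\ell}=\frac1{b_i}\sum_{j\in\mathcal B_{i,t,\ell}}\nabla\phi_{ij}(y_{i,t}^{(\ell)})$ and sets $y_{i,t}^{(\ell+1)}=y_{i,t}^{(\ell)}-\eta_{i,t}(g_{i,t,\ell}-c_{i,t}+c_t)$; then $\Delta_{i,t}=y_{i,t}^{(H_i)}-x_t$,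 $c_{i,t+1}=c_{i,t}-c_t+\frac1{H_i\eta_{i,t}}(x_t-y_{i,t}^{(H_i)})$, $x_{t+1}=x_t+\sum_iw_{i,t}\Delta_{i,t}$, $c_{t+1}=c_t+\frac1n\sum_i(c_{i,t+1}-c_{i,t})$. Standing assumptions: almost surely $x_t,y_{i,t}^{(\ell)}\in B(x_\star,R)$ for all $t,i,\ell$. $\mathcal F_t$ is generated by the initial state and all minibatches drawn strictly before round $t$; $\mathcal G_{i,t,\ell}$ by $\mathcal F_t$ and all minibatches of node $i$ drawn strictly before local step $\ell$ of round $t$. Conditionally on $\mathcal G_{i,t,\ell}$ the minibatches are independent across nodes and local steps, $\mathbb E[g_{i,t,\ell}\mid\mathcal G_{i,t,\ell}]=\nabla F_i(y_{i,t}^{(\ell)})$, $\mathbb E[\|g_{i,t,\ell}-\nabla F_i(y_{i,t}^{(\ell)})\|^2\mid\mathcal G_{i,t,\ell}]\le v_i^2/b_i$. Notation: $g_t:=\mathbb E[F(x_t)-F_\star]$, $e_{i,t}:=c_{i,t}-\nabla F_i(x_t)$, $T_a(u)=\frac u{1+au}$. A deterministic surrogate upper state at round $t$ is a deterministic pair $(u_t,\chi_t)\in[0,\infty)^2$ with $g_t\le u_t\le\bar f$ and $\max_{1\le i\le n}\mathbb E\|e_{i,t}\|^2\le\chi_t$. For deterministic $(u,\chi)$ with $0\le u\le\bar f$: $A_i(\theta_i)=\frac{\theta_i}{2LR^2}$, $s_i(u;\theta_i)=u-T_{A_i(\theta_i)}(u)$, $$\rho_i(\theta_i;u,\chi)=32e^{2\theta_i}\theta_i^3u+\frac{16\theta_i+64e^{2\theta_i}\theta_i^3}L\chi+8e^{2\theta_i}\frac{\theta_i^3v_i^2}{LH_ib_i},$$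 $$\kappa_i(\theta_i;u,\chi)=16e^{2\theta_i}\frac{\theta_i^4}Lu+32e^{2\theta_i}\frac{\theta_i^4}{L^2}\chi+(2\theta_i^2+4e^{2\theta_i}\theta_i^4)\frac{v_i^2}{L^2H_ib_i},$$ $\mu_i=s_i-\rho_i$, and $\mathfrak J_t^{\mathrm{id}}(w,\theta;u,\chi)=u-\sum_iw_i\mu_i(\theta_i;u,\chi)+\frac L2\sum_iw_i^2\kappa_i(\theta_i;u,\chi)$. $\mathfrak J_t^{\mathrm{ex}}$ is obtained by replacing every $v_i^2$ by a (deterministic) proxy $\widehat v_{i,t}^2\ge v_i^2$. *)

theory Defs
  imports "HOL-Probability.Probability"
begin

subsection \<open>Objective\<close>

definition grad :: "('a::euclidean_space \<Rightarrow> real) \<Rightarrow> 'a \<Rightarrow> 'a" where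
  "grad f x = (THE D. GDERIV f x :> D)"

lemma grad_eqI:
  assumes "GDERIV f x :> D"
  shows "grad f x = D"
  unfolding grad_def
proof (rule the_equality)
  show "GDERIV f x :> D" by (fact assms)
next
  fix E assume "GDERIV f x :> E"
  then have "(\<lambda>h. h \<bullet> E) = (\<lambda>h. h \<bullet> D)"
    using assms unfolding gderiv_def by (rule has_derivative_unique)
  then show "E = D"
    by (simp add: fun_eq_iff vector_eq_ldot)
qed

definition smooth_fun :: "real \<Rightarrow> ('a::euclidean_space \<Rightarrow> real) \<Rightarrow> bool" where
  "smooth_fun L f \<longleftrightarrow> (\<forall>x. \<exists>D. GDERIV f x :> D) \<and> L-lipschitz_on UNIV (grad f)"

text \<open>
  Nodes are the elements of a finite type \<open>'n\<close>; the samples of node \<open>i\<close> are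
  indexed by \<open>{..<m i}\<close>.
\<close>

definition node_obj ::
  "('n \<Rightarrow> nat \<Rightarrow> 'a \<Rightarrow> real) \<Rightarrow> ('n \<Rightarrow> nat) \<Rightarrow> 'n \<Rightarrow> 'a::euclidean_space \<Rightarrow> real" where
  "node_obj \<phi> m i x = (\<Sum>j<m i. \<phi> i j x) / real (m i)"

definition global_obj ::
  "('n::finite \<Rightarrow> nat \<Rightarrow> 'a \<Rightarrow> real) \<Rightarrow> ('n \<Rightarrow> nat) \<Rightarrow> 'a::euclidean_space \<Rightarrow> real" where
  "global_obj \<phi> m x = (\<Sum>i\<in>UNIV. node_obj \<phi> m i x) / real CARD('n)"

text \<open>The quantity \<open>v\<^sub>i\<^sup>2\<close> (already squared).\<close>

definition node_var ::
  "('n \<Rightarrow> nat \<Rightarrow> 'a \<Rightarrow> real) \<Rightarrow> ('n \<Rightarrow> nat) \<Rightarrow> 'a::euclidean_space \<Rightarrow> real \<Rightarrow> 'n \<Rightarrow> real" where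
  "node_var \<phi> m xs R i =
     (SUP x\<in>cball xs R.
        (\<Sum>j<m i. (norm (grad (\<phi> i j) x - grad (node_obj \<phi> m i) x))\<^sup>2) / real (m i))"


subsection \<open>Algorithm\<close>

definition minibatches :: "('n \<Rightarrow> nat) \<Rightarrow> ('n \<Rightarrow> nat) \<Rightarrow> 'n \<Rightarrow> nat set set" where
  "minibatches m b i = {S. S \<subseteq> {..<m i} \<and> card S = b i}"

definition minibatch_grad ::
  "('n \<Rightarrow> nat \<Rightarrow> 'a \<Rightarrow> real) \<Rightarrow> ('n \<Rightarrow> nat) \<Rightarrow> 'n \<Rightarrow> nat set \<Rightarrow> 'a::euclidean_space \<Rightarrow> 'a" where
  "minibatch_grad \<phi> b i S y = (1 / real (b i)) *\<^sub>R (\<Sum>j\<in>S. grad (\<phi> i j) y)"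

text \<open>
  The arguments of the next predicate are the round-indexed weights \<open>w t i\<close> and amplitudes
  \<open>\<theta> t i\<close>, the minibatches \<open>B t i l\<close>, the server iterates \<open>x t\<close>, the local iterates \<open>y t i l\<close>
  (for \<open>l \<le> H i\<close>), the node controls \<open>c t i\<close> and the global control \<open>cb t\<close>. The initial data
  \<open>x 0\<close> and \<open>c 0 i\<close> are unconstrained.
\<close>

definition hew_local_sgd ::
  "('n::finite \<Rightarrow> nat \<Rightarrow> 'a \<Rightarrow> real) \<Rightarrow> ('n \<Rightarrow> nat) \<Rightarrow> ('n \<Rightarrow> nat) \<Rightarrow> real \<Rightarrow> 'w measure \<Rightarrow>
   (nat \<Rightarrow> 'n \<Rightarrow> real) \<Rightarrow> (nat \<Rightarrow> 'n \<Rightarrow> real) \<Rightarrow> (nat \<Rightarrow> 'n \<Rightarrow> nat \<Rightarrow> 'w \<Rightarrow> nat set) \<Rightarrow>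
   (nat \<Rightarrow> 'w \<Rightarrow> 'a::euclidean_space) \<Rightarrow> (nat \<Rightarrow> 'n \<Rightarrow> nat \<Rightarrow> 'w \<Rightarrow> 'a) \<Rightarrow>
   (nat \<Rightarrow> 'n \<Rightarrow> 'w \<Rightarrow> 'a) \<Rightarrow> (nat \<Rightarrow> 'w \<Rightarrow> 'a) \<Rightarrow> bool" where
  "hew_local_sgd \<phi> H b L M w \<theta> B x y c cb \<longleftrightarrow>
    (\<forall>\<omega>\<in>space M.
       cb 0 \<omega> = (1 / real CARD('n)) *\<^sub>R (\<Sum>i\<in>UNIV. c 0 i \<omega>) \<and>
       (\<forall>t.
          (\<forall>i. let \<eta> = \<theta> t i / (L * real (H i)) in
             y t i 0 \<omega> = x t \<omega> \<and>
             (\<forall>l<H i. y t i (Suc l) \<omega> =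
                y t i l \<omega> - \<eta> *\<^sub>R (minibatch_grad \<phi> b i (B t i l \<omega>) (y t i l \<omega>) - c t i \<omega> + cb t \<omega>)) \<and>
             c (Suc t) i \<omega> =
               c t i \<omega> - cb t \<omega> + (1 / (real (H i) * \<eta>)) *\<^sub>R (x t \<omega> - y t i (H i) \<omega>)) \<and>
          x (Suc t) \<omega> = x t \<omega> + (\<Sum>i\<in>UNIV. w t i *\<^sub>R (y t i (H i) \<omega> - x t \<omega>)) \<and>
          cb (Suc t) \<omega> =
            cb t \<omega> + (1 / real CARD('n)) *\<^sub>R (\<Sum>i\<in>UNIV. c (Suc t) i \<omega> - c t i \<omega>)))"


subsection \<open>Filtration and stochastic assumptions\<close>

definition round_history ::
  "('n \<Rightarrow> nat) \<Rightarrow> 'w measure \<Rightarrow> (nat \<Rightarrow> 'n \<Rightarrow> nat \<Rightarrow> 'w \<Rightarrow> nat set) \<Rightarrow>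
   ('w \<Rightarrow> 'a::euclidean_space) \<Rightarrow> ('n \<Rightarrow> 'w \<Rightarrow> 'a) \<Rightarrow> nat \<Rightarrow> 'w measure" where
  "round_history H M B x0 c0 t = sigma (space M)
     ({x0 -` A \<inter> space M | A. A \<in> sets borel} \<union>
      {c0 i -` A \<inter> space M | i A. A \<in> sets borel} \<union>
      {B s i l -` \<S> \<inter> space M | s i l \<S>. s < t \<and> l < H i})"

definition local_history ::
  "('n \<Rightarrow> nat) \<Rightarrow> 'w measure \<Rightarrow> (nat \<Rightarrow> 'n \<Rightarrow> nat \<Rightarrow> 'w \<Rightarrow> nat set) \<Rightarrow>
   ('w \<Rightarrow> 'a::euclidean_space) \<Rightarrow> ('n \<Rightarrow> 'w \<Rightarrow> 'a) \<Rightarrow> 'n \<Rightarrow> nat \<Rightarrow> nat \<Rightarrow> 'w measure" where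
  "local_history H M B x0 c0 i t l = sigma (space M)
     (sets (round_history H M B x0 c0 t) \<union> {B t i k -` \<S> \<inter> space M | k \<S>. k < l})"

text \<open>
  Conditional version of \<^const>\<open>prob_space.indep_vars\<close>. It is meant for a
  sub-\<open>\<sigma>\<close>-algebra \<open>G\<close> of \<open>M\<close>.
\<close>

definition cond_indep_vars ::
  "'w measure \<Rightarrow> 'w measure \<Rightarrow> ('k \<Rightarrow> 's measure) \<Rightarrow> ('k \<Rightarrow> 'w \<Rightarrow> 's) \<Rightarrow> 'k set \<Rightarrow> bool" where
  "cond_indep_vars M G N X I \<longleftrightarrow>
    (\<forall>k\<in>I. X k \<in> M \<rightarrow>\<^sub>M N k) \<and>
    (\<forall>J A. J \<subseteq> I \<and> J \<noteq> {} \<and> finite J \<and> (\<forall>k\<in>J. A k \<in> sets (N k)) \<longrightarrow>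
      (AE \<omega> in M.
         real_cond_exp M G (indicator (\<Inter>k\<in>J. X k -` A k \<inter> space M)) \<omega> =
         (\<Prod>k\<in>J. real_cond_exp M G (indicator (X k -` A k \<inter> space M)) \<omega>)))"

text \<open>
  The joint family of all minibatches of round \<open>t\<close> is required to be independent given each
  local history of that round; those already contained in the history satisfy this trivially.
  The vector-valued conditional expectation is expressed coordinatewise.
\<close>

definition minibatch_sampling ::
  "('n::finite \<Rightarrow> nat \<Rightarrow> 'a \<Rightarrow> real) \<Rightarrow> ('n \<Rightarrow> nat) \<Rightarrow> ('n \<Rightarrow> nat) \<Rightarrow> ('n \<Rightarrow> nat) \<Rightarrow>
   'a::euclidean_space \<Rightarrow> real \<Rightarrow> 'w measure \<Rightarrow> (nat \<Rightarrow> 'n \<Rightarrow> nat \<Rightarrow> 'w \<Rightarrow> nat set) \<Rightarrow>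
   (nat \<Rightarrow> 'w \<Rightarrow> 'a) \<Rightarrow> (nat \<Rightarrow> 'n \<Rightarrow> nat \<Rightarrow> 'w \<Rightarrow> 'a) \<Rightarrow> (nat \<Rightarrow> 'n \<Rightarrow> 'w \<Rightarrow> 'a) \<Rightarrow> bool" where
  "minibatch_sampling \<phi> m H b xs R M B x y c \<longleftrightarrow>
    (\<forall>t i l. l < H i \<longrightarrow>
      (let G = local_history H M B (x 0) (c 0) i t l;
           g = (\<lambda>\<omega>. minibatch_grad \<phi> b i (B t i l \<omega>) (y t i l \<omega>));
           h = (\<lambda>\<omega>. grad (node_obj \<phi> m i) (y t i l \<omega>))
       in cond_indep_vars M G (\<lambda>(k, r). count_space (minibatches m b k)) (\<lambda>(k, r). B t k r)
            (SIGMA k:UNIV. {..<H k}) \<and>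
          (\<forall>a\<in>Basis. AE \<omega> in M. real_cond_exp M G (\<lambda>\<omega>. g \<omega> \<bullet> a) \<omega> = h \<omega> \<bullet> a) \<and>
          (AE \<omega> in M. real_cond_exp M G (\<lambda>\<omega>. (norm (g \<omega> - h \<omega>))\<^sup>2) \<omega>
             \<le> node_var \<phi> m xs R i / real (b i))))"


subsection \<open>Surrogate objective and upper states\<close>

definition prob_simplex :: "('n::finite \<Rightarrow> real) set" where
  "prob_simplex = {w. (\<forall>i. 0 \<le> w i) \<and> (\<Sum>i\<in>UNIV. w i) = 1}"

definition T_map :: "real \<Rightarrow> real \<Rightarrow> real" where
  "T_map a u = u / (1 + a * u)"

definition s_fun :: "real \<Rightarrow> real \<Rightarrow> real \<Rightarrow> real \<Rightarrow> real" where
  "s_fun L R \<theta> u = u - T_map (\<theta> / (2 * L * R\<^sup>2)) u"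

text \<open>
  In the following, \<open>V i\<close> stands for \<open>v\<^sub>i\<^sup>2\<close>; taking the true variances gives the idealized
  objective, taking variance proxies gives the executable one.
\<close>

definition rho_fun ::
  "real \<Rightarrow> ('n \<Rightarrow> nat) \<Rightarrow> ('n \<Rightarrow> nat) \<Rightarrow> ('n \<Rightarrow> real) \<Rightarrow> 'n \<Rightarrow> real \<Rightarrow> real \<Rightarrow> real \<Rightarrow> real" where
  "rho_fun L H b V i \<theta> u chi =
     32 * exp (2 * \<theta>) * \<theta> ^ 3 * u
     + (16 * \<theta> + 64 * exp (2 * \<theta>) * \<theta> ^ 3) / L * chi
     + 8 * exp (2 * \<theta>) * (\<theta> ^ 3 * V i / (L * real (H i) * real (b i)))"

definition kappa_fun ::
  "real \<Rightarrow> ('n \<Rightarrow> nat) \<Rightarrow> ('n \<Rightarrow> nat) \<Rightarrow> ('n \<Rightarrow> real) \<Rightarrow> 'n \<Rightarrow> real \<Rightarrow> real \<Rightarrow> real \<Rightarrow> real" where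
  "kappa_fun L H b V i \<theta> u chi =
     16 * exp (2 * \<theta>) * (\<theta> ^ 4 / L) * u
     + 32 * exp (2 * \<theta>) * (\<theta> ^ 4 / L\<^sup>2) * chi
     + (2 * \<theta>\<^sup>2 + 4 * exp (2 * \<theta>) * \<theta> ^ 4) * (V i / (L\<^sup>2 * real (H i) * real (b i)))"

definition surrogate_obj ::
  "real \<Rightarrow> real \<Rightarrow> ('n::finite \<Rightarrow> nat) \<Rightarrow> ('n \<Rightarrow> nat) \<Rightarrow> ('n \<Rightarrow> real) \<Rightarrow>
   ('n \<Rightarrow> real) \<Rightarrow> ('n \<Rightarrow> real) \<Rightarrow> real \<Rightarrow> real \<Rightarrow> real" where
  "surrogate_obj L R H b V w \<theta> u chi =
     u - (\<Sum>i\<in>UNIV. w i * (s_fun L R (\<theta> i) u - rho_fun L H b V i (\<theta> i) u chi))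
     + L / 2 * (\<Sum>i\<in>UNIV. (w i)\<^sup>2 * kappa_fun L H b V i (\<theta> i) u chi)"

definition optimal_controls ::
  "real \<Rightarrow> real \<Rightarrow> ('n::finite \<Rightarrow> nat) \<Rightarrow> ('n \<Rightarrow> nat) \<Rightarrow> ('n \<Rightarrow> real) \<Rightarrow> real \<Rightarrow> real \<Rightarrow>
   real \<Rightarrow> real \<Rightarrow> ('n \<Rightarrow> real) \<Rightarrow> ('n \<Rightarrow> real) \<Rightarrow> bool" where
  "optimal_controls L R H b V \<theta>lo \<theta>hi u chi w \<theta> \<longleftrightarrow>
     is_arg_min (\<lambda>(w, \<theta>). surrogate_obj L R H b V w \<theta> u chi)
       (\<lambda>(w, \<theta>). w \<in> prob_simplex \<and> (\<forall>i. \<theta> i \<in> {\<theta>lo..\<theta>hi})) (w, \<theta>)"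

definition opt_gap ::
  "('n::finite \<Rightarrow> nat \<Rightarrow> 'a \<Rightarrow> real) \<Rightarrow> ('n \<Rightarrow> nat) \<Rightarrow> 'a \<Rightarrow> 'w measure \<Rightarrow>
   (nat \<Rightarrow> 'w \<Rightarrow> 'a::euclidean_space) \<Rightarrow> nat \<Rightarrow> real" where
  "opt_gap \<phi> m xs M x t = (\<integral>\<omega>. (global_obj \<phi> m (x t \<omega>) - global_obj \<phi> m xs) \<partial>M)"

text \<open>
  The control error is an \<open>ennreal\<close>, so that a finite bound on it includes square
  integrability; the Bochner integral would return 0 for non-integrable errors.
\<close>

definition max_ctrl_err ::
  "('n::finite \<Rightarrow> nat \<Rightarrow> 'a \<Rightarrow> real) \<Rightarrow> ('n \<Rightarrow> nat) \<Rightarrow> 'w measure \<Rightarrow>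
   (nat \<Rightarrow> 'w \<Rightarrow> 'a::euclidean_space) \<Rightarrow> (nat \<Rightarrow> 'n \<Rightarrow> 'w \<Rightarrow> 'a) \<Rightarrow> nat \<Rightarrow> ennreal" where
  "max_ctrl_err \<phi> m M x c t =
     (MAX i. \<integral>\<^sup>+\<omega>. ennreal ((norm (c t i \<omega> - grad (node_obj \<phi> m i) (x t \<omega>)))\<^sup>2) \<partial>M)"

definition upper_state ::
  "('n::finite \<Rightarrow> nat \<Rightarrow> 'a \<Rightarrow> real) \<Rightarrow> ('n \<Rightarrow> nat) \<Rightarrow> real \<Rightarrow> 'a \<Rightarrow> real \<Rightarrow> 'w measure \<Rightarrow>
   (nat \<Rightarrow> 'w \<Rightarrow> 'a::euclidean_space) \<Rightarrow> (nat \<Rightarrow> 'n \<Rightarrow> 'w \<Rightarrow> 'a) \<Rightarrow> nat \<Rightarrow> real \<Rightarrow> real \<Rightarrow> bool" where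
  "upper_state \<phi> m L xs R M x c t u chi \<longleftrightarrow>
     0 \<le> u \<and> 0 \<le> chi \<and> opt_gap \<phi> m xs M x t \<le> u \<and> u \<le> L * R\<^sup>2 / 2 \<and>
     max_ctrl_err \<phi> m M x c t \<le> ennreal chi"

end

theory Submission
  imports Defs
begin

text \<open>
  Fix a round \<open>t\<close> with upper state \<open>(u, \<chi>)\<close>, and write \<open>\<xi>\<^sub>i\<^sub>l\<close> for the noise of the stochastic gradient of node
  \<open>i\<close> at local step \<open>l\<close> and \<open>s\<^sub>i\<^sup>2 = v\<^sub>i\<^sup>2 / (H\<^sub>i b\<^sub>i)\<close>. The corrected initial direction of node \<open>i\<close>,
  \<open>q\<^sub>i = \<nabla>F\<^sub>i(x\<^sub>t) + c\<^sub>t - c\<^sub>i\<^sub>t\<close>, equals \<open>\<nabla>F(x\<^sub>t)\<close> up to the centred control errors, because \<open>c\<^sub>t\<close> is always the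
  mean of the \<open>c\<^sub>i\<^sub>t\<close>. Since \<open>\<parallel>\<nabla>F\<parallel>\<^sup>2 \<le> 2L(F - F\<^sub>\<star>)\<close>, this gives \<open>E\<parallel>q\<^sub>i\<parallel>\<^sup>2 \<le> Q\<^sup>2 = 4Lu + 8\<chi>\<close>.

  Two facts drive the estimates. First, the noise of node \<open>i\<close> at step \<open>l\<close> is centred even
  conditionally on its own past together with all minibatches of the other nodes in this round
  (lemma \<open>\<xi>_orthogonal\<close>). All noises of a round are therefore pairwise orthogonal, which is where the
  squared weights come from. Second, gradient steps of a smooth convex function are nonexpansive, so the
  local drift satisfies \<open>\<parallel>y\<^sub>i\<^sub>l - x\<^sub>t\<parallel> \<le> (\<theta>\<^sub>i / L) (\<tau> Q + \<surd>\<tau> s\<^sub>i)\<close> in the \<open>L\<^sup>2\<close> norm, with \<open>\<tau> = l / H\<^sub>i\<close> and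
  without an exponential factor (lemma \<open>drift\<close>).

  For the optimality gap, the server step is split into the noise \<open>N\<close> and a noise-free part. By
  convexity of \<open>F\<close> the noise-free part decreases \<open>F\<close> at least as the weighted average of perturbed
  gradient steps, and the gap inequality \<open>F(x) - F\<^sub>\<star> \<le> R \<parallel>\<nabla>F(x)\<parallel>\<close> turns this into the quadratic decrease
  that \<open>T\<^sub>a\<close> dominates. The term linear in \<open>N\<close> has mean zero once the gradient is evaluated at a point
  determined by the history of the round; moving it there costs a product of the drift and \<open>N\<close>, which is
  absorbed into the constants of \<open>\<rho>\<^sub>i\<close> and \<open>\<kappa>\<^sub>i\<close> (lemmas \<open>pointwise_descent\<close>, \<open>surrogate_descent\<close>).

  For the control error, \<open>c\<^sub>i\<^sub>,\<^sub>t\<^sub>+\<^sub>1\<close> is the mean of the stochastic gradients of the round. The error is thus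
  the mean over \<open>l\<close> of the averaged noise of node \<open>i\<close> plus \<open>\<nabla>F\<^sub>i(y\<^sub>i\<^sub>l) - \<nabla>F\<^sub>i(x\<^sub>t\<^sub>+\<^sub>1)\<close>. The triangle inequality alone
  would give more than the constant 6. One uses in addition that the averaged noise of node \<open>i\<close> is
  orthogonal to everything computed by the other nodes, hence correlated with \<open>x\<^sub>t\<^sub>+\<^sub>1\<close> only in proportion to
  \<open>w\<^sub>i\<close>, and that for large \<open>w\<^sub>i\<close> the point \<open>x\<^sub>t\<^sub>+\<^sub>1\<close> is close to the last local iterate of the same node
  (lemmas \<open>noise_Z\<close>, \<open>Z_l2\<close>, \<open>control_error\<close>).

  These estimates hold for all feasible controls. The objective with variance proxies is covered because
  the bounds are monotone in the variances.
\<close>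

section \<open>Smooth convex functions\<close>

lemma smooth_fun_GDERIV: "smooth_fun L f \<Longrightarrow> GDERIV f x :> grad f x"
  unfolding smooth_fun_def using grad_eqI by metis

lemma smooth_fun_lipschitz: "smooth_fun L f \<Longrightarrow> norm (grad f x - grad f y) \<le> L * norm (x - y)"
  unfolding smooth_fun_def using lipschitz_onD[of L UNIV "grad f" x y] by (simp add: dist_norm)

lemma smooth_fun_continuous_grad: "smooth_fun L f \<Longrightarrow> continuous_on UNIV (grad f)"
  unfolding smooth_fun_def using lipschitz_on_continuous_on by blast

lemma smooth_fun_continuous: 
  assumes "smooth_fun L f" shows "continuous_on UNIV f"
  using smooth_fun_GDERIV[OF assms] unfolding gderiv_def
  by (meson continuous_at_imp_continuous_on has_derivative_continuous)

lemma GDERIV_line: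
  assumes "GDERIV f (x + t *\<^sub>R d) :> D"
  shows "((\<lambda>t. f (x + t *\<^sub>R d)) has_real_derivative D \<bullet> d) (at t)"
proof -
  have 1: "((\<lambda>t. x + t *\<^sub>R d) has_derivative (\<lambda>h. h *\<^sub>R d)) (at t)"
    by (auto intro!: derivative_eq_intros)
  have "((\<lambda>t. f (x + t *\<^sub>R d)) has_derivative (\<lambda>h. (h *\<^sub>R d) \<bullet> D)) (at t)"
    using has_derivative_compose[OF 1] assms unfolding gderiv_def by blast
  then show ?thesis
    by (simp add: has_field_derivative_def inner_commute mult.commute[of _ "_ \<bullet> _"])
qed

lemma smooth_fun_descent:
  assumes "smooth_fun L f"
  shows "f y \<le> f x + grad f x \<bullet> (y - x) + L / 2 * (norm (y - x))\<^sup>2"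
proof -
  define d where "d = y - x"
  define h where "h = (\<lambda>t. f (x + t *\<^sub>R d) - t * (grad f x \<bullet> d) - L * t\<^sup>2 / 2 * (norm d)\<^sup>2)"
  have D: "(h has_real_derivative (grad f (x + t *\<^sub>R d) \<bullet> d - grad f x \<bullet> d - L * t * (norm d)\<^sup>2)) (at t)" for t
    unfolding h_def 
    by (rule derivative_eq_intros GDERIV_line smooth_fun_GDERIV[OF assms] refl | simp)+
  have "h 1 \<le> h 0"
  proof (rule DERIV_nonpos_imp_nonincreasing[of 0 1])
    fix t :: real assume t: "0 \<le> t" "t \<le> 1"
    have "grad f (x + t *\<^sub>R d) \<bullet> d - grad f x \<bullet> d = (grad f (x + t *\<^sub>R d) - grad f x) \<bullet> d"
      by (simp add: inner_diff_left)
    also have "\<dots> \<le> norm (grad f (x + t *\<^sub>R d) - grad f x) * norm d"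
      by (rule norm_cauchy_schwarz)
    also have "\<dots> \<le> (L * norm (t *\<^sub>R d)) * norm d"
      using smooth_fun_lipschitz[OF assms, of "x + t *\<^sub>R d" x] by (intro mult_right_mono) auto
    also have "\<dots> = L * t * (norm d)\<^sup>2" using t by (simp add: power2_eq_square)
    finally show "\<exists>z. DERIV h t :> z \<and> z \<le> 0" using D[of t] by (intro exI conjI) auto
  qed simp
  then show ?thesis by (simp add: h_def d_def)
qed

lemma convex_on_grad_le:
  assumes c: "convex_on UNIV f" and s: "smooth_fun L f"
  shows "f x + grad f x \<bullet> (y - x) \<le> f y"
proof -
  define d where "d = y - x"
  define h where "h = (\<lambda>t::real. f (x + t *\<^sub>R d))"
  have "convex_on UNIV h"
  proof (rule convex_onI)
    fix t a b :: real assume t: "0 < t" "t < 1"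
    have "x + ((1 - t) *\<^sub>R a + t *\<^sub>R b) *\<^sub>R d = (1 - t) *\<^sub>R (x + a *\<^sub>R d) + t *\<^sub>R (x + b *\<^sub>R d)"
      by (simp add: algebra_simps)
    then show "h ((1 - t) *\<^sub>R a + t *\<^sub>R b) \<le> (1 - t) * h a + t * h b"
      unfolding h_def using convex_onD[OF c, of t "x + a *\<^sub>R d" "x + b *\<^sub>R d"] t by auto
  qed simp
  moreover have "(h has_real_derivative grad f x \<bullet> d) (at 0)"
    unfolding h_def using GDERIV_line[of f x 0 d] smooth_fun_GDERIV[OF s] by simp
  ultimately have "h 1 - h 0 \<ge> (grad f x \<bullet> d) * (1 - 0)"
    by (intro convex_on_imp_above_tangent[of UNIV]) auto
  then show ?thesis by (simp add: h_def d_def)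
qed

lemma convex_smooth_lower_bound:
  assumes c: "convex_on UNIV f" and s: "smooth_fun L f" and L: "L > 0"
  shows "f x + grad f x \<bullet> (y - x) + (norm (grad f y - grad f x))\<^sup>2 / (2 * L) \<le> f y"
proof -
  \<comment> \<open>The point \<open>z\<close> minimises the quadratic upper model at \<open>y\<close> minus the tangent at \<open>x\<close>.\<close>
  define G where "G = grad f y - grad f x"
  define z where "z = y - (1 / L) *\<^sub>R G"
  have 1: "f x + grad f x \<bullet> (z - x) \<le> f z" using convex_on_grad_le[OF c s] .
  have 2: "f z \<le> f y + grad f y \<bullet> (z - y) + L / 2 * (norm (z - y))\<^sup>2" using smooth_fun_descent[OF s] .
  have 3: "L / 2 * (norm (z - y))\<^sup>2 = (norm G)\<^sup>2 / (2 * L)"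
    using L by (simp add: z_def power2_eq_square field_simps)
  have 4: "grad f y \<bullet> (z - y) = - (grad f y \<bullet> G) / L" by (simp add: z_def)
  have 5: "grad f x \<bullet> (z - x) = grad f x \<bullet> (y - x) - (grad f x \<bullet> G) / L"
    by (simp add: z_def algebra_simps)
  have 6: "(norm G)\<^sup>2 / L = (grad f y \<bullet> G) / L - (grad f x \<bullet> G) / L"
    unfolding power2_norm_eq_inner diff_divide_distrib[symmetric] by (simp add: G_def inner_diff_left)
  show ?thesis using 1 2 6 unfolding 3 4 5 by (simp add: G_def[symmetric] field_simps)
qed

text \<open>
  Adding the lower bounds with \<open>x\<close> and \<open>y\<close> exchanged shows that the gradient is cocoercive, which bounds
  the quadratic term in the expansion of the squared distance.
\<close>

lemma gradient_step_nonexpansive: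
  assumes c: "convex_on UNIV f" and s: "smooth_fun L f" and L: "L > 0"
    and e: "0 \<le> \<eta>" "\<eta> * L \<le> 2"
  shows "norm ((y - \<eta> *\<^sub>R grad f y) - (x - \<eta> *\<^sub>R grad f x)) \<le> norm (y - x)"
proof -
  define G where "G = grad f y - grad f x"
  define d where "d = y - x"
  have A: "f x + grad f x \<bullet> (y - x) + (norm (grad f y - grad f x))\<^sup>2 / (2 * L) \<le> f y"
    and Bq: "f y + grad f y \<bullet> (x - y) + (norm (grad f x - grad f y))\<^sup>2 / (2 * L) \<le> f x"
    using convex_smooth_lower_bound[OF c s L] by blast+
  have "grad f x \<bullet> (y - x) + grad f y \<bullet> (x - y) = - (G \<bullet> d)"
    by (simp add: G_def d_def inner_diff_left inner_diff_right)
  then have "(norm G)\<^sup>2 / (2 * L) + (norm G)\<^sup>2 / (2 * L) \<le> G \<bullet> d"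
    using A Bq by (simp add: G_def norm_minus_commute)
  then have coco: "(norm G)\<^sup>2 \<le> L * (G \<bullet> d)" using L by (simp add: field_simps)
  then have "0 \<le> L * (G \<bullet> d)" by (rule order_trans[rotated]) simp
  then have Gd: "0 \<le> G \<bullet> d" using L by (simp add: zero_le_mult_iff)
  have "(norm (d - \<eta> *\<^sub>R G))\<^sup>2 = (norm d)\<^sup>2 - 2 * \<eta> * (G \<bullet> d) + \<eta>\<^sup>2 * (norm G)\<^sup>2"
    unfolding power2_norm_eq_inner
    by (simp add: inner_diff_left inner_diff_right inner_commute[of G d] power2_eq_square right_diff_distrib)
  also have "\<dots> \<le> (norm d)\<^sup>2 - 2 * \<eta> * (G \<bullet> d) + \<eta>\<^sup>2 * (L * (G \<bullet> d))"
    using coco by (simp add: mult_left_mono)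
  also have "\<dots> = (norm d)\<^sup>2 - (2 - \<eta> * L) * (\<eta> * (G \<bullet> d))" by (simp add: algebra_simps power2_eq_square)
  also have "\<dots> \<le> (norm d)\<^sup>2" using e Gd by simp
  finally have "norm (d - \<eta> *\<^sub>R G) \<le> norm d" by (rule power2_le_imp_le) simp
  moreover have "(y - \<eta> *\<^sub>R grad f y) - (x - \<eta> *\<^sub>R grad f x) = d - \<eta> *\<^sub>R G"
    by (simp add: d_def G_def algebra_simps)
  ultimately show ?thesis by (simp only: d_def)
qed

lemma
  assumes "finite I" "I \<noteq> {}" "\<And>i. i \<in> I \<Longrightarrow> smooth_fun L (f i)"
  shows grad_average: "grad (\<lambda>x. (\<Sum>i\<in>I. f i x) / real (card I)) x = (1 / real (card I)) *\<^sub>R (\<Sum>i\<in>I. grad (f i) x)"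
    and smooth_average: "smooth_fun L (\<lambda>x. (\<Sum>i\<in>I. f i x) / real (card I))"
proof -
  let ?F = "\<lambda>x. (\<Sum>i\<in>I. f i x) / real (card I)"
  have c: "real (card I) > 0" using assms by (simp add: card_gt_0_iff)
  have G: "GDERIV ?F x :> (1 / real (card I)) *\<^sub>R (\<Sum>i\<in>I. grad (f i) x)" for x
  proof -
    have "(?F has_derivative (\<lambda>h. (\<Sum>i\<in>I. h \<bullet> grad (f i) x) / real (card I))) (at x)"
      unfolding divide_inverse using smooth_fun_GDERIV[OF assms(3)] unfolding gderiv_def
      by (intro has_derivative_mult_left has_derivative_sum)
    then show ?thesis unfolding gderiv_def by (simp add: inner_sum_right)
  qed
  show g: "grad ?F x = (1 / real (card I)) *\<^sub>R (\<Sum>i\<in>I. grad (f i) x)" for x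
    using grad_eqI[OF G] .
  obtain j where "j \<in> I" using assms by blast
  then have L0: "0 \<le> L" using assms(3) by (auto simp: smooth_fun_def lipschitz_on_def)
  have "L-lipschitz_on UNIV (grad ?F)"
  proof (rule lipschitz_onI)
    fix x y
    have "dist (grad ?F x) (grad ?F y) = norm ((1 / real (card I)) *\<^sub>R (\<Sum>i\<in>I. grad (f i) x - grad (f i) y))"
      by (simp only: g dist_norm sum_subtractf scaleR_diff_right)
    also have "\<dots> \<le> (\<Sum>i\<in>I. norm (grad (f i) x - grad (f i) y)) / real (card I)"
      using c norm_sum[of "\<lambda>i. grad (f i) x - grad (f i) y" I] by (simp add: divide_right_mono)
    also have "\<dots> \<le> (\<Sum>i\<in>I. L * dist x y) / real (card I)"
      using c smooth_fun_lipschitz[OF assms(3)] by (intro divide_right_mono sum_mono) (auto simp: dist_norm)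
    finally show "dist (grad ?F x) (grad ?F y) \<le> L * dist x y" using c by simp
  qed (rule L0)
  then show "smooth_fun L ?F" using G unfolding smooth_fun_def by blast
qed

lemma convex_on_average:
  assumes "finite I" "\<And>i. i \<in> I \<Longrightarrow> convex_on UNIV (f i)"
  shows "convex_on UNIV (\<lambda>x. (\<Sum>i\<in>I. f i x) / real (card I))"
proof -
  have "convex_on UNIV (\<lambda>x. \<Sum>i\<in>I. f i x)" using assms
    by (induction I rule: finite_induct) (auto intro: convex_on_add simp: convex_on_const)
  then have "convex_on UNIV (\<lambda>x. inverse (real (card I)) * (\<Sum>i\<in>I. f i x))"
    by (rule convex_on_cmul[rotated]) simp
  then show ?thesis by (simp add: divide_inverse mult.commute)
qed

text \<open>
  A gradient step with error \<open>e\<close>: the error enters only through its norm, since \<open>\<theta>\<^sup>2 \<le> \<theta>\<close> completes the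
  square.
\<close>

lemma smooth_gradient_step_error:
  assumes s: "smooth_fun L f" and L: "0 < L" and \<theta>: "0 \<le> \<theta>" "\<theta> \<le> 1"
  shows "f (z - (\<theta> / L) *\<^sub>R (grad f z + e)) \<le> f z + \<theta> / (2 * L) * ((norm e)\<^sup>2 - (norm (grad f z))\<^sup>2)"
proof -
  define v where "v = grad f z + e"
  have "f (z - (\<theta> / L) *\<^sub>R v) \<le> f z + grad f z \<bullet> (- ((\<theta> / L) *\<^sub>R v)) + L / 2 * (norm ((\<theta> / L) *\<^sub>R v))\<^sup>2"
    using smooth_fun_descent[OF s, of "z - (\<theta> / L) *\<^sub>R v" z] by simp
  also have "L / 2 * (norm ((\<theta> / L) *\<^sub>R v))\<^sup>2 = \<theta>\<^sup>2 / (2 * L) * (norm v)\<^sup>2"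
    using L by (simp add: power_mult_distrib power_divide) (simp add: power2_eq_square)
  also have "\<theta>\<^sup>2 / (2 * L) * (norm v)\<^sup>2 \<le> \<theta> / (2 * L) * (norm v)\<^sup>2"
    using \<theta> L by (intro mult_right_mono divide_right_mono) (auto simp: power2_eq_square mult_left_le)
  also have "f z + grad f z \<bullet> (- ((\<theta> / L) *\<^sub>R v)) + \<theta> / (2 * L) * (norm v)\<^sup>2 =
      f z + \<theta> / (2 * L) * ((norm v)\<^sup>2 - 2 * (grad f z \<bullet> v))"
    using L by (simp add: field_simps)
  also have "(norm v)\<^sup>2 - 2 * (grad f z \<bullet> v) = (norm e)\<^sup>2 - (norm (grad f z))\<^sup>2"
    by (simp add: v_def power2_norm_eq_inner inner_add_left inner_add_right inner_commute)
  finally show ?thesis by (simp add: v_def)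
qed

section \<open>Square-integrable random vectors\<close>

text \<open>
  \<open>X\<close> is a square-integrable random vector whose \<open>L\<^sup>2\<close> norm is at most \<open>a\<close>. Integrability is part of the
  notion because the Bochner integral of a non-integrable function is 0.
\<close>

definition l2_le :: "'w measure \<Rightarrow> ('w \<Rightarrow> 'a::euclidean_space) \<Rightarrow> real \<Rightarrow> bool" where
  "l2_le M X a \<longleftrightarrow> X \<in> borel_measurable M \<and> integrable M (\<lambda>\<omega>. (norm (X \<omega>))\<^sup>2) \<and> 0 \<le> a \<and>
     (\<integral>\<omega>. (norm (X \<omega>))\<^sup>2 \<partial>M) \<le> a\<^sup>2"

lemma l2_leD:
  assumes "l2_le M X a"
  shows "X \<in> borel_measurable M" "integrable M (\<lambda>\<omega>. (norm (X \<omega>))\<^sup>2)" "0 \<le> a"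
    "(\<integral>\<omega>. (norm (X \<omega>))\<^sup>2 \<partial>M) \<le> a\<^sup>2"
  using assms by (auto simp: l2_le_def)

text \<open>Allows the Cauchy-Schwarz inequality to be proved with strictly positive bounds, where one may divide by them.\<close>

lemma le_eps_product:
  fixes P a b :: real
  assumes "\<And>e. e > 0 \<Longrightarrow> P \<le> (a + e) * (b + e)"
  shows "P \<le> a * b"
proof -
  have "((\<lambda>e. (a + e) * (b + e)) \<longlongrightarrow> (a + 0) * (b + 0)) (at_right 0)"
    by (intro tendsto_intros)
  moreover have "\<forall>\<^sub>F e in at_right 0. P \<le> (a + e) * (b + e)"
    using eventually_at_right_less[of "0::real"] by (rule eventually_mono) (rule assms)
  ultimately have "P \<le> (a + 0) * (b + 0)"
    by (rule tendsto_lowerbound) simp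
  then show ?thesis by simp
qed

lemma
  assumes X: "l2_le M X a" and Y: "l2_le M Y b"
  shows l2_le_norm_prod_integrable: "integrable M (\<lambda>\<omega>. norm (X \<omega>) * norm (Y \<omega>))"
    and l2_le_norm_prod: "(\<integral>\<omega>. norm (X \<omega>) * norm (Y \<omega>) \<partial>M) \<le> a * b"
proof -
  note [measurable] = l2_leD(1)[OF X] l2_leD(1)[OF Y]
  have "norm (X \<omega>) * norm (Y \<omega>) \<le> (norm (X \<omega>))\<^sup>2 + (norm (Y \<omega>))\<^sup>2" for \<omega>
    using sum_squares_bound[of "norm (X \<omega>)" "norm (Y \<omega>)"]
      mult_nonneg_nonneg[OF norm_ge_zero norm_ge_zero, of "X \<omega>" "Y \<omega>"] by linarith
  then show I: "integrable M (\<lambda>\<omega>. norm (X \<omega>) * norm (Y \<omega>))"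
    by (intro Bochner_Integration.integrable_bound[OF Bochner_Integration.integrable_add[OF l2_leD(2)[OF X] l2_leD(2)[OF Y]]]) auto
  show "(\<integral>\<omega>. norm (X \<omega>) * norm (Y \<omega>) \<partial>M) \<le> a * b"
  proof (rule le_eps_product)
    fix e :: real assume e: "e > 0"
    \<comment> \<open>Young's inequality with the weight that is optimal for the bounds \<open>p\<close> and \<open>q\<close>.\<close>
    define p q where "p = a + e" and "q = b + e"
    have pq: "p > 0" "q > 0" "a \<le> p" "b \<le> q" using e l2_leD(3)[OF X] l2_leD(3)[OF Y] by (auto simp: p_def q_def)
    have "norm (X \<omega>) * norm (Y \<omega>) \<le> q / (2 * p) * (norm (X \<omega>))\<^sup>2 + p / (2 * q) * (norm (Y \<omega>))\<^sup>2" for \<omega>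
    proof -
      have "0 \<le> (q * norm (X \<omega>) - p * norm (Y \<omega>))\<^sup>2 / (2 * p * q)" using pq by simp
      also have "\<dots> = q / (2 * p) * (norm (X \<omega>))\<^sup>2 + p / (2 * q) * (norm (Y \<omega>))\<^sup>2 - norm (X \<omega>) * norm (Y \<omega>)"
        using pq by (simp add: field_simps power2_eq_square)
      finally show ?thesis by simp
    qed
    then have "(\<integral>\<omega>. norm (X \<omega>) * norm (Y \<omega>) \<partial>M) \<le>
        (\<integral>\<omega>. q / (2 * p) * (norm (X \<omega>))\<^sup>2 + p / (2 * q) * (norm (Y \<omega>))\<^sup>2 \<partial>M)"
      using I l2_leD(2)[OF X] l2_leD(2)[OF Y] by (intro integral_mono) auto
    also have "\<dots> = q / (2 * p) * (\<integral>\<omega>. (norm (X \<omega>))\<^sup>2 \<partial>M) + p / (2 * q) * (\<integral>\<omega>. (norm (Y \<omega>))\<^sup>2 \<partial>M)"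
      using l2_leD(2)[OF X] l2_leD(2)[OF Y] by simp
    also have "\<dots> \<le> q / (2 * p) * p\<^sup>2 + p / (2 * q) * q\<^sup>2"
      using pq l2_leD(3,4)[OF X] l2_leD(3,4)[OF Y]
      by (intro add_mono mult_left_mono) (auto intro: order_trans power_mono)
    also have "\<dots> = p * q" using pq by (simp add: power2_eq_square)
    finally show "(\<integral>\<omega>. norm (X \<omega>) * norm (Y \<omega>) \<partial>M) \<le> (a + e) * (b + e)" by (simp add: p_def q_def)
  qed
qed

lemma
  assumes X: "l2_le M X a" and Y: "l2_le M Y b"
  shows l2_le_inner_integrable: "integrable M (\<lambda>\<omega>. X \<omega> \<bullet> Y \<omega>)"
    and l2_le_inner: "(\<integral>\<omega>. X \<omega> \<bullet> Y \<omega> \<partial>M) \<le> a * b"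
proof -
  note [measurable] = l2_leD(1)[OF X] l2_leD(1)[OF Y]
  show I: "integrable M (\<lambda>\<omega>. X \<omega> \<bullet> Y \<omega>)"
    by (rule Bochner_Integration.integrable_bound[OF l2_le_norm_prod_integrable[OF X Y]])
       (auto simp: Cauchy_Schwarz_ineq2)
  have "(\<integral>\<omega>. X \<omega> \<bullet> Y \<omega> \<partial>M) \<le> (\<integral>\<omega>. norm (X \<omega>) * norm (Y \<omega>) \<partial>M)"
    using I l2_le_norm_prod_integrable[OF X Y] by (intro integral_mono) (auto intro: norm_cauchy_schwarz)
  then show "(\<integral>\<omega>. X \<omega> \<bullet> Y \<omega> \<partial>M) \<le> a * b" using l2_le_norm_prod[OF X Y] by simp
qed

lemma norm_add_square: "(norm (x + y))\<^sup>2 = (norm x)\<^sup>2 + 2 * (x \<bullet> y) + (norm (y::'a::real_inner))\<^sup>2"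
  by (simp add: power2_norm_eq_inner inner_add_left inner_add_right inner_commute)

lemma
  assumes X: "l2_le M X a" and Y: "l2_le M Y b"
  shows l2_le_add_integrable: "integrable M (\<lambda>\<omega>. (norm (X \<omega> + Y \<omega>))\<^sup>2)"
    and l2_le_add_integral: "(\<integral>\<omega>. (norm (X \<omega> + Y \<omega>))\<^sup>2 \<partial>M) =
      (\<integral>\<omega>. (norm (X \<omega>))\<^sup>2 \<partial>M) + 2 * (\<integral>\<omega>. X \<omega> \<bullet> Y \<omega> \<partial>M) + (\<integral>\<omega>. (norm (Y \<omega>))\<^sup>2 \<partial>M)"
  unfolding norm_add_square
  using l2_leD(2)[OF X] l2_leD(2)[OF Y] l2_le_inner_integrable[OF X Y] by simp_all

lemma l2_le_add:
  assumes X: "l2_le M X a" and Y: "l2_le M Y b"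
  shows "l2_le M (\<lambda>\<omega>. X \<omega> + Y \<omega>) (a + b)"
  unfolding l2_le_def l2_le_add_integral[OF X Y]
  using l2_leD[OF X] l2_leD[OF Y] l2_le_inner[OF X Y] l2_le_add_integrable[OF X Y]
  by (auto simp: power2_sum)

lemma l2_le_orthogonal_add:
  assumes X: "l2_le M X a" and Y: "l2_le M Y b" and "(\<integral>\<omega>. X \<omega> \<bullet> Y \<omega> \<partial>M) = 0"
  shows "l2_le M (\<lambda>\<omega>. X \<omega> + Y \<omega>) (sqrt (a\<^sup>2 + b\<^sup>2))"
  unfolding l2_le_def l2_le_add_integral[OF X Y]
  using l2_leD[OF X] l2_leD[OF Y] assms(3) l2_le_add_integrable[OF X Y]
  by auto

lemma l2_le_mono: "l2_le M X a \<Longrightarrow> a \<le> b \<Longrightarrow> l2_le M X b"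
  unfolding l2_le_def by (auto intro: order_trans power_mono)

lemma l2_le_dominated:
  assumes X: "l2_le M X a" and Y: "Y \<in> borel_measurable M" and "0 \<le> K"
    and d: "AE \<omega> in M. norm (Y \<omega>) \<le> K * norm (X \<omega>)"
  shows "l2_le M Y (K * a)"
proof -
  have d2: "AE \<omega> in M. (norm (Y \<omega>))\<^sup>2 \<le> K\<^sup>2 * (norm (X \<omega>))\<^sup>2"
    using d by eventually_elim (metis norm_ge_zero power_mono power_mult_distrib)
  have I: "integrable M (\<lambda>\<omega>. (norm (Y \<omega>))\<^sup>2)"
    using d2 Y by (intro Bochner_Integration.integrable_bound[OF integrable_mult_right[OF l2_leD(2)[OF X], of "K\<^sup>2"]]) auto
  have "(\<integral>\<omega>. (norm (Y \<omega>))\<^sup>2 \<partial>M) \<le> (\<integral>\<omega>. K\<^sup>2 * (norm (X \<omega>))\<^sup>2 \<partial>M)"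
    using I d2 l2_leD(2)[OF X] by (intro integral_mono_AE) auto
  also have "\<dots> \<le> K\<^sup>2 * a\<^sup>2" using l2_leD(4)[OF X] by (simp add: mult_left_mono)
  finally show ?thesis using Y I assms(3) l2_leD(3)[OF X] by (auto simp: l2_le_def power_mult_distrib)
qed

lemma l2_le_scaleR:
  assumes "l2_le M X a"
  shows "l2_le M (\<lambda>\<omega>. k *\<^sub>R X \<omega>) (\<bar>k\<bar> * a)"
  using l2_leD(1)[OF assms] by (intro l2_le_dominated[OF assms]) auto

lemma l2_le_minus: "l2_le M X a \<Longrightarrow> l2_le M (\<lambda>\<omega>. - X \<omega>) a"
  using l2_le_scaleR[of M X a "-1"] by simp

lemma l2_le_diff: "l2_le M X a \<Longrightarrow> l2_le M Y b \<Longrightarrow> l2_le M (\<lambda>\<omega>. X \<omega> - Y \<omega>) (a + b)"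
  using l2_le_add[of M X a "\<lambda>\<omega>. - Y \<omega>" b] l2_le_minus[of M Y b] by simp

lemma l2_le_zero: "l2_le M (\<lambda>_. 0) 0"
  by (simp add: l2_le_def)

lemma l2_le_sum:
  assumes "\<And>i. i \<in> I \<Longrightarrow> l2_le M (X i) (a i)"
  shows "l2_le M (\<lambda>\<omega>. \<Sum>i\<in>I. X i \<omega>) (\<Sum>i\<in>I. a i)"
  using assms by (induction I rule: infinite_finite_induct) (auto intro: l2_le_add l2_le_zero)

lemma l2_le_cong:
  assumes "l2_le M X a" "\<And>\<omega>. \<omega> \<in> space M \<Longrightarrow> X \<omega> = Y \<omega>"
  shows "l2_le M Y a"
proof -
  have "Y \<in> borel_measurable M" using l2_leD(1)[OF assms(1)] assms(2) measurable_cong[of M X Y] by blast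
  from l2_le_dominated[OF assms(1) this, of 1] assms(2) show ?thesis by (auto intro!: AE_I2)
qed

lemma (in prob_space) l2_le_bounded:
  assumes "X \<in> borel_measurable M" "AE \<omega> in M. norm (X \<omega>) \<le> K" "0 \<le> K"
  shows "l2_le M X K"
proof -
  have "l2_le M (\<lambda>_. 1::real) 1" by (simp add: l2_le_def prob_space)
  then have 1: "l2_le M (\<lambda>_. SOME b::'b. b \<in> Basis) 1"
    using SOME_Basis by (auto simp: l2_le_def)
  have n: "norm (SOME b::'b. b \<in> Basis) = 1" using SOME_Basis by auto
  from l2_le_dominated[OF 1 assms(1) assms(3)] assms(2) show ?thesis unfolding n by simp
qed

lemma l2_le_orthogonal_sum:
  assumes "finite I" and X: "\<And>i. i \<in> I \<Longrightarrow> l2_le M (X i) (a i)"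
    and orth: "\<And>i j. i \<in> I \<Longrightarrow> j \<in> I \<Longrightarrow> i \<noteq> j \<Longrightarrow> (\<integral>\<omega>. X i \<omega> \<bullet> X j \<omega> \<partial>M) = 0"
  shows "l2_le M (\<lambda>\<omega>. \<Sum>i\<in>I. X i \<omega>) (sqrt (\<Sum>i\<in>I. (a i)\<^sup>2))"
  using assms
proof (induction I rule: finite_induct)
  case (insert i I)
  have S: "l2_le M (\<lambda>\<omega>. \<Sum>j\<in>I. X j \<omega>) (sqrt (\<Sum>j\<in>I. (a j)\<^sup>2))"
    using insert by auto
  have "(\<integral>\<omega>. X i \<omega> \<bullet> (\<Sum>j\<in>I. X j \<omega>) \<partial>M) = (\<Sum>j\<in>I. \<integral>\<omega>. X i \<omega> \<bullet> X j \<omega> \<partial>M)"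
    unfolding inner_sum_right using insert
    by (intro Bochner_Integration.integral_sum l2_le_inner_integrable[of M _ "a i" _ "a _"]) auto
  also have "\<dots> = 0" using insert by (intro sum.neutral) auto
  finally have "l2_le M (\<lambda>\<omega>. X i \<omega> + (\<Sum>j\<in>I. X j \<omega>)) (sqrt ((a i)\<^sup>2 + (sqrt (\<Sum>j\<in>I. (a j)\<^sup>2))\<^sup>2))"
    using insert by (intro l2_le_orthogonal_add[OF _ S]) auto
  then show ?case using insert by (simp add: sum_nonneg)
qed (simp add: l2_le_zero)

lemma norm_sq_weighted_sum_le:
  fixes a :: "'i \<Rightarrow> 'a::real_inner"
  assumes w: "\<And>i. i \<in> I \<Longrightarrow> 0 \<le> w i" "(\<Sum>i\<in>I. w i) = 1"
  shows "(norm (\<Sum>i\<in>I. w i *\<^sub>R a i))\<^sup>2 \<le> (\<Sum>i\<in>I. w i * (norm (a i))\<^sup>2)"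
proof -
  define s where "s = (\<Sum>i\<in>I. w i *\<^sub>R a i)"
  have "0 \<le> (\<Sum>i\<in>I. w i * (norm (a i - s))\<^sup>2)" using w by (intro sum_nonneg) auto
  also have "\<dots> = (\<Sum>i\<in>I. w i * (norm (a i))\<^sup>2 - 2 * ((w i *\<^sub>R a i) \<bullet> s) + w i * (norm s)\<^sup>2)"
    by (intro sum.cong) (auto simp: power2_norm_eq_inner inner_diff_left inner_diff_right inner_commute algebra_simps)
  also have "\<dots> = (\<Sum>i\<in>I. w i * (norm (a i))\<^sup>2) - 2 * (s \<bullet> s) + (norm s)\<^sup>2"
  proof -
    have "(\<Sum>i\<in>I. w i *\<^sub>R a i) \<bullet> s = (\<Sum>i\<in>I. (w i *\<^sub>R a i) \<bullet> s)" by (rule inner_sum_left)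
    then have "(\<Sum>i\<in>I. (w i *\<^sub>R a i) \<bullet> s) = s \<bullet> s" by (simp add: s_def)
    then show ?thesis
      using w(2) by (simp only: sum.distrib sum_subtractf sum_distrib_left[symmetric] sum_distrib_right[symmetric] mult_1)
  qed
  finally show ?thesis by (simp add: s_def power2_norm_eq_inner)
qed

section \<open>Conditionally independent innovations\<close>

lemma (in prob_space) finite_measure_subalgebraI:
  "subalgebra M G \<Longrightarrow> finite_measure_subalgebra M G"
  by (simp add: finite_measure_subalgebra_def finite_measure_subalgebra_axioms_def finite_measure_axioms)

text \<open>Additivity when integrability is known only for the summands in the index set.\<close>

lemma (in sigma_finite_subalgebra) real_cond_exp_sum_on:
  fixes f :: "'b \<Rightarrow> 'a \<Rightarrow> real"
  assumes "\<And>i. i \<in> I \<Longrightarrow> integrable M (f i)"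
  shows "AE x in M. real_cond_exp M F (\<lambda>x. \<Sum>i\<in>I. f i x) x = (\<Sum>i\<in>I. real_cond_exp M F (f i) x)"
proof -
  have "AE x in M. real_cond_exp M F (\<lambda>x. \<Sum>i\<in>I. (if i \<in> I then f i else (\<lambda>_. 0)) x) x =
      (\<Sum>i\<in>I. real_cond_exp M F (if i \<in> I then f i else (\<lambda>_. 0)) x)"
    using assms by (intro real_cond_exp_sum) auto
  then show ?thesis by (simp cong: sum.cong)
qed

lemma (in prob_space) integral_eq_0_on_sigma_sets:
  fixes f :: "'a \<Rightarrow> real"
  assumes f: "integrable M f" and P: "P \<subseteq> sets M" "Int_stable P"
    and base: "\<And>A. A \<in> P \<Longrightarrow> (\<integral>\<omega>. indicator A \<omega> * f \<omega> \<partial>M) = 0"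
    and top: "space M \<in> P"
    and A: "A \<in> sigma_sets (space M) P"
  shows "(\<integral>\<omega>. indicator A \<omega> * f \<omega> \<partial>M) = 0"
proof -
  have PM: "P \<subseteq> Pow (space M)" using P(1) sets.space_closed by blast
  have sub: "A \<in> sets M" if "A \<in> sigma_sets (space M) P" for A
    using that P(1) sets.sigma_sets_subset by blast
  have I: "integrable M (\<lambda>\<omega>. indicator A \<omega> * f \<omega>)" if "A \<in> sets M" for A
    using f that by (simp add: integrable_real_mult_indicator mult.commute)
  show ?thesis
    using P(2) PM A
  proof (induction A rule: sigma_sets_induct_disjoint)
    case (basic A) then show ?case by (rule base)
  next
    case empty show ?case by simp
  next
    case (compl A)
    have "(\<integral>\<omega>. indicator (space M - A) \<omega> * f \<omega> \<partial>M) =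
      (\<integral>\<omega>. indicator (space M) \<omega> * f \<omega> - indicator A \<omega> * f \<omega> \<partial>M)"
      by (rule Bochner_Integration.integral_cong) (auto simp: indicator_def)
    also have "\<dots> = 0" using I[OF sub[OF compl(1)]] I[of "space M"] compl(2) base[OF top]
      by (subst Bochner_Integration.integral_diff) auto
    finally show ?case .
  next
    case (union A)
    have AM: "A i \<in> sets M" for i using union(2) sub by blast
    have "(LINT \<omega>:(\<Union>i. A i)|M. f \<omega>) = (\<Sum>i. (LINT \<omega>:(A i)|M. f \<omega>))"
      using union(1) AM I[of "\<Union>i. A i"]
      by (intro lebesgue_integral_countable_add) (auto simp: disjoint_family_on_def set_integrable_def)
    then show ?case using union(3) by (simp add: set_lebesgue_integral_def)
  qed
qed

text \<open>
  Let \<open>X\<close> be a random element with finitely many values, and let \<open>f\<close> be a function of \<open>X\<close> and of the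
  \<open>\<sigma>\<close>-algebra \<open>G\<close> that has conditional mean zero given \<open>G\<close>. If the event \<open>E\<close> is conditionally
  independent of \<open>X\<close> given \<open>G\<close>, then \<open>f\<close> still integrates to zero over the intersection of \<open>E\<close> with each
  event of \<open>G\<close>. The factor \<open>p\<close> plays the role of the conditional probability of \<open>E\<close>, but any
  function for which the factorisation holds will do.
\<close>

lemma (in prob_space) cond_mean_zero_cond_indep:
  fixes f :: "'k \<Rightarrow> 'a \<Rightarrow> real"
  assumes G: "subalgebra M G" and K: "finite K" and X: "X \<in> M \<rightarrow>\<^sub>M count_space K"
    and f: "\<And>S. S \<in> K \<Longrightarrow> f S \<in> borel_measurable G" "\<And>S. S \<in> K \<Longrightarrow> integrable M (f S)"
    and E: "E \<in> sets M" and Cs: "Cs \<in> sets G"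
    and ind: "\<And>S. S \<in> K \<Longrightarrow> AE \<omega> in M. real_cond_exp M G (indicator (X -` {S} \<inter> space M \<inter> E)) \<omega> =
       real_cond_exp M G (indicator (X -` {S} \<inter> space M)) \<omega> * p \<omega>"
    and zero: "AE \<omega> in M. real_cond_exp M G (\<lambda>\<omega>. f (X \<omega>) \<omega>) \<omega> = 0"
  shows "(\<integral>\<omega>. indicator (Cs \<inter> E) \<omega> * f (X \<omega>) \<omega> \<partial>M) = 0"
proof -
  interpret finite_measure_subalgebra M G using finite_measure_subalgebraI[OF G] .
  define D where "D S = X -` {S} \<inter> space M" for S
  have D[measurable]: "D S \<in> sets M" if "S \<in> K" for S
    unfolding D_def using measurable_sets[OF X, of "{S}"] that by auto
  have CM: "Cs \<in> sets M" using Cs G by (auto simp: subalgebra_def)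
  have XK: "X \<omega> \<in> K" if "\<omega> \<in> space M" for \<omega> using measurable_space[OF X that] by simp
  have fsum: "f (X \<omega>) \<omega> = (\<Sum>S\<in>K. f S \<omega> * indicator (D S) \<omega>)" if "\<omega> \<in> space M" for \<omega>
  proof -
    have "(\<Sum>S\<in>K. f S \<omega> * indicator (D S) \<omega>) = (\<Sum>S\<in>K. if S = X \<omega> then f S \<omega> else 0)"
      using that by (intro sum.cong) (auto simp: D_def)
    then show ?thesis using XK[OF that] K by simp
  qed
  have int1: "integrable M (\<lambda>\<omega>. f S \<omega> * indicator (D S) \<omega>)" if "S \<in> K" for S
    using f(2)[OF that] D[OF that] by (rule integrable_real_mult_indicator[rotated])
  have int2: "integrable M (\<lambda>\<omega>. (indicator Cs \<omega> * f S \<omega>) * indicator (D S \<inter> E) \<omega>)" if "S \<in> K" for S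
    using integrable_real_mult_indicator[OF CM f(2)[OF that]] D[OF that] E
    by (intro integrable_real_mult_indicator) (auto simp: mult.commute)
  have A: "AE \<omega> in M. real_cond_exp M G (\<lambda>\<omega>. f (X \<omega>) \<omega>) \<omega> =
      (\<Sum>S\<in>K. f S \<omega> * real_cond_exp M G (indicator (D S)) \<omega>)"
  proof -
    have "AE \<omega> in M. real_cond_exp M G (\<lambda>\<omega>. f (X \<omega>) \<omega>) \<omega> =
        real_cond_exp M G (\<lambda>\<omega>. \<Sum>S\<in>K. f S \<omega> * indicator (D S) \<omega>) \<omega>"
    proof (rule real_cond_exp_cong)
      show m: "(\<lambda>\<omega>. \<Sum>S\<in>K. f S \<omega> * indicator (D S) \<omega>) \<in> borel_measurable M"
        using int1 by (intro borel_measurable_sum) (auto intro: borel_measurable_integrable)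
      show "(\<lambda>\<omega>. f (X \<omega>) \<omega>) \<in> borel_measurable M"
        by (rule iffD2[OF measurable_cong m]) (rule fsum)
    qed (simp add: fsum)
    moreover have "AE \<omega> in M. real_cond_exp M G (\<lambda>\<omega>. \<Sum>S\<in>K. f S \<omega> * indicator (D S) \<omega>) \<omega> =
       (\<Sum>S\<in>K. real_cond_exp M G (\<lambda>\<omega>. f S \<omega> * indicator (D S) \<omega>) \<omega>)"
      using int1 by (rule real_cond_exp_sum_on)
    moreover have "AE \<omega> in M. \<forall>S\<in>K. real_cond_exp M G (\<lambda>\<omega>. f S \<omega> * indicator (D S) \<omega>) \<omega> =
       f S \<omega> * real_cond_exp M G (indicator (D S)) \<omega>"
      using K f(1) D int1 by (intro AE_finite_allI real_cond_exp_mult) auto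
    ultimately show ?thesis by eventually_elim auto
  qed
  have ind': "AE \<omega> in M. \<forall>S\<in>K. real_cond_exp M G (indicator (D S \<inter> E)) \<omega> = real_cond_exp M G (indicator (D S)) \<omega> * p \<omega>"
    using K ind by (intro AE_finite_allI) (auto simp: D_def)
  let ?h = "\<lambda>\<omega>. indicator (Cs \<inter> E) \<omega> * f (X \<omega>) \<omega>"
  have hsum: "?h \<omega> = (\<Sum>S\<in>K. (indicator Cs \<omega> * f S \<omega>) * indicator (D S \<inter> E) \<omega>)" if "\<omega> \<in> space M" for \<omega>
    unfolding fsum[OF that] by (auto simp: sum_distrib_left indicator_def intro!: sum.cong)
  have hI: "integrable M (\<lambda>\<omega>. \<Sum>S\<in>K. (indicator Cs \<omega> * f S \<omega>) * indicator (D S \<inter> E) \<omega>)"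
    using int2 by (rule Bochner_Integration.integrable_sum)
  have "AE \<omega> in M. real_cond_exp M G (\<lambda>\<omega>. \<Sum>S\<in>K. (indicator Cs \<omega> * f S \<omega>) * indicator (D S \<inter> E) \<omega>) \<omega> = 0"
  proof -
    have "AE \<omega> in M. real_cond_exp M G (\<lambda>\<omega>. \<Sum>S\<in>K. (indicator Cs \<omega> * f S \<omega>) * indicator (D S \<inter> E) \<omega>) \<omega> =
       (\<Sum>S\<in>K. real_cond_exp M G (\<lambda>\<omega>. (indicator Cs \<omega> * f S \<omega>) * indicator (D S \<inter> E) \<omega>) \<omega>)"
      using int2 by (rule real_cond_exp_sum_on)
    moreover have "AE \<omega> in M. \<forall>S\<in>K. real_cond_exp M G (\<lambda>\<omega>. (indicator Cs \<omega> * f S \<omega>) * indicator (D S \<inter> E) \<omega>) \<omega> =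
       (indicator Cs \<omega> * f S \<omega>) * real_cond_exp M G (indicator (D S \<inter> E)) \<omega>"
      using K f(1) D E Cs int2 by (intro AE_finite_allI real_cond_exp_mult) auto
    ultimately show ?thesis using A zero ind'
    proof eventually_elim
      case (elim \<omega>)
      have "(\<Sum>S\<in>K. real_cond_exp M G (\<lambda>\<omega>. (indicator Cs \<omega> * f S \<omega>) * indicator (D S \<inter> E) \<omega>) \<omega>) =
        (\<Sum>S\<in>K. (indicator Cs \<omega> * p \<omega>) * (f S \<omega> * real_cond_exp M G (indicator (D S)) \<omega>))"
        using elim by (intro sum.cong) (auto simp: mult_ac)
      then show ?case using elim by (simp add: sum_distrib_left[symmetric])
    qed
  qed
  then have "(\<integral>\<omega>. real_cond_exp M G (\<lambda>\<omega>. \<Sum>S\<in>K. (indicator Cs \<omega> * f S \<omega>) * indicator (D S \<inter> E) \<omega>) \<omega> \<partial>M) = 0"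
    by (rule integral_eq_zero_AE)
  then have "(\<integral>\<omega>. (\<Sum>S\<in>K. (indicator Cs \<omega> * f S \<omega>) * indicator (D S \<inter> E) \<omega>) \<partial>M) = 0"
    using real_cond_exp_int(2)[OF hI] by simp
  then show ?thesis using hsum by (simp cong: Bochner_Integration.integral_cong)
qed

text \<open>A random variable whose integral vanishes over each set of \<open>G\<close> is orthogonal to the random vectors measurable in \<open>G\<close>.\<close>

lemma (in prob_space) orthogonal_if_integrals_zero:
  fixes X W :: "'a \<Rightarrow> 'b::euclidean_space"
  assumes G: "subalgebra M G" and X: "l2_le M X a" and W: "l2_le M W b" "W \<in> borel_measurable G"
    and zero: "\<And>A e. A \<in> sets G \<Longrightarrow> e \<in> Basis \<Longrightarrow> (\<integral>\<omega>. indicator A \<omega> * (X \<omega> \<bullet> e) \<partial>M) = 0"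
  shows "(\<integral>\<omega>. W \<omega> \<bullet> X \<omega> \<partial>M) = 0"
proof -
  interpret finite_measure_subalgebra M G using finite_measure_subalgebraI[OF G] .
  have eb: "l2_le M (\<lambda>_. e) 1" if "e \<in> Basis" for e :: 'b
    using that by (intro l2_le_bounded) auto
  have comp: "l2_le M (\<lambda>\<omega>. (Z \<omega> \<bullet> e)) c" if "l2_le M Z c" "e \<in> Basis" for Z :: "'a \<Rightarrow> 'b" and c e
    using l2_le_dominated[OF that(1), of "\<lambda>\<omega>. Z \<omega> \<bullet> e" 1] l2_leD(1)[OF that(1)] that(2)
    by (auto simp: Basis_le_norm)
  have z: "(\<integral>\<omega>. (W \<omega> \<bullet> e) * (X \<omega> \<bullet> e) \<partial>M) = 0" if e: "e \<in> Basis" for e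
  proof -
    have I: "integrable M (\<lambda>\<omega>. X \<omega> \<bullet> e)" using l2_le_inner_integrable[OF X eb[OF e]] .
    have IW: "integrable M (\<lambda>\<omega>. (W \<omega> \<bullet> e) * (X \<omega> \<bullet> e))"
      using l2_le_inner_integrable[OF comp[OF W(1) e] comp[OF X e]] by simp
    have ae: "AE \<omega> in M. real_cond_exp M G (\<lambda>\<omega>. X \<omega> \<bullet> e) \<omega> = 0"
      by (rule real_cond_exp_charact) (use zero[OF _ e] I in \<open>auto simp: set_lebesgue_integral_def\<close>)
    have "(\<integral>\<omega>. (W \<omega> \<bullet> e) * (X \<omega> \<bullet> e) \<partial>M) = (\<integral>\<omega>. (W \<omega> \<bullet> e) * real_cond_exp M G (\<lambda>\<omega>. X \<omega> \<bullet> e) \<omega> \<partial>M)"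
      using IW W(2) I by (intro real_cond_exp_intg(2)[symmetric]) auto
    also have "\<dots> = 0" using ae by (intro integral_eq_zero_AE) auto
    finally show ?thesis .
  qed
  have "(\<integral>\<omega>. W \<omega> \<bullet> X \<omega> \<partial>M) = (\<Sum>e\<in>Basis. \<integral>\<omega>. (W \<omega> \<bullet> e) * (X \<omega> \<bullet> e) \<partial>M)"
  proof -
    have "(\<integral>\<omega>. W \<omega> \<bullet> X \<omega> \<partial>M) = (\<integral>\<omega>. (\<Sum>e\<in>Basis. (W \<omega> \<bullet> e) * (X \<omega> \<bullet> e)) \<partial>M)"
      by (rule Bochner_Integration.integral_cong[OF refl]) (rule euclidean_inner)
    also have "\<dots> = (\<Sum>e\<in>Basis. \<integral>\<omega>. (W \<omega> \<bullet> e) * (X \<omega> \<bullet> e) \<partial>M)"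
      using l2_le_inner_integrable[OF comp[OF W(1)] comp[OF X]]
      by (intro Bochner_Integration.integral_sum) auto
    finally show ?thesis .
  qed
  then show ?thesis using z by simp
qed

section \<open>The algorithm and its histories\<close>

lemma finite_minibatches: "finite (minibatches m b i)"
  by (rule finite_subset[of _ "Pow {..<m i}"]) (auto simp: minibatches_def)

lemma borel_measurable_minibatch_grad:
  assumes g: "\<And>j. j < m i \<Longrightarrow> smooth_fun L (\<phi> i j)"
    and S: "S \<in> G \<rightarrow>\<^sub>M count_space (minibatches m b i)" and Y: "Y \<in> borel_measurable G"
  shows "(\<lambda>\<omega>. minibatch_grad \<phi> b i (S \<omega>) (Y \<omega>)) \<in> borel_measurable G"
proof (rule measurable_compose_countable'[OF _ S])
  fix T assume T: "T \<in> minibatches m b i"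
  have "(\<lambda>\<omega>. grad (\<phi> i j) (Y \<omega>)) \<in> borel_measurable G" if "j \<in> T" for j
    using smooth_fun_continuous_grad[OF g] that T
    by (intro measurable_compose[OF Y] borel_measurable_continuous_onI) (auto simp: minibatches_def)
  then show "(\<lambda>\<omega>. minibatch_grad \<phi> b i T (Y \<omega>)) \<in> borel_measurable G"
    unfolding minibatch_grad_def by (intro borel_measurable_scaleR borel_measurable_sum) auto
qed (simp add: countable_finite finite_minibatches)

text \<open>
  A run of the algorithm with weights in the simplex and amplitudes that are positive and at most \<open>\<theta>hi\<close>.
\<close>

locale hew_run = prob_space M
  for M :: "'w measure" +
  fixes \<phi> :: "'n::finite \<Rightarrow> nat \<Rightarrow> 'a::euclidean_space \<Rightarrow> real"
    and m H b :: "'n \<Rightarrow> nat"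
    and L R \<theta>hi :: real
    and xs :: "'a"
    and B :: "nat \<Rightarrow> 'n \<Rightarrow> nat \<Rightarrow> 'w \<Rightarrow> nat set"
    and x cb :: "nat \<Rightarrow> 'w \<Rightarrow> 'a"
    and y :: "nat \<Rightarrow> 'n \<Rightarrow> nat \<Rightarrow> 'w \<Rightarrow> 'a"
    and c :: "nat \<Rightarrow> 'n \<Rightarrow> 'w \<Rightarrow> 'a"
    and w \<theta> :: "nat \<Rightarrow> 'n \<Rightarrow> real"
  assumes L: "L > 0" and R: "R > 0"
    and H1: "\<And>i. 1 \<le> H i" and b1: "\<And>i. 1 \<le> b i" and bm: "\<And>i. b i \<le> m i"
    and \<theta>0: "\<And>t i. 0 < \<theta> t i" and \<theta>hi: "\<And>t i. \<theta> t i \<le> \<theta>hi" and \<theta>hi1: "\<theta>hi \<le> 1"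
    and w0: "\<And>t i. 0 \<le> w t i" and w1: "\<And>t. (\<Sum>i\<in>UNIV. w t i) = 1"
    and conv: "\<And>i j. j < m i \<Longrightarrow> convex_on UNIV (\<phi> i j)"
    and smooth: "\<And>i j. j < m i \<Longrightarrow> smooth_fun L (\<phi> i j)"
    and argmin: "is_arg_min (global_obj \<phi> m) (\<lambda>_. True) xs"
    and x0: "x 0 \<in> borel_measurable M" and c0: "\<And>i. c 0 i \<in> borel_measurable M"
    and Bm: "\<And>t i l. l < H i \<Longrightarrow> B t i l \<in> M \<rightarrow>\<^sub>M count_space (minibatches m b i)"
    and alg: "hew_local_sgd \<phi> H b L M w \<theta> B x y c cb"
    and ball: "AE \<omega> in M. \<forall>t i l. l \<le> H i \<longrightarrow> x t \<omega> \<in> cball xs R \<and> y t i l \<omega> \<in> cball xs R"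
    and sampling: "minibatch_sampling \<phi> m H b xs R M B x y c"
begin

abbreviation gF :: "'n \<Rightarrow> 'a \<Rightarrow> 'a" where "gF i \<equiv> grad (node_obj \<phi> m i)"
abbreviation FF :: "'a \<Rightarrow> real" where "FF \<equiv> global_obj \<phi> m"
abbreviation gFF :: "'a \<Rightarrow> 'a" where "gFF \<equiv> grad (global_obj \<phi> m)"
abbreviation \<eta> :: "nat \<Rightarrow> 'n \<Rightarrow> real" where "\<eta> t i \<equiv> \<theta> t i / (L * real (H i))"

text \<open>The stochastic gradient of node \<open>i\<close> at local step \<open>l\<close> of round \<open>t\<close>.\<close>

definition gs :: "nat \<Rightarrow> 'n \<Rightarrow> nat \<Rightarrow> 'w \<Rightarrow> 'a" where
  "gs t i l \<omega> = minibatch_grad \<phi> b i (B t i l \<omega>) (y t i l \<omega>)"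

text \<open>Its noise, the deviation from the exact gradient of the node objective at the same point.\<close>

definition \<xi> :: "nat \<Rightarrow> 'n \<Rightarrow> nat \<Rightarrow> 'w \<Rightarrow> 'a" where
  "\<xi> t i l \<omega> = gs t i l \<omega> - gF i (y t i l \<omega>)"

lemma Hpos: "0 < real (H i)" "0 < H i" using H1[of i] by auto
lemma mpos: "0 < m i" using b1[of i] bm[of i] by auto
lemma bpos: "0 < real (b i)" using b1[of i] by auto
lemma \<theta>1: "\<theta> t i \<le> 1" using \<theta>hi \<theta>hi1 order_trans by blast
lemma \<eta>pos: "0 < \<eta> t i" using \<theta>0 L Hpos by simp
lemma \<eta>HL: "\<eta> t i * real (H i) = \<theta> t i / L" using Hpos(1)[of i] L by (simp add: field_simps)

subsection \<open>The objective\<close>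

lemma smooth_F: "smooth_fun L (node_obj \<phi> m i)"
  and gF_eq: "gF i z = (1 / real (m i)) *\<^sub>R (\<Sum>j<m i. grad (\<phi> i j) z)"
proof -
  have "node_obj \<phi> m i = (\<lambda>z. (\<Sum>j\<in>{..<m i}. \<phi> i j z) / real (card {..<m i}))"
    by (simp add: fun_eq_iff node_obj_def)
  moreover have "finite {..<m i}" "{..<m i} \<noteq> {}" "\<And>j. j \<in> {..<m i} \<Longrightarrow> smooth_fun L (\<phi> i j)"
    using mpos[of i] smooth by auto
  note smooth_average[OF this] grad_average[OF this]
  ultimately show "smooth_fun L (node_obj \<phi> m i)" "gF i z = (1 / real (m i)) *\<^sub>R (\<Sum>j<m i. grad (\<phi> i j) z)"
    by simp_all
qed

lemma convex_F: "convex_on UNIV (node_obj \<phi> m i)"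
proof -
  have "node_obj \<phi> m i = (\<lambda>z. (\<Sum>j\<in>{..<m i}. \<phi> i j z) / real (card {..<m i}))"
    by (simp add: fun_eq_iff node_obj_def)
  then show ?thesis using convex_on_average[of "{..<m i}" "\<phi> i"] conv by simp
qed

lemma FF_eq: "FF = (\<lambda>z. (\<Sum>i\<in>(UNIV::'n set). node_obj \<phi> m i z) / real (card (UNIV::'n set)))"
  by (simp add: fun_eq_iff global_obj_def)

lemma smooth_FF: "smooth_fun L FF"
  and gFF_eq: "gFF z = (1 / real CARD('n)) *\<^sub>R (\<Sum>i\<in>UNIV. gF i z)"
  unfolding FF_eq using smooth_average[of "UNIV::'n set" L "node_obj \<phi> m"]
    grad_average[of "UNIV::'n set" L "node_obj \<phi> m"] smooth_F by auto

lemma convex_FF: "convex_on UNIV FF"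
  unfolding FF_eq using convex_on_average[of "UNIV::'n set"] convex_F by auto

lemma gap_nonneg: "0 \<le> FF z - FF xs"
  using argmin by (auto simp: is_arg_min_def not_less)

lemma gFF_sq_le: "(norm (gFF z))\<^sup>2 \<le> 2 * L * (FF z - FF xs)"
proof -
  have "FF xs \<le> FF (z - (1 / L) *\<^sub>R gFF z)" using gap_nonneg by simp
  also have "\<dots> \<le> FF z + gFF z \<bullet> (- ((1 / L) *\<^sub>R gFF z)) + L / 2 * (norm ((1 / L) *\<^sub>R gFF z))\<^sup>2"
    using smooth_fun_descent[OF smooth_FF, of "z - (1 / L) *\<^sub>R gFF z" z] by simp
  also have "\<dots> = FF z - (norm (gFF z))\<^sup>2 / (2 * L)"
    using L by (simp add: power2_norm_eq_inner[symmetric] power_divide) (simp add: power2_eq_square field_simps)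
  finally show ?thesis using L by (simp add: field_simps)
qed

lemma gFF_xs: "gFF xs = 0" using gFF_sq_le[of xs] by simp

lemma gap_le_quadratic: "FF z - FF xs \<le> L / 2 * (norm (z - xs))\<^sup>2"
  using smooth_fun_descent[OF smooth_FF, of z xs] by (simp add: gFF_xs)

lemma gap_le_gradient: "FF z - FF xs \<le> norm (gFF z) * norm (z - xs)"
proof -
  have "FF z + gFF z \<bullet> (xs - z) \<le> FF xs" using convex_on_grad_le[OF convex_FF smooth_FF] .
  then have "FF z - FF xs \<le> gFF z \<bullet> (z - xs)" by (simp add: inner_diff_right)
  also have "\<dots> \<le> norm (gFF z) * norm (z - xs)" by (rule norm_cauchy_schwarz)
  finally show ?thesis .
qed

lemma gF_lipschitz: "norm (gF i z - gF i z') \<le> L * norm (z - z')"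
  using smooth_fun_lipschitz[OF smooth_F] .

lemma gF_measurable: "Y \<in> borel_measurable G \<Longrightarrow> (\<lambda>\<omega>. gF i (Y \<omega>)) \<in> borel_measurable G"
  using smooth_fun_continuous_grad[OF smooth_F]
  by (intro measurable_compose[of Y _ borel "gF i"] borel_measurable_continuous_onI)

lemma gFF_measurable: "Y \<in> borel_measurable G \<Longrightarrow> (\<lambda>\<omega>. gFF (Y \<omega>)) \<in> borel_measurable G"
  using smooth_fun_continuous_grad[OF smooth_FF]
  by (intro measurable_compose[of Y _ borel gFF] borel_measurable_continuous_onI)

lemma FF_measurable: "Y \<in> borel_measurable G \<Longrightarrow> (\<lambda>\<omega>. FF (Y \<omega>)) \<in> borel_measurable G"
  using smooth_fun_continuous[OF smooth_FF]
  by (intro measurable_compose[of Y _ borel FF] borel_measurable_continuous_onI)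

subsection \<open>The recursion\<close>

lemma
  assumes "\<omega> \<in> space M"
  shows y_0: "y t i 0 \<omega> = x t \<omega>"
    and y_Suc: "l < H i \<Longrightarrow> y t i (Suc l) \<omega> = y t i l \<omega> - \<eta> t i *\<^sub>R (gs t i l \<omega> - c t i \<omega> + cb t \<omega>)"
    and c_Suc: "c (Suc t) i \<omega> = c t i \<omega> - cb t \<omega> + (1 / (real (H i) * \<eta> t i)) *\<^sub>R (x t \<omega> - y t i (H i) \<omega>)"
    and x_Suc: "x (Suc t) \<omega> = x t \<omega> + (\<Sum>i\<in>UNIV. w t i *\<^sub>R (y t i (H i) \<omega> - x t \<omega>))"
    and cb_0: "cb 0 \<omega> = (1 / real CARD('n)) *\<^sub>R (\<Sum>i\<in>UNIV. c 0 i \<omega>)"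
    and cb_Suc: "cb (Suc t) \<omega> = cb t \<omega> + (1 / real CARD('n)) *\<^sub>R (\<Sum>i\<in>UNIV. c (Suc t) i \<omega> - c t i \<omega>)"
  using alg assms unfolding hew_local_sgd_def gs_def Let_def by blast+

text \<open>The global control is the mean of the node controls at all times.\<close>

lemma cb_eq: "\<omega> \<in> space M \<Longrightarrow> cb t \<omega> = (1 / real CARD('n)) *\<^sub>R (\<Sum>i\<in>UNIV. c t i \<omega>)"
  by (induction t) (simp_all add: cb_0 cb_Suc sum_subtractf scaleR_diff_right)

lemma y_eq:
  assumes "\<omega> \<in> space M"
  shows "l \<le> H i \<Longrightarrow> y t i l \<omega> = x t \<omega> - \<eta> t i *\<^sub>R (\<Sum>k<l. gs t i k \<omega> - c t i \<omega> + cb t \<omega>)"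
  by (induction l) (simp_all add: y_0[OF assms] y_Suc[OF assms] scaleR_add_right)

text \<open>The new control is the mean stochastic gradient of the round: the corrections cancel.\<close>

lemma c_Suc_eq:
  assumes "\<omega> \<in> space M"
  shows "c (Suc t) i \<omega> = (1 / real (H i)) *\<^sub>R (\<Sum>l<H i. gs t i l \<omega>)"
proof -
  have "(1 / (real (H i) * \<eta> t i)) *\<^sub>R (x t \<omega> - y t i (H i) \<omega>) =
      (1 / (real (H i) * \<eta> t i) * \<eta> t i) *\<^sub>R (\<Sum>k<H i. gs t i k \<omega> - c t i \<omega> + cb t \<omega>)"
    using y_eq[OF assms, of "H i" i t] by simp
  also have "1 / (real (H i) * \<eta> t i) * \<eta> t i = 1 / real (H i)"
    using \<theta>0[of t i] L Hpos(1)[of i] by (simp add: field_simps)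
  also have "(1 / real (H i)) *\<^sub>R (\<Sum>k<H i. gs t i k \<omega> - c t i \<omega> + cb t \<omega>) =
      (1 / real (H i)) *\<^sub>R (\<Sum>l<H i. gs t i l \<omega>) - c t i \<omega> + cb t \<omega>"
    using Hpos[of i] by (simp add: sum.distrib sum_subtractf sum_constant_scaleR scaleR_add_right scaleR_diff_right)
  finally show ?thesis unfolding c_Suc[OF assms] by simp
qed

subsection \<open>Measurability\<close>

abbreviation RH :: "nat \<Rightarrow> 'w measure" where "RH t \<equiv> round_history H M B (x 0) (c 0) t"
abbreviation LH :: "'n \<Rightarrow> nat \<Rightarrow> nat \<Rightarrow> 'w measure" where "LH i t l \<equiv> local_history H M B (x 0) (c 0) i t l"

text \<open>The local history of node \<open>i\<close> enlarged by all minibatches of the round drawn by the other nodes.\<close>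

definition others_history :: "'n \<Rightarrow> nat \<Rightarrow> nat \<Rightarrow> 'w measure" where
  "others_history i t l = sigma (space M)
     (sets (LH i t l) \<union> {B t j r -` S \<inter> space M | j r S. j \<noteq> i \<and> r < H j})"

lemma B_vimage: "l < H i \<Longrightarrow> B t i l -` S \<inter> space M \<in> sets M"
proof -
  assume l: "l < H i"
  have "B t i l -` S \<inter> space M = B t i l -` (S \<inter> minibatches m b i) \<inter> space M"
    using measurable_space[OF Bm[OF l]] by auto
  then show ?thesis using measurable_sets[OF Bm[OF l], of "S \<inter> minibatches m b i"] by simp
qed

lemma space_RH[simp]: "space (RH t) = space M" and space_LH[simp]: "space (LH i t l) = space M"
  and space_others_history[simp]: "space (others_history i t l) = space M"
  by (auto simp: round_history_def local_history_def others_history_def space_measure_of_conv)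

lemma sets_RH: "sets (RH t) = sigma_sets (space M)
     ({x 0 -` A \<inter> space M | A. A \<in> sets borel} \<union>
      {c 0 i -` A \<inter> space M | i A. A \<in> sets borel} \<union>
      {B s i l -` \<S> \<inter> space M | s i l \<S>. s < t \<and> l < H i})"
  unfolding round_history_def by (rule sets_measure_of) auto

lemma sets_LH: "sets (LH i t l) = sigma_sets (space M)
     (sets (RH t) \<union> {B t i k -` \<S> \<inter> space M | k \<S>. k < l})"
  unfolding local_history_def using sets.space_closed[of "RH t"] by (intro sets_measure_of) auto

lemma sets_others_history: "sets (others_history i t l) = sigma_sets (space M)
     (sets (LH i t l) \<union> {B t j r -` S \<inter> space M | j r S. j \<noteq> i \<and> r < H j})"
  unfolding others_history_def using sets.space_closed[of "LH i t l"] by (intro sets_measure_of) auto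

lemma RH_subset: "sets (RH t) \<subseteq> sets M"
  unfolding sets_RH
  using x0 c0 by (intro sets.sigma_sets_subset) (auto intro: B_vimage measurable_sets)

lemma LH_subset: "l \<le> H i \<Longrightarrow> sets (LH i t l) \<subseteq> sets M"
  unfolding sets_LH
  using RH_subset by (intro sets.sigma_sets_subset) (auto intro!: B_vimage)

lemma others_history_subset: "l \<le> H i \<Longrightarrow> sets (others_history i t l) \<subseteq> sets M"
  unfolding sets_others_history
  using LH_subset[of l i t] by (intro sets.sigma_sets_subset) (auto intro!: B_vimage)

lemma subalg_RH: "subalgebra M (RH t)"
  and subalg_LH: "l \<le> H i \<Longrightarrow> subalgebra M (LH i t l)"
  and subalg_others_history: "l \<le> H i \<Longrightarrow> subalgebra M (others_history i t l)"
  using RH_subset LH_subset others_history_subset by (simp_all add: subalgebra_def)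

lemma RH_LH: "sets (RH t) \<subseteq> sets (LH i t l)"
  unfolding sets_LH by auto

lemma LH_others: "sets (LH i t l) \<subseteq> sets (others_history i t l)"
  unfolding sets_others_history by auto

lemma LH_mono: "l \<le> l' \<Longrightarrow> sets (LH i t l) \<subseteq> sets (LH i t l')"
proof -
  assume "l \<le> l'"
  then have "{B t i k -` \<S> \<inter> space M | k \<S>. k < l} \<subseteq> {B t i k -` \<S> \<inter> space M | k \<S>. k < l'}"
    using less_le_trans by blast
  then show ?thesis unfolding sets_LH by (intro sigma_sets_mono' Un_mono order_refl)
qed

lemma LH_others_other: "j \<noteq> i \<Longrightarrow> l' \<le> H j \<Longrightarrow> sets (LH j t l') \<subseteq> sets (others_history i t l)"
proof -
  assume a: "j \<noteq> i" "l' \<le> H j"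
  have "sets (RH t) \<subseteq> sets (others_history i t l)" using RH_LH LH_others by blast
  moreover have "{B t j k -` \<S> \<inter> space M | k \<S>. k < l'} \<subseteq> sets (others_history i t l)"
    unfolding sets_others_history using a less_le_trans[of _ l' "H j"]
    by (intro subsetI sigma_sets.Basic UnI2) blast
  ultimately show ?thesis 
    unfolding sets_LH[of j t l'] using sets.sigma_sets_subset[of _ "others_history i t l"] by simp
qed

lemma RH_mono: "sets (RH t) \<subseteq> sets (RH (Suc t))"
proof -
  have "{B s i l -` \<S> \<inter> space M | s i l \<S>. s < t \<and> l < H i} \<subseteq>
      {B s i l -` \<S> \<inter> space M | s i l \<S>. s < Suc t \<and> l < H i}"
    using less_SucI by blast
  then show ?thesis unfolding sets_RH by (intro sigma_sets_mono' Un_mono order_refl)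
qed

lemma LH_RH_Suc: "sets (LH i t (H i)) \<subseteq> sets (RH (Suc t))"
proof -
  have "{B t i k -` \<S> \<inter> space M | k \<S>. k < H i} \<subseteq> sets (RH (Suc t))"
    unfolding sets_RH using lessI[of t] by (intro subsetI sigma_sets.Basic UnI2) blast
  then show ?thesis 
    unfolding sets_LH[of i t] using RH_mono[of t] sets.sigma_sets_subset[of _ "RH (Suc t)"] by simp
qed

lemma measurable_mono_sets:
  assumes "f \<in> borel_measurable G" "sets G \<subseteq> sets G'" "space G = space G'"
  shows "f \<in> borel_measurable G'"
  using assms by (auto simp: measurable_def)

lemma B_LH: "l < H i \<Longrightarrow> B t i l \<in> LH i t (Suc l) \<rightarrow>\<^sub>M count_space (minibatches m b i)"
proof (rule measurableI)
  fix \<omega> assume "l < H i" "\<omega> \<in> space (LH i t (Suc l))"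
  then show "B t i l \<omega> \<in> space (count_space (minibatches m b i))" using measurable_space[OF Bm] by simp
next
  fix A assume "l < H i"
  show "B t i l -` A \<inter> space (LH i t (Suc l)) \<in> sets (LH i t (Suc l))"
    unfolding sets_LH space_LH by (rule sigma_sets.Basic) auto
qed

lemma y_measurable:
  assumes a: "x t \<in> borel_measurable (RH t)" "c t i \<in> borel_measurable (RH t)" "cb t \<in> borel_measurable (RH t)"
  shows "l \<le> H i \<Longrightarrow> y t i l \<in> borel_measurable (LH i t l)"
proof (induction l)
  case 0
  have "x t \<in> borel_measurable (LH i t 0)" by (rule measurable_mono_sets[OF a(1) RH_LH]) simp
  then show ?case by (rule iffD2[OF measurable_cong, rotated]) (simp add: y_0)
next
  case (Suc l)
  have 1: "y t i l \<in> borel_measurable (LH i t (Suc l))"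
    using Suc by (intro measurable_mono_sets[OF Suc.IH LH_mono]) auto
  have 2: "gs t i l \<in> borel_measurable (LH i t (Suc l))"
    unfolding gs_def[abs_def] using Suc 1 by (intro borel_measurable_minibatch_grad[OF smooth B_LH]) auto
  have "c t i \<in> borel_measurable (LH i t (Suc l))" "cb t \<in> borel_measurable (LH i t (Suc l))"
    using measurable_mono_sets[OF a(2) RH_LH] measurable_mono_sets[OF a(3) RH_LH] by auto
  then have "(\<lambda>\<omega>. y t i l \<omega> - \<eta> t i *\<^sub>R (gs t i l \<omega> - c t i \<omega> + cb t \<omega>)) \<in> borel_measurable (LH i t (Suc l))"
    using 1 2 by measurable
  then show ?case by (rule iffD2[OF measurable_cong, rotated]) (use Suc in \<open>simp add: y_Suc\<close>)
qed

lemma state_measurable: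
  "x t \<in> borel_measurable (RH t) \<and> (\<forall>i. c t i \<in> borel_measurable (RH t)) \<and> cb t \<in> borel_measurable (RH t)"
proof (induction t)
  case 0
  have x: "x 0 \<in> borel_measurable (RH 0)"
    by (rule measurableI) (auto simp: sets_RH intro!: sigma_sets.Basic)
  have c: "c 0 i \<in> borel_measurable (RH 0)" for i
    by (rule measurableI) (auto simp: sets_RH intro!: sigma_sets.Basic)
  have "cb 0 \<in> borel_measurable (RH 0)"
    by (rule iffD2[OF measurable_cong borel_measurable_scaleR[OF borel_measurable_const borel_measurable_sum[of UNIV, OF c]]])
      (simp add: cb_0)
  then show ?case using x c by auto
next
  case (Suc t)
  let ?G = "RH (Suc t)"
  have p: "x t \<in> borel_measurable ?G" "\<And>i. c t i \<in> borel_measurable ?G" "cb t \<in> borel_measurable ?G"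
    using Suc by (auto intro: measurable_mono_sets[OF _ RH_mono])
  have y: "y t i (H i) \<in> borel_measurable ?G" for i
    using Suc by (intro measurable_mono_sets[OF y_measurable LH_RH_Suc]) auto
  have x: "x (Suc t) \<in> borel_measurable ?G"
  proof (rule iffD2[OF measurable_cong])
    show "(\<lambda>\<omega>. x t \<omega> + (\<Sum>i\<in>UNIV. w t i *\<^sub>R (y t i (H i) \<omega> - x t \<omega>))) \<in> borel_measurable ?G"
      using p y by measurable
  qed (simp add: x_Suc)
  have c: "c (Suc t) i \<in> borel_measurable ?G" for i
  proof (rule iffD2[OF measurable_cong])
    show "(\<lambda>\<omega>. c t i \<omega> - cb t \<omega> + (1 / (real (H i) * \<eta> t i)) *\<^sub>R (x t \<omega> - y t i (H i) \<omega>)) \<in> borel_measurable ?G"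
      using p y by measurable
  qed (simp only: c_Suc space_RH)
  have "cb (Suc t) \<in> borel_measurable ?G"
  proof (rule iffD2[OF measurable_cong])
    show "(\<lambda>\<omega>. (1 / real CARD('n)) *\<^sub>R (\<Sum>i\<in>UNIV. c (Suc t) i \<omega>)) \<in> borel_measurable ?G"
      using c by measurable
  qed (simp add: cb_eq)
  then show ?case using x c by auto
qed

lemma y_LH: "l \<le> H i \<Longrightarrow> y t i l \<in> borel_measurable (LH i t l)"
  using y_measurable state_measurable by blast

lemma x_M: "x t \<in> borel_measurable M" and c_M: "c t i \<in> borel_measurable M"
  using state_measurable[of t] measurable_from_subalg[OF subalg_RH] by blast+

lemma y_M: "l \<le> H i \<Longrightarrow> y t i l \<in> borel_measurable M"
  using measurable_from_subalg[OF subalg_LH y_LH] by blast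

lemma gs_LH: "l < H i \<Longrightarrow> gs t i l \<in> borel_measurable (LH i t (Suc l))"
  unfolding gs_def[abs_def]
  by (intro borel_measurable_minibatch_grad[OF smooth B_LH] measurable_mono_sets[OF y_LH LH_mono]) auto

lemma \<xi>_LH: "l < H i \<Longrightarrow> \<xi> t i l \<in> borel_measurable (LH i t (Suc l))"
  unfolding \<xi>_def[abs_def]
  by (intro borel_measurable_diff gs_LH gF_measurable measurable_mono_sets[OF y_LH LH_mono]) auto

lemma \<xi>_M: "l < H i \<Longrightarrow> \<xi> t i l \<in> borel_measurable M"
  using measurable_from_subalg[OF subalg_LH \<xi>_LH] by simp

end

context hew_run begin

subsection \<open>The stochastic gradient noise\<close>

text \<open>A bound on all gradients and minibatch gradients of node \<open>i\<close> in the ball.\<close>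

definition Kb :: "'n \<Rightarrow> real" where "Kb i = (\<Sum>j<m i. norm (grad (\<phi> i j) xs) + L * R)"

lemma Kb_nonneg: "0 \<le> Kb i"
  unfolding Kb_def using L R by (intro sum_nonneg) simp

lemma gphi_bound:
  assumes "j < m i" "z \<in> cball xs R"
  shows "norm (grad (\<phi> i j) z) \<le> norm (grad (\<phi> i j) xs) + L * R"
proof -
  have "norm (grad (\<phi> i j) z) \<le> norm (grad (\<phi> i j) xs) + norm (grad (\<phi> i j) z - grad (\<phi> i j) xs)"
    by (metis add.commute diff_add_cancel norm_triangle_ineq)
  also have "\<dots> \<le> norm (grad (\<phi> i j) xs) + L * norm (z - xs)"
    using smooth_fun_lipschitz[OF smooth[OF assms(1)]] by simp
  also have "\<dots> \<le> norm (grad (\<phi> i j) xs) + L * R"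
    using assms(2) L by (simp add: dist_norm norm_minus_commute)
  finally show ?thesis .
qed

lemma sum_gphi_bound:
  assumes "S \<subseteq> {..<m i}" "z \<in> cball xs R" "1 \<le> k"
  shows "norm ((1 / real k) *\<^sub>R (\<Sum>j\<in>S. grad (\<phi> i j) z)) \<le> Kb i"
proof -
  have "norm ((1 / real k) *\<^sub>R (\<Sum>j\<in>S. grad (\<phi> i j) z)) \<le> norm (\<Sum>j\<in>S. grad (\<phi> i j) z)"
    using assms(3) mult_left_le_one_le[of "norm (\<Sum>j\<in>S. grad (\<phi> i j) z)" "1 / real k"] by simp
  also have "\<dots> \<le> (\<Sum>j\<in>S. norm (grad (\<phi> i j) xs) + L * R)"
    using assms gphi_bound by (intro sum_norm_le) auto
  also have "\<dots> \<le> Kb i" unfolding Kb_def using assms(1) L R by (intro sum_mono2) auto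
  finally show ?thesis .
qed

lemma innovation_bound:
  assumes "S \<in> minibatches m b i" "z \<in> cball xs R"
  shows "norm (minibatch_grad \<phi> b i S z - gF i z) \<le> 2 * Kb i"
proof -
  have "norm (minibatch_grad \<phi> b i S z) \<le> Kb i" "norm (gF i z) \<le> Kb i"
    unfolding minibatch_grad_def gF_eq
    using sum_gphi_bound[of S i z "b i"] sum_gphi_bound[of "{..<m i}" i z "m i"] assms b1 mpos[of i]
    by (auto simp: minibatches_def)
  then show ?thesis using norm_triangle_ineq4[of "minibatch_grad \<phi> b i S z" "gF i z"] by linarith
qed

lemma gF_bound: "z \<in> cball xs R \<Longrightarrow> norm (gF i z) \<le> Kb i"
  unfolding gF_eq using sum_gphi_bound[of "{..<m i}" i z "m i"] mpos[of i] by auto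

lemma ball_y: "l \<le> H i \<Longrightarrow> AE \<omega> in M. y t i l \<omega> \<in> cball xs R"
  using ball by eventually_elim blast

lemma ball_x: "AE \<omega> in M. x t \<omega> \<in> cball xs R"
  using ball by eventually_elim blast

lemma \<xi>_bound:
  assumes l: "l < H i"
  shows "AE \<omega> in M. norm (\<xi> t i l \<omega>) \<le> 2 * Kb i"
  unfolding \<xi>_def gs_def using AE_space ball_y[OF less_imp_le_nat[OF l], of t]
  by eventually_elim (use measurable_space[OF Bm[OF l]] in \<open>auto intro!: innovation_bound\<close>)

text \<open>A crude bound that provides integrability; the variance bound is \<open>\<xi>_l2\<close>.\<close>

lemma \<xi>_square_integrable: "l < H i \<Longrightarrow> l2_le M (\<xi> t i l) (2 * Kb i)"
  using \<xi>_M \<xi>_bound Kb_nonneg by (intro l2_le_bounded) auto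

lemma gF_y_bounded: "l \<le> H i \<Longrightarrow> l2_le M (\<lambda>\<omega>. gF i (y t i l \<omega>)) (Kb i)"
  using Kb_nonneg eventually_mono[OF ball_y gF_bound]
  by (intro l2_le_bounded gF_measurable y_M) auto

lemma
  assumes "l < H i"
  shows cond_indep_B: "cond_indep_vars M (LH i t l) (\<lambda>(k, r). count_space (minibatches m b k)) (\<lambda>(k, r). B t k r)
            (SIGMA k:UNIV. {..<H k})"
    and cond_exp_gs: "a \<in> Basis \<Longrightarrow> AE \<omega> in M. real_cond_exp M (LH i t l) (\<lambda>\<omega>. gs t i l \<omega> \<bullet> a) \<omega> = gF i (y t i l \<omega>) \<bullet> a"
    and cond_exp_\<xi>_sq: "AE \<omega> in M. real_cond_exp M (LH i t l) (\<lambda>\<omega>. (norm (\<xi> t i l \<omega>))\<^sup>2) \<omega>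
             \<le> node_var \<phi> m xs R i / real (b i)"
  using sampling assms unfolding minibatch_sampling_def Let_def \<xi>_def gs_def by blast+

lemma
  assumes l: "l < H i"
  shows \<xi>_l2: "l2_le M (\<xi> t i l) (sqrt (node_var \<phi> m xs R i / real (b i)))"
proof -
  interpret finite_measure_subalgebra M "LH i t l"
    using finite_measure_subalgebraI[OF subalg_LH] l by simp
  note X = \<xi>_square_integrable[OF l, of t]
  have I: "integrable M (\<lambda>\<omega>. (norm (\<xi> t i l \<omega>))\<^sup>2)" using l2_leD(2)[OF X] .
  have "(\<integral>\<omega>. (norm (\<xi> t i l \<omega>))\<^sup>2 \<partial>M) = (\<integral>\<omega>. real_cond_exp M (LH i t l) (\<lambda>\<omega>. (norm (\<xi> t i l \<omega>))\<^sup>2) \<omega> \<partial>M)"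
    using real_cond_exp_int(2)[OF I] by simp
  also have "\<dots> \<le> (\<integral>\<omega>. node_var \<phi> m xs R i / real (b i) \<partial>M)"
    using real_cond_exp_int(1)[OF I] cond_exp_\<xi>_sq[OF l, of t] by (intro integral_mono_AE) auto
  finally have le: "(\<integral>\<omega>. (norm (\<xi> t i l \<omega>))\<^sup>2 \<partial>M) \<le> node_var \<phi> m xs R i / real (b i)"
    by (simp add: prob_space)
  have "0 \<le> (\<integral>\<omega>. (norm (\<xi> t i l \<omega>))\<^sup>2 \<partial>M)" by simp
  with le have "0 \<le> node_var \<phi> m xs R i / real (b i)" by linarith
  then show ?thesis using le I \<xi>_M[OF l] by (simp add: l2_le_def)
qed

lemma node_var_nonneg: "0 \<le> node_var \<phi> m xs R i"
  using l2_leD(3)[OF \<xi>_l2[of 0 i undefined]] Hpos(2)[of i] bpos[of i] by (simp add: zero_le_divide_iff)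

lemma cond_exp_\<xi>:
  assumes l: "l < H i" and a: "a \<in> Basis"
  shows "AE \<omega> in M. real_cond_exp M (LH i t l) (\<lambda>\<omega>. \<xi> t i l \<omega> \<bullet> a) \<omega> = 0"
proof -
  interpret finite_measure_subalgebra M "LH i t l"
    using finite_measure_subalgebraI[OF subalg_LH] l by simp
  have A: "l2_le M (\<lambda>_. a) 1" using a by (intro l2_le_bounded) auto
  have I2: "integrable M (\<lambda>\<omega>. gF i (y t i l \<omega>) \<bullet> a)"
    using l2_le_inner_integrable[OF gF_y_bounded A] l by simp
  have "integrable M (\<lambda>\<omega>. \<xi> t i l \<omega> \<bullet> a + gF i (y t i l \<omega>) \<bullet> a)"
    using l2_le_inner_integrable[OF \<xi>_square_integrable[OF l] A] I2 by (rule Bochner_Integration.integrable_add)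
  then have I1: "integrable M (\<lambda>\<omega>. gs t i l \<omega> \<bullet> a)" by (simp add: \<xi>_def inner_diff_left)
  have m: "(\<lambda>\<omega>. gF i (y t i l \<omega>) \<bullet> a) \<in> borel_measurable (LH i t l)"
    using gF_measurable[OF y_LH] l by (intro borel_measurable_inner) auto
  have "AE \<omega> in M. real_cond_exp M (LH i t l) (\<lambda>\<omega>. gs t i l \<omega> \<bullet> a - gF i (y t i l \<omega>) \<bullet> a) \<omega> =
      real_cond_exp M (LH i t l) (\<lambda>\<omega>. gs t i l \<omega> \<bullet> a) \<omega> - real_cond_exp M (LH i t l) (\<lambda>\<omega>. gF i (y t i l \<omega>) \<bullet> a) \<omega>"
    using I1 I2 by (rule real_cond_exp_diff)
  moreover note real_cond_exp_F_meas[OF I2 m] cond_exp_gs[OF l a, of t]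
  ultimately show ?thesis unfolding \<xi>_def inner_diff_left by eventually_elim simp
qed

text \<open>
  The sets \<open>C \<inter> Ev A\<close>, with \<open>C\<close> in the local history and \<open>Ev A\<close> an event that prescribes a set of values for
  each minibatch of each other node, form a \<open>\<pi>\<close>-system that generates the enlarged history. On such a set
  the joint conditional independence of \<open>B t i k\<close> and the minibatches of the other nodes applies.
\<close>

lemma integral_\<xi>_others_zero:
  assumes k: "k < H i" and a: "a \<in> Basis" and A: "A \<in> sets (others_history i t k)"
  shows "(\<integral>\<omega>. indicator A \<omega> * (\<xi> t i k \<omega> \<bullet> a) \<partial>M) = 0"
proof -
  let ?G = "LH i t k"
  define J where "J = (SIGMA j:UNIV - {i}. {..<H j})"
  define Ev where "Ev A = {\<omega>\<in>space M. \<forall>p\<in>J. B t (fst p) (snd p) \<omega> \<in> A p}" for A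
  define P where "P = {C \<inter> Ev A | C A. C \<in> sets ?G}"
  have G: "subalgebra M ?G" using subalg_LH k by simp
  have GM: "sets ?G \<subseteq> sets M" using G by (simp add: subalgebra_def)
  have Ga: "l2_le M (\<lambda>_. a) 1" using a by (intro l2_le_bounded) auto
  have I: "integrable M (\<lambda>\<omega>. \<xi> t i k \<omega> \<bullet> a)"
    using l2_le_inner_integrable[OF \<xi>_square_integrable[OF k] Ga] .
  have finJ: "finite J" unfolding J_def by auto
  have JB: "B t (fst p) (snd p) \<in> M \<rightarrow>\<^sub>M count_space (minibatches m b (fst p))" if "p \<in> J" for p
    using that Bm by (auto simp: J_def)
  have EvM: "Ev A \<in> sets M" for A
  proof -
    have "Ev A = space M \<inter> (\<Inter>p\<in>J. B t (fst p) (snd p) -` A p \<inter> space M)" if "J \<noteq> {}"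
      using that by (auto simp: Ev_def)
    moreover have "(\<Inter>p\<in>J. B t (fst p) (snd p) -` A p \<inter> space M) \<in> sets M" if "J \<noteq> {}"
      using finJ that by (intro sets.finite_INT) (auto intro: B_vimage simp: J_def)
    moreover have "Ev A = space M" if "J = {}" using that by (simp add: Ev_def)
    ultimately show ?thesis by (cases "J = {}") auto
  qed
  have PM: "P \<subseteq> sets M" using GM EvM by (auto simp: P_def)
  have stable: "Int_stable P"
  proof (rule Int_stableI)
    fix U V assume "U \<in> P" "V \<in> P"
    then obtain C1 A1 C2 A2 where "U = C1 \<inter> Ev A1" "V = C2 \<inter> Ev A2" "C1 \<in> sets ?G" "C2 \<in> sets ?G"
      by (auto simp: P_def)
    moreover have "Ev A1 \<inter> Ev A2 = Ev (\<lambda>p. A1 p \<inter> A2 p)" by (auto simp: Ev_def)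
    ultimately show "U \<inter> V \<in> P" unfolding P_def
      by (intro CollectI exI[of _ "C1 \<inter> C2"] exI[of _ "\<lambda>p. A1 p \<inter> A2 p"]) auto
  qed
  have EvU: "Ev (\<lambda>_. UNIV) = space M" by (auto simp: Ev_def)
  have topG: "space M \<in> sets ?G" using sets.top[of ?G] by simp
  have GP: "C \<in> P" if "C \<in> sets ?G" for C
  proof -
    have "C = C \<inter> Ev (\<lambda>_. UNIV)" using that sets.sets_into_space[OF that] by (auto simp: EvU)
    then show ?thesis using that unfolding P_def by blast
  qed
  have BP: "B t j r -` S \<inter> space M \<in> P" if "j \<noteq> i" "r < H j" for j r S
  proof -
    have "B t j r -` S \<inter> space M = space M \<inter> Ev (\<lambda>p. if p = (j, r) then S else UNIV)"
      using that by (auto simp: Ev_def J_def)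
    then show ?thesis using topG unfolding P_def by blast
  qed
  have "sets (LH i t k) \<union> {B t j r -` S \<inter> space M | j r S. j \<noteq> i \<and> r < H j} \<subseteq> P"
    using GP BP by blast
  then have "sets (others_history i t k) \<subseteq> sigma_sets (space M) P"
    unfolding sets_others_history by (rule sigma_sets_mono')
  with A have A': "A \<in> sigma_sets (space M) P" by blast
  have base: "(\<integral>\<omega>. indicator U \<omega> * (\<xi> t i k \<omega> \<bullet> a) \<partial>M) = 0" if "U \<in> P" for U
  proof -
    from that obtain C A where U: "U = C \<inter> Ev A" and C: "C \<in> sets ?G" by (auto simp: P_def)
    define f where "f S \<omega> = (minibatch_grad \<phi> b i S (y t i k \<omega>) - gF i (y t i k \<omega>)) \<bullet> a" for S \<omega>
    define p where "p \<omega> = (\<Prod>q\<in>J. real_cond_exp M ?G (indicator (B t (fst q) (snd q) -` (A q \<inter> minibatches m b (fst q)) \<inter> space M)) \<omega>)" for \<omega>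
    have fX: "f (B t i k \<omega>) \<omega> = \<xi> t i k \<omega> \<bullet> a" for \<omega> by (simp add: f_def \<xi>_def gs_def)
    have fG: "f S \<in> borel_measurable ?G" if "S \<in> minibatches m b i" for S
      unfolding f_def using k that
      by (intro borel_measurable_inner borel_measurable_diff gF_measurable y_LH borel_measurable_const
          borel_measurable_minibatch_grad[OF smooth]) auto
    have fI: "integrable M (f S)" if "S \<in> minibatches m b i" for S
    proof (rule integrable_const_bound)
      show "AE \<omega> in M. norm (f S \<omega>) \<le> 2 * Kb i"
        using ball_y[OF less_imp_le_nat[OF k], of t]
      proof eventually_elim
        case (elim \<omega>)
        have "norm (f S \<omega>) \<le> norm (minibatch_grad \<phi> b i S (y t i k \<omega>) - gF i (y t i k \<omega>))"
          unfolding f_def using a Basis_le_norm by auto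
        also have "\<dots> \<le> 2 * Kb i" using innovation_bound[OF that] elim k by auto
        finally show ?case .
      qed
      show "f S \<in> borel_measurable M" using measurable_from_subalg[OF G fG[OF that]] .
    qed
    have ind: "AE \<omega> in M. real_cond_exp M ?G (indicator (B t i k -` {S} \<inter> space M \<inter> Ev A)) \<omega> =
       real_cond_exp M ?G (indicator (B t i k -` {S} \<inter> space M)) \<omega> * p \<omega>" if S: "S \<in> minibatches m b i" for S
    proof -
      define A' where "A' q = (if q = (i, k) then {S} else A q \<inter> minibatches m b (fst q))" for q
      have nin: "(i, k) \<notin> J" by (simp add: J_def)
      let ?J = "insert (i, k) J"
      have "?J \<subseteq> (SIGMA k:UNIV. {..<H k}) \<and> ?J \<noteq> {} \<and> finite ?J \<and>
         (\<forall>q\<in>?J. A' q \<in> sets ((\<lambda>(k, r). count_space (minibatches m b k)) q))"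
        using k finJ S by (auto simp: J_def A'_def)
      then have "AE \<omega> in M. real_cond_exp M ?G (indicator (\<Inter>q\<in>?J. (\<lambda>(k, r). B t k r) q -` A' q \<inter> space M)) \<omega> =
         (\<Prod>q\<in>?J. real_cond_exp M ?G (indicator ((\<lambda>(k, r). B t k r) q -` A' q \<inter> space M)) \<omega>)"
        using cond_indep_B[OF k, of t] unfolding cond_indep_vars_def by blast
      moreover have "(\<Inter>q\<in>?J. (\<lambda>(k, r). B t k r) q -` A' q \<inter> space M) = B t i k -` {S} \<inter> space M \<inter> Ev A"
        using nin measurable_space[OF JB] by (auto simp: Ev_def A'_def split: if_splits)
      moreover have "(\<Prod>q\<in>?J. real_cond_exp M ?G (indicator ((\<lambda>(k, r). B t k r) q -` A' q \<inter> space M)) \<omega>) =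
         real_cond_exp M ?G (indicator (B t i k -` {S} \<inter> space M)) \<omega> * p \<omega>" for \<omega>
      proof -
        have "(\<Prod>q\<in>J. real_cond_exp M ?G (indicator ((\<lambda>(k, r). B t k r) q -` A' q \<inter> space M)) \<omega>) = p \<omega>"
          unfolding p_def using nin by (intro prod.cong) (auto simp: A'_def case_prod_beta)
        then show ?thesis using finJ nin by (simp add: A'_def)
      qed
      ultimately show ?thesis by simp
    qed
    have "(\<integral>\<omega>. indicator (C \<inter> Ev A) \<omega> * f (B t i k \<omega>) \<omega> \<partial>M) = 0"
      using cond_exp_\<xi>[OF k a, of t]
      by (intro cond_mean_zero_cond_indep[OF G finite_minibatches Bm[OF k] fG fI EvM C ind]) (simp_all add: fX)
    then show ?thesis by (simp add: fX U)
  qed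
  show ?thesis
    by (rule integral_eq_0_on_sigma_sets[OF I PM stable base GP[OF topG] A'])
qed

lemma \<xi>_orthogonal:
  assumes "k < H i" "l2_le M W a" "W \<in> borel_measurable (others_history i t k)"
  shows "(\<integral>\<omega>. W \<omega> \<bullet> \<xi> t i k \<omega> \<partial>M) = 0"
  using assms integral_\<xi>_others_zero[OF assms(1)]
  by (intro orthogonal_if_integrals_zero[OF subalg_others_history \<xi>_square_integrable]) auto

lemma \<xi>_uncorrelated:
  assumes "k < H i" "k' < H i'" "(i, k) \<noteq> (i', k')"
  shows "(\<integral>\<omega>. \<xi> t i k \<omega> \<bullet> \<xi> t i' k' \<omega> \<partial>M) = 0"
proof -
  have *: "(\<integral>\<omega>. \<xi> t i k \<omega> \<bullet> \<xi> t i' k' \<omega> \<partial>M) = 0"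
    if k: "k < H i" "k' < H i'" and c: "i \<noteq> i' \<or> k < k'" for i k i' k'
  proof -
    have "sets (LH i t (Suc k)) \<subseteq> sets (others_history i' t k')"
    proof (cases "i = i'")
      case True
      then have "sets (LH i t (Suc k)) \<subseteq> sets (LH i' t k')" using c LH_mono[of "Suc k" k' i t] by simp
      then show ?thesis using LH_others by blast
    qed (use LH_others_other k in simp)
    then show ?thesis using k
      by (intro \<xi>_orthogonal[OF k(2) \<xi>_square_integrable] measurable_mono_sets[OF \<xi>_LH]) auto
  qed
  show ?thesis
  proof (cases "i \<noteq> i' \<or> k < k'")
    case False
    then have "i' \<noteq> i \<or> k' < k" using assms(3) by auto
    from *[OF assms(2,1) this] show ?thesis by (simp add: inner_commute)
  qed (use * assms in blast)
qed

end

context hew_run begin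

text \<open>The variance bound \<open>v\<^sub>i\<^sup>2 / (H\<^sub>i b\<^sub>i)\<close> for the noise of node \<open>i\<close> averaged over the local steps of a round.\<close>

definition noise_var :: "'n \<Rightarrow> real" where
  "noise_var i = node_var \<phi> m xs R i / (real (H i) * real (b i))"

text \<open>The noise averaged over the local steps.\<close>

definition noise_bar :: "nat \<Rightarrow> 'n \<Rightarrow> 'w \<Rightarrow> 'a" where
  "noise_bar t i \<omega> = (1 / real (H i)) *\<^sub>R (\<Sum>l<H i. \<xi> t i l \<omega>)"

lemma noise_var_nonneg: "0 \<le> noise_var i"
  unfolding noise_var_def using node_var_nonneg by simp

lemma node_var_eq: "node_var \<phi> m xs R i / real (b i) = real (H i) * noise_var i"
  unfolding noise_var_def using Hpos(1)[of i] by simp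

lemma noise_bar_l2: "l2_le M (noise_bar t i) (sqrt (noise_var i))"
proof -
  have "l2_le M (\<lambda>\<omega>. \<Sum>l<H i. \<xi> t i l \<omega>) (sqrt (\<Sum>l<H i. (sqrt (real (H i) * noise_var i))\<^sup>2))"
    using \<xi>_l2[of _ i t] \<xi>_uncorrelated unfolding node_var_eq by (intro l2_le_orthogonal_sum) auto
  from l2_le_scaleR[OF this, of "1 / real (H i)"]
  have 1: "l2_le M (noise_bar t i) (1 / real (H i) * sqrt (real (H i) * (real (H i) * noise_var i)))"
    using noise_var_nonneg[of i] unfolding noise_bar_def[abs_def] by simp
  have "sqrt (real (H i) * (real (H i) * noise_var i)) = real (H i) * sqrt (noise_var i)"
    by (simp add: mult.assoc[symmetric] real_sqrt_mult)
  then show ?thesis using 1 Hpos(1)[of i] by simp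
qed

lemma others_history_mono: "sets (others_history i t 0) \<subseteq> sets (others_history i t k)"
  unfolding sets_others_history using LH_mono[of 0 k i t] by (intro sigma_sets_mono' Un_mono) auto

lemma noise_bar_orthogonal:
  assumes W: "l2_le M W a" "W \<in> borel_measurable (others_history i t 0)"
  shows "(\<integral>\<omega>. W \<omega> \<bullet> noise_bar t i \<omega> \<partial>M) = 0"
proof -
  have "(\<integral>\<omega>. W \<omega> \<bullet> (\<Sum>l<H i. \<xi> t i l \<omega>) \<partial>M) = (\<Sum>l<H i. \<integral>\<omega>. W \<omega> \<bullet> \<xi> t i l \<omega> \<partial>M)"
    unfolding inner_sum_right using l2_le_inner_integrable[OF W(1) \<xi>_l2]
    by (intro Bochner_Integration.integral_sum) auto
  also have "\<dots> = 0"
    using W by (intro sum.neutral ballI \<xi>_orthogonal measurable_mono_sets[OF W(2) others_history_mono]) auto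
  finally show ?thesis by (simp add: noise_bar_def)
qed

lemma noise_bar_LH: "noise_bar t i \<in> borel_measurable (LH i t (H i))"
proof -
  have "\<xi> t i l \<in> borel_measurable (LH i t (H i))" if "l < H i" for l
    using that by (intro measurable_mono_sets[OF \<xi>_LH LH_mono]) auto
  then show ?thesis unfolding noise_bar_def[abs_def]
    by (intro borel_measurable_scaleR borel_measurable_sum) auto
qed

text \<open>Averaging over the nodes: the noises of distinct nodes are orthogonal, hence the squares of the weights.\<close>

lemma noise_sum_l2:
  "l2_le M (\<lambda>\<omega>. \<Sum>i\<in>UNIV. k i *\<^sub>R noise_bar t i \<omega>) (sqrt (\<Sum>i\<in>UNIV. (k i)\<^sup>2 * noise_var i))"
proof -
  have "(\<integral>\<omega>. (k i *\<^sub>R noise_bar t i \<omega>) \<bullet> (k j *\<^sub>R noise_bar t j \<omega>) \<partial>M) = 0" if "i \<noteq> j" for i j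
  proof -
    have "noise_bar t i \<in> borel_measurable (others_history j t 0)"
      using that by (intro measurable_mono_sets[OF noise_bar_LH LH_others_other]) auto
    from noise_bar_orthogonal[OF noise_bar_l2 this] show ?thesis by simp
  qed
  then have "l2_le M (\<lambda>\<omega>. \<Sum>i\<in>UNIV. k i *\<^sub>R noise_bar t i \<omega>) (sqrt (\<Sum>i\<in>UNIV. (\<bar>k i\<bar> * sqrt (noise_var i))\<^sup>2))"
    by (intro l2_le_orthogonal_sum l2_le_scaleR noise_bar_l2) auto
  then show ?thesis using noise_var_nonneg by (simp add: power_mult_distrib)
qed

subsection \<open>Drift of the local iterates\<close>

lemma drift_step_arith:
  fixes q v e :: real
  assumes "0 \<le> q" "0 \<le> v" "0 \<le> e"
  shows "sqrt ((e * (real k * q + sqrt (real k) * v) + e * q)\<^sup>2 + (e * v)\<^sup>2) \<le>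
    e * (real (Suc k) * q + sqrt (real (Suc k)) * v)"
proof (rule real_le_lsqrt)
  have s: "sqrt (real k) \<le> sqrt (real (Suc k))" by simp
  have "((real k + 1) * q + sqrt (real k) * v)\<^sup>2 + v\<^sup>2 =
      ((real k + 1) * q)\<^sup>2 + 2 * ((real k + 1) * q) * (sqrt (real k) * v) + (real k + 1) * v\<^sup>2"
    by (simp add: power2_sum power_mult_distrib algebra_simps)
  also have "\<dots> \<le> ((real k + 1) * q)\<^sup>2 + 2 * ((real k + 1) * q) * (sqrt (real (Suc k)) * v) + (real k + 1) * v\<^sup>2"
    using assms s by (intro add_mono mult_left_mono mult_right_mono) auto
  also have "\<dots> = ((real k + 1) * q + sqrt (real (Suc k)) * v)\<^sup>2"
    by (simp add: power2_sum power_mult_distrib algebra_simps)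
  finally have "e\<^sup>2 * (((real k + 1) * q + sqrt (real k) * v)\<^sup>2 + v\<^sup>2) \<le> e\<^sup>2 * ((real k + 1) * q + sqrt (real (Suc k)) * v)\<^sup>2"
    by (intro mult_left_mono) auto
  moreover have "(e * (real k * q + sqrt (real k) * v) + e * q)\<^sup>2 + (e * v)\<^sup>2 =
      e\<^sup>2 * (((real k + 1) * q + sqrt (real k) * v)\<^sup>2 + v\<^sup>2)"
  proof -
    have "e * (real k * q + sqrt (real k) * v) + e * q = e * ((real k + 1) * q + sqrt (real k) * v)"
      by (simp add: distrib_left distrib_right)
    then show ?thesis by (simp only: power_mult_distrib[of e] distrib_left[of "e\<^sup>2"])
  qed
  ultimately show "(e * (real k * q + sqrt (real k) * v) + e * q)\<^sup>2 + (e * v)\<^sup>2 \<le>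
      (e * (real (Suc k) * q + sqrt (real (Suc k)) * v))\<^sup>2"
    by (simp add: power_mult_distrib add.commute)
qed (use assms in auto)

text \<open>
  The local iterates, seen from the iterate at step \<open>l\<close>: a nonexpansive map, a shift by \<open>\<eta>\<close> times the
  direction at step \<open>l\<close>, and a noise orthogonal to both. Thus \<open>q\<close> accumulates linearly and the noise like
  a square root.
\<close>

lemma drift_from:
  assumes q: "l2_le M (\<lambda>\<omega>. gF i (y t i l \<omega>) + cb t \<omega> - c t i \<omega>) q"
  shows "l + k \<le> H i \<Longrightarrow> l2_le M (\<lambda>\<omega>. y t i (l + k) \<omega> - y t i l \<omega>)
     (\<eta> t i * (real k * q + sqrt (real k) * sqrt (real (H i) * noise_var i)))"
proof (induction k)
  case 0
  then show ?case using l2_le_zero[of M] by simp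
next
  case (Suc k)
  let ?e = "\<eta> t i" and ?v = "sqrt (real (H i) * noise_var i)"
  \<comment> \<open>The difference of the gradient steps from \<open>y t i (l + k)\<close> and from \<open>y t i l\<close>.\<close>
  let ?A = "\<lambda>\<omega>. (y t i (l + k) \<omega> - ?e *\<^sub>R gF i (y t i (l + k) \<omega>)) - (y t i l \<omega> - ?e *\<^sub>R gF i (y t i l \<omega>))"
  let ?q = "\<lambda>\<omega>. gF i (y t i l \<omega>) + cb t \<omega> - c t i \<omega>"
  have lk: "l + k < H i" "l + k \<le> H i" "l \<le> H i" using Suc by auto
  have e: "0 \<le> ?e" using \<eta>pos[of t i] by simp
  have "\<eta> t i * L * 1 \<le> \<eta> t i * L * real (H i)"
    using L H1[of i] by (intro mult_left_mono mult_nonneg_nonneg e) auto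
  also have "\<eta> t i * L * real (H i) = \<theta> t i" using L Hpos(1)[of i] by (simp add: field_simps)
  finally have eL: "?e * L \<le> 2" using \<theta>1[of t i] by simp
  note [measurable] = y_M[OF lk(2)] y_M[OF lk(3)] gF_measurable[OF y_M[OF lk(2)]] gF_measurable[OF y_M[OF lk(3)]]
  have "?A \<in> borel_measurable M" by measurable
  from l2_le_dominated[OF Suc.IH[OF lk(2)] this, of 1]
  have A: "l2_le M ?A (?e * (real k * q + sqrt (real k) * ?v))"
    using gradient_step_nonexpansive[OF convex_F smooth_F L e eL] by auto
  have D: "l2_le M (\<lambda>\<omega>. ?A \<omega> - ?e *\<^sub>R ?q \<omega>) (?e * (real k * q + sqrt (real k) * ?v) + ?e * q)"
    using l2_le_diff[OF A l2_le_scaleR[OF q, of ?e]] unfolding abs_of_nonneg[OF e] .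
  have X: "l2_le M (\<lambda>\<omega>. - (?e *\<^sub>R \<xi> t i (l + k) \<omega>)) (?e * ?v)"
    using l2_le_minus[OF l2_le_scaleR[OF \<xi>_l2[OF lk(1)], of ?e]] unfolding node_var_eq abs_of_nonneg[OF e] .
  have meas: "(\<lambda>\<omega>. ?A \<omega> - ?e *\<^sub>R ?q \<omega>) \<in> borel_measurable (LH i t (l + k))"
  proof -
    have [measurable]: "y t i (l + k) \<in> borel_measurable (LH i t (l + k))" using y_LH lk by simp
    have [measurable]: "y t i l \<in> borel_measurable (LH i t (l + k))"
      using lk by (intro measurable_mono_sets[OF y_LH LH_mono]) auto
    have [measurable]: "cb t \<in> borel_measurable (LH i t (l + k))" "c t i \<in> borel_measurable (LH i t (l + k))"
      using state_measurable[of t] by (auto intro: measurable_mono_sets[OF _ RH_LH])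
    note [measurable] = gF_measurable[of "y t i l" "LH i t (l + k)" i] gF_measurable[of "y t i (l + k)" "LH i t (l + k)" i]
    show ?thesis by measurable
  qed
  have "(\<integral>\<omega>. (?A \<omega> - ?e *\<^sub>R ?q \<omega>) \<bullet> \<xi> t i (l + k) \<omega> \<partial>M) = 0"
    by (rule \<xi>_orthogonal[OF lk(1) D measurable_mono_sets[OF meas LH_others]]) simp
  then have "(\<integral>\<omega>. (?A \<omega> - ?e *\<^sub>R ?q \<omega>) \<bullet> - (?e *\<^sub>R \<xi> t i (l + k) \<omega>) \<partial>M) = 0"
    by simp
  from l2_le_orthogonal_add[OF D X this]
  have "l2_le M (\<lambda>\<omega>. (?A \<omega> - ?e *\<^sub>R ?q \<omega>) + - (?e *\<^sub>R \<xi> t i (l + k) \<omega>))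
      (?e * (real (Suc k) * q + sqrt (real (Suc k)) * ?v))"
    using l2_leD(3)[OF q] noise_var_nonneg[of i] e by (elim l2_le_mono) (intro drift_step_arith, auto)
  then show ?case
  proof (rule l2_le_cong)
    fix \<omega> assume "\<omega> \<in> space M"
    then show "(?A \<omega> - ?e *\<^sub>R ?q \<omega>) + - (?e *\<^sub>R \<xi> t i (l + k) \<omega>) = y t i (l + Suc k) \<omega> - y t i l \<omega>"
      using lk by (simp add: y_Suc \<xi>_def algebra_simps)
  qed
qed

text \<open>The same bound, expressed in the fraction of the horizon that has elapsed.\<close>

lemma drift_from_fraction:
  assumes q: "l2_le M (\<lambda>\<omega>. gF i (y t i l \<omega>) + cb t \<omega> - c t i \<omega>) q" and lk: "l + k \<le> H i"
  shows "l2_le M (\<lambda>\<omega>. y t i (l + k) \<omega> - y t i l \<omega>)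
     (\<theta> t i / L * (real k / real (H i) * q + sqrt (real k / real (H i)) * sqrt (noise_var i)))"
proof -
  have "\<eta> t i * (real k * q + sqrt (real k) * sqrt (real (H i) * noise_var i)) =
     \<theta> t i / L * (real k / real (H i) * q + sqrt (real k / real (H i)) * sqrt (noise_var i))"
  proof -
    have "sqrt (real (H i)) * sqrt (real (H i)) = real (H i)" by simp
    then have "sqrt (real (H i)) / real (H i) = 1 / sqrt (real (H i))"
      using Hpos(1)[of i] by (simp add: field_simps)
    moreover have "sqrt (real k) * sqrt (real (H i) * noise_var i) / real (H i) =
        sqrt (real k) * sqrt (noise_var i) * (sqrt (real (H i)) / real (H i))"
      by (simp add: real_sqrt_mult)
    ultimately have "sqrt (real k) * sqrt (real (H i) * noise_var i) / real (H i) = sqrt (real k / real (H i)) * sqrt (noise_var i)"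
      by (simp add: real_sqrt_divide)
    then show ?thesis using L Hpos(1)[of i] by (simp add: field_simps)
  qed
  then show ?thesis using drift_from[OF q lk] by simp
qed

end

lemma concave_tangent:
  fixes a g u :: real
  assumes "0 \<le> a"
  shows "g - a * g\<^sup>2 \<le> (u - a * u\<^sup>2) + (1 - 2 * a * u) * (g - u)"
proof -
  have "(u - a * u\<^sup>2) + (1 - 2 * a * u) * (g - u) - (g - a * g\<^sup>2) = a * (g - u)\<^sup>2"
    by (simp add: power2_eq_square algebra_simps)
  then show ?thesis using assms by (smt (verit) mult_nonneg_nonneg zero_le_power2)
qed

lemma integral_add5:
  fixes f1 :: "'w \<Rightarrow> real"
  assumes "integrable M f1" "integrable M f2" "integrable M f3" "integrable M f4" "integrable M f5"
  shows "(\<integral>\<omega>. f1 \<omega> + f2 \<omega> + f3 \<omega> + f4 \<omega> + f5 \<omega> \<partial>M) =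
    (\<integral>\<omega>. f1 \<omega> \<partial>M) + (\<integral>\<omega>. f2 \<omega> \<partial>M) + (\<integral>\<omega>. f3 \<omega> \<partial>M) + (\<integral>\<omega>. f4 \<omega> \<partial>M) + (\<integral>\<omega>. f5 \<omega> \<partial>M)"
  using assms by simp

text \<open>
  A round \<open>t\<close> at whose beginning \<open>(u, X)\<close> is an upper state, stated with the \<open>L\<^sup>2\<close> norms of the control
  errors.
\<close>

locale hew_round = hew_run +
  fixes t :: nat and u X :: real
  assumes gap_le: "(\<integral>\<omega>. (global_obj \<phi> m (x t \<omega>) - global_obj \<phi> m xs) \<partial>M) \<le> u"
    and u: "0 \<le> u" "u \<le> L * R\<^sup>2 / 2" and X: "0 \<le> X"
    and err: "\<And>i. l2_le M (\<lambda>\<omega>. c t i \<omega> - grad (node_obj \<phi> m i) (x t \<omega>)) (sqrt X)"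
begin

abbreviation "gap \<omega> \<equiv> FF (x t \<omega>) - FF xs"
abbreviation "s i \<equiv> sqrt (noise_var i)"

text \<open>The bound on the \<open>L\<^sup>2\<close> norms of the corrected initial directions.\<close>

definition "Q = sqrt (4 * L * u + 8 * X)"

text \<open>The corrected direction in which node \<open>i\<close> starts; it is \<open>gFF (x t)\<close> plus \<open>bias i\<close>, the centred control errors.\<close>

definition "dir i \<omega> = gF i (x t \<omega>) + cb t \<omega> - c t i \<omega>"
definition "bias i \<omega> = (1 / real CARD('b)) *\<^sub>R (\<Sum>j\<in>UNIV. c t j \<omega> - gF j (x t \<omega>)) - (c t i \<omega> - gF i (x t \<omega>))"

lemma Q_nonneg: "0 \<le> Q" and Q_sq: "Q\<^sup>2 = 4 * L * u + 8 * X"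
  using L u X by (auto simp: Q_def)

lemma s_nonneg: "0 \<le> s i" using noise_var_nonneg by simp

lemma x_l2: "l2_le M (\<lambda>\<omega>. x t \<omega> - xs) R"
  using x_M[of t] ball_x[of t] R by (intro l2_le_bounded) (auto simp: dist_norm norm_minus_commute)

lemma gap_integrable: "integrable M gap"
proof (rule integrable_const_bound)
  show "AE \<omega> in M. norm (gap \<omega>) \<le> L / 2 * R\<^sup>2"
    using ball_x[of t]
  proof eventually_elim
    case (elim \<omega>)
    have "gap \<omega> \<le> L / 2 * (norm (x t \<omega> - xs))\<^sup>2" by (rule gap_le_quadratic)
    also have "\<dots> \<le> L / 2 * R\<^sup>2" using elim L by (intro mult_left_mono power_mono) (auto simp: dist_norm norm_minus_commute)
    finally show ?case using gap_nonneg[of "x t \<omega>"] by simp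
  qed
  show "gap \<in> borel_measurable M" using FF_measurable[OF x_M] by simp
qed

lemma gFF_l2: "l2_le M (\<lambda>\<omega>. gFF (x t \<omega>)) (sqrt (2 * L * u))"
proof -
  have "norm (gFF (x t \<omega>)) \<le> L * norm (x t \<omega> - xs)" for \<omega>
    using smooth_fun_lipschitz[OF smooth_FF, of "x t \<omega>" xs] by (simp add: gFF_xs)
  then have D: "l2_le M (\<lambda>\<omega>. gFF (x t \<omega>)) (L * R)"
    using L by (intro l2_le_dominated[OF x_l2] gFF_measurable x_M) auto
  have "(\<integral>\<omega>. (norm (gFF (x t \<omega>)))\<^sup>2 \<partial>M) \<le> (\<integral>\<omega>. 2 * L * gap \<omega> \<partial>M)"
    using l2_leD(2)[OF D] integrable_mult_right[OF gap_integrable, of "2 * L"] gFF_sq_le by (intro integral_mono) auto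
  also have "\<dots> = 2 * L * (\<integral>\<omega>. gap \<omega> \<partial>M)" by (rule integral_mult_right_zero)
  also have "\<dots> \<le> 2 * L * u" using gap_le L by (intro mult_left_mono) auto
  finally show ?thesis using l2_leD(1,2)[OF D] L u by (auto simp: l2_le_def)
qed

lemma dir_eq: "\<omega> \<in> space M \<Longrightarrow> dir i \<omega> = gFF (x t \<omega>) + bias i \<omega>"
  by (simp add: dir_def bias_def gFF_eq cb_eq sum_subtractf scaleR_diff_right)

lemma bias_l2: "l2_le M (bias i) (2 * sqrt X)"
proof -
  have "l2_le M (bias i) (\<bar>1 / real CARD('b)\<bar> * (\<Sum>j\<in>(UNIV::'b set). sqrt X) + sqrt X)"
    unfolding bias_def[abs_def] by (intro l2_le_diff l2_le_scaleR l2_le_sum err)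
  then show ?thesis by simp
qed

lemma dir_l2: "l2_le M (dir i) Q"
proof -
  have "l2_le M (dir i) (sqrt (2 * L * u) + 2 * sqrt X)"
    using l2_le_cong[OF l2_le_add[OF gFF_l2 bias_l2]] by (simp add: dir_eq)
  moreover have "sqrt (2 * L * u) + 2 * sqrt X \<le> Q" unfolding Q_def
  proof (rule real_le_rsqrt)
    have "(sqrt (2 * L * u) + 2 * sqrt X)\<^sup>2 \<le> 2 * (sqrt (2 * L * u))\<^sup>2 + 2 * (2 * sqrt X)\<^sup>2"
      using sum_squares_bound[of "sqrt (2 * L * u)" "2 * sqrt X"] by (simp add: power2_sum)
    then show "(sqrt (2 * L * u) + 2 * sqrt X)\<^sup>2 \<le> 4 * L * u + 8 * X"
      using L u X by (simp add: power_mult_distrib)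
  qed
  ultimately show ?thesis by (rule l2_le_mono)
qed

lemma drift:
  assumes "l \<le> H i"
  shows "l2_le M (\<lambda>\<omega>. y t i l \<omega> - x t \<omega>)
     (\<theta> t i / L * (real l / real (H i) * Q + sqrt (real l / real (H i)) * s i))"
proof -
  have "l2_le M (\<lambda>\<omega>. gF i (y t i 0 \<omega>) + cb t \<omega> - c t i \<omega>) Q"
    using l2_le_cong[OF dir_l2] by (simp add: dir_def y_0)
  from drift_from_fraction[OF this] assms
  have "l2_le M (\<lambda>\<omega>. y t i l \<omega> - y t i 0 \<omega>)
     (\<theta> t i / L * (real l / real (H i) * Q + sqrt (real l / real (H i)) * s i))" by simp
  then show ?thesis by (rule l2_le_cong) (simp add: y_0)
qed

lemma gF_drift:
  assumes "l \<le> H i"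
  shows "l2_le M (\<lambda>\<omega>. gF i (y t i l \<omega>) - gF i (x t \<omega>))
     (\<theta> t i * (real l / real (H i) * Q + sqrt (real l / real (H i)) * s i))"
proof -
  have "l2_le M (\<lambda>\<omega>. gF i (y t i l \<omega>) - gF i (x t \<omega>))
     (L * (\<theta> t i / L * (real l / real (H i) * Q + sqrt (real l / real (H i)) * s i)))"
    using L gF_lipschitz[of i] assms
    by (intro l2_le_dominated[OF drift] borel_measurable_diff gF_measurable y_M x_M) auto
  then show ?thesis using L by simp
qed

subsection \<open>One round of descent\<close>

text \<open>The mean change of the gradient of node \<open>i\<close> along its local iterates.\<close>

definition "dG i \<omega> = (1 / real (H i)) *\<^sub>R (\<Sum>l<H i. gF i (y t i l \<omega>) - gF i (x t \<omega>))"

text \<open>The deviation of the noise-free mean direction of node \<open>i\<close> from \<open>gFF (x t)\<close>.\<close>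

definition "beta i \<omega> = dG i \<omega> + bias i \<omega>"

text \<open>
  The server step that would result without noise and without drift. It is determined by the history of
  the round, so the gradient at \<open>x t + P0\<close> is orthogonal to the noise \<open>N\<close> of the server step.
\<close>

definition "P0 \<omega> = (\<Sum>i\<in>UNIV. w t i *\<^sub>R (- ((\<theta> t i / L) *\<^sub>R dir i \<omega>)))"
definition "N \<omega> = (\<Sum>i\<in>UNIV. (- (w t i * \<theta> t i / L)) *\<^sub>R noise_bar t i \<omega>)"

lemma dG_l2: "l2_le M (dG i) (\<theta> t i * (Q + s i))"
proof -
  have "l2_le M (\<lambda>\<omega>. gF i (y t i l \<omega>) - gF i (x t \<omega>)) (\<theta> t i * (Q + s i))" if "l < H i" for l
  proof (rule l2_le_mono[OF gF_drift])
    have "real l / real (H i) \<le> 1" using that by simp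
    then show "\<theta> t i * (real l / real (H i) * Q + sqrt (real l / real (H i)) * s i) \<le> \<theta> t i * (Q + s i)"
      using \<theta>0[of t i] Q_nonneg s_nonneg[of i]
      by (intro mult_left_mono add_mono mult_left_le_one_le) auto
  qed (use that in simp)
  then have "l2_le M (dG i) (\<bar>1 / real (H i)\<bar> * (\<Sum>l<H i. \<theta> t i * (Q + s i)))"
    unfolding dG_def[abs_def] by (intro l2_le_scaleR l2_le_sum) auto
  then show ?thesis using Hpos(1)[of i] by simp
qed

lemma beta_l2: "l2_le M (beta i) (\<theta> t i * (Q + s i) + 2 * sqrt X)"
  unfolding beta_def[abs_def] by (intro l2_le_add dG_l2 bias_l2)

lemma local_update_eq:
  assumes "\<omega> \<in> space M"
  shows "y t i (H i) \<omega> - x t \<omega> = - ((\<theta> t i / L) *\<^sub>R (dir i \<omega> + dG i \<omega> + noise_bar t i \<omega>))"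
proof -
  have "(\<Sum>k<H i. gs t i k \<omega> - c t i \<omega> + cb t \<omega>) =
      (\<Sum>k<H i. \<xi> t i k \<omega> + (gF i (y t i k \<omega>) - gF i (x t \<omega>)) + dir i \<omega>)"
    by (intro sum.cong) (simp_all add: \<xi>_def dir_def)
  also have "\<dots> = real (H i) *\<^sub>R (dir i \<omega> + dG i \<omega> + noise_bar t i \<omega>)"
    using Hpos(1)[of i] by (simp add: sum.distrib dG_def noise_bar_def sum_constant_scaleR scaleR_add_right)
  finally show ?thesis
    using y_eq[OF assms, of "H i" i t] \<eta>HL[of t i] by simp
qed

lemma N_l2: "l2_le M N (sqrt (\<Sum>i\<in>UNIV. (w t i * \<theta> t i / L)\<^sup>2 * noise_var i))"
  using noise_sum_l2[of "\<lambda>i. - (w t i * \<theta> t i / L)" t] unfolding N_def[abs_def] by simp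

lemma z_RH: "(\<lambda>\<omega>. x t \<omega> + P0 \<omega>) \<in> borel_measurable (RH t)"
proof -
  have [measurable]: "x t \<in> borel_measurable (RH t)" "cb t \<in> borel_measurable (RH t)" "\<And>i. c t i \<in> borel_measurable (RH t)"
    using state_measurable[of t] by auto
  note [measurable] = gF_measurable[of "x t" "RH t"]
  show ?thesis unfolding P0_def dir_def by measurable
qed

lemma P0_l2: "\<exists>a. l2_le M P0 a"
proof
  show "l2_le M P0 (\<Sum>i\<in>UNIV. \<bar>w t i\<bar> * (\<bar>\<theta> t i / L\<bar> * Q))"
    unfolding P0_def[abs_def] by (intro l2_le_sum l2_le_scaleR l2_le_minus dir_l2)
qed

lemma gFF_z_l2: "\<exists>a. l2_le M (\<lambda>\<omega>. gFF (x t \<omega> + P0 \<omega>)) a"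
proof -
  obtain a where "l2_le M P0 a" using P0_l2 by blast
  from l2_le_add[OF x_l2 this] have "l2_le M (\<lambda>\<omega>. x t \<omega> - xs + P0 \<omega>) (R + a)" .
  then have "l2_le M (\<lambda>\<omega>. gFF (x t \<omega> + P0 \<omega>)) (L * (R + a))"
  proof (rule l2_le_dominated)
    show "(\<lambda>\<omega>. gFF (x t \<omega> + P0 \<omega>)) \<in> borel_measurable M"
      using measurable_from_subalg[OF subalg_RH gFF_measurable[OF z_RH]] .
    show "AE \<omega> in M. norm (gFF (x t \<omega> + P0 \<omega>)) \<le> L * norm (x t \<omega> - xs + P0 \<omega>)"
      using smooth_fun_lipschitz[OF smooth_FF, of _ xs] by (intro AE_I2) (simp add: gFF_xs diff_add_eq)
  qed (use L in simp)
  then show ?thesis by blast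
qed

lemma gFF_z_N: "(\<integral>\<omega>. gFF (x t \<omega> + P0 \<omega>) \<bullet> N \<omega> \<partial>M) = 0"
proof -
  obtain a where a: "l2_le M (\<lambda>\<omega>. gFF (x t \<omega> + P0 \<omega>)) a" using gFF_z_l2 by blast
  have RHo: "sets (RH t) \<subseteq> sets (others_history i t 0)" for i using RH_LH LH_others by blast
  have z: "(\<integral>\<omega>. gFF (x t \<omega> + P0 \<omega>) \<bullet> noise_bar t i \<omega> \<partial>M) = 0" for i
    by (rule noise_bar_orthogonal[OF a measurable_mono_sets[OF gFF_measurable[OF z_RH] RHo]]) simp
  have "(\<integral>\<omega>. gFF (x t \<omega> + P0 \<omega>) \<bullet> N \<omega> \<partial>M) =
     (\<Sum>i\<in>UNIV. \<integral>\<omega>. gFF (x t \<omega> + P0 \<omega>) \<bullet> ((- (w t i * \<theta> t i / L)) *\<^sub>R noise_bar t i \<omega>) \<partial>M)"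
    unfolding N_def inner_sum_right
    by (intro Bochner_Integration.integral_sum l2_le_inner_integrable[OF a l2_le_scaleR[OF noise_bar_l2]])
  also have "\<dots> = 0" using z by (intro sum.neutral) simp
  finally show ?thesis .
qed

abbreviation "A i \<equiv> \<theta> t i / (2 * L * R\<^sup>2)"

text \<open>
  The quadratic decrease \<open>gap - A i * gap\<^sup>2\<close> is replaced by its tangent at \<open>u\<close>, which is an affine function
  of the gap and hence compatible with taking expectations.
\<close>

lemma pointwise_descent:
  assumes \<omega>: "\<omega> \<in> space M" and xb: "x t \<omega> \<in> cball xs R"
  shows "FF (x (Suc t) \<omega>) - FF xs \<le>
     (\<Sum>i\<in>UNIV. w t i * ((u - A i * u\<^sup>2) + (1 - 2 * A i * u) * (gap \<omega> - u)))
     + (\<Sum>i\<in>UNIV. w t i * (\<theta> t i / (2 * L)) * (norm (beta i \<omega>))\<^sup>2)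
     + gFF (x t \<omega> + P0 \<omega>) \<bullet> N \<omega>
     + L / 2 * (\<Sum>i\<in>UNIV. w t i * (\<theta> t i / L)\<^sup>2 * (norm (dG i \<omega>))\<^sup>2)
     + L * (norm (N \<omega>))\<^sup>2"
proof -
  \<comment> \<open>\<open>P\<close> is the server step without its noise; it differs from \<open>P0\<close> by the drift only.\<close>
  define p where "p i = - ((\<theta> t i / L) *\<^sub>R (dir i \<omega> + dG i \<omega>))" for i
  define P where "P = (\<Sum>i\<in>UNIV. w t i *\<^sub>R p i)"
  let ?x = "x t \<omega>"
  have xS: "x (Suc t) \<omega> = ?x + P + N \<omega>"
  proof -
    have "w t i *\<^sub>R (y t i (H i) \<omega> - ?x) = w t i *\<^sub>R p i + (- (w t i * \<theta> t i / L)) *\<^sub>R noise_bar t i \<omega>" for i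
      unfolding local_update_eq[OF \<omega>] p_def by (simp add: scaleR_add_right algebra_simps)
    then show ?thesis unfolding x_Suc[OF \<omega>] P_def N_def by (simp only: sum.distrib add.assoc)
  qed
  have PP0: "P - P0 \<omega> = (\<Sum>i\<in>UNIV. w t i *\<^sub>R (- ((\<theta> t i / L) *\<^sub>R dG i \<omega>)))"
    unfolding P_def P0_def p_def sum_subtractf[symmetric]
    by (intro sum.cong) (simp_all add: algebra_simps)
  have "(norm (P - P0 \<omega>))\<^sup>2 \<le> (\<Sum>i\<in>UNIV. w t i * (norm (- ((\<theta> t i / L) *\<^sub>R dG i \<omega>)))\<^sup>2)"
    unfolding PP0 using w0 w1 by (intro norm_sq_weighted_sum_le) auto
  then have 3: "(norm (P - P0 \<omega>))\<^sup>2 \<le> (\<Sum>i\<in>UNIV. w t i * (\<theta> t i / L)\<^sup>2 * (norm (dG i \<omega>))\<^sup>2)"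
    by (simp add: power_mult_distrib power_divide mult.assoc)
  have 1: "FF (?x + P + N \<omega>) \<le> FF (?x + P) + gFF (?x + P) \<bullet> N \<omega> + L / 2 * (norm (N \<omega>))\<^sup>2"
    using smooth_fun_descent[OF smooth_FF, of "?x + P + N \<omega>" "?x + P"] by simp
  have 2: "gFF (?x + P) \<bullet> N \<omega> \<le> gFF (?x + P0 \<omega>) \<bullet> N \<omega> + L / 2 * (norm (P - P0 \<omega>))\<^sup>2 + L / 2 * (norm (N \<omega>))\<^sup>2"
  proof -
    have "gFF (?x + P) \<bullet> N \<omega> - gFF (?x + P0 \<omega>) \<bullet> N \<omega> \<le> norm (gFF (?x + P) - gFF (?x + P0 \<omega>)) * norm (N \<omega>)"
      unfolding inner_diff_left[symmetric] by (rule norm_cauchy_schwarz)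
    also have "\<dots> \<le> L * norm (P - P0 \<omega>) * norm (N \<omega>)"
      using smooth_fun_lipschitz[OF smooth_FF, of "?x + P" "?x + P0 \<omega>"] by (intro mult_right_mono) auto
    also have "\<dots> = L / 2 * (2 * norm (P - P0 \<omega>) * norm (N \<omega>))" by simp
    also have "\<dots> \<le> L / 2 * ((norm (P - P0 \<omega>))\<^sup>2 + (norm (N \<omega>))\<^sup>2)"
      using L by (intro mult_left_mono sum_squares_bound) auto
    finally show ?thesis by (simp add: distrib_left)
  qed
  have 4: "FF (?x + P) \<le> (\<Sum>i\<in>UNIV. w t i * FF (?x + p i))"
  proof -
    have "?x + P = (\<Sum>i\<in>UNIV. w t i *\<^sub>R (?x + p i))"
      unfolding P_def scaleR_add_right sum.distrib scaleR_left.sum[symmetric] w1 by simp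
    then show ?thesis
      using convex_on_sum[OF _ _ convex_FF w1[of t], of "\<lambda>i. ?x + p i"] w0 by auto
  qed
  have 5: "FF (?x + p i) - FF xs \<le> (u - A i * u\<^sup>2) + (1 - 2 * A i * u) * (gap \<omega> - u) + \<theta> t i / (2 * L) * (norm (beta i \<omega>))\<^sup>2" for i
  proof -
    have "FF (?x + p i) \<le> FF ?x + \<theta> t i / (2 * L) * ((norm (beta i \<omega>))\<^sup>2 - (norm (gFF ?x))\<^sup>2)"
      using smooth_gradient_step_error[OF smooth_FF L less_imp_le[OF \<theta>0[of t i]] \<theta>1, of ?x "beta i \<omega>"]
      by (simp add: p_def dir_eq[OF \<omega>] beta_def add_ac)
    moreover have "A i * (gap \<omega>)\<^sup>2 \<le> \<theta> t i / (2 * L) * (norm (gFF ?x))\<^sup>2"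
    proof -
      have "gap \<omega> \<le> norm (gFF ?x) * R"
        using gap_le_gradient[of ?x] xb
        by (rule_tac order_trans) (auto intro!: mult_left_mono simp: dist_norm norm_minus_commute)
      then have "(gap \<omega>)\<^sup>2 \<le> (norm (gFF ?x) * R)\<^sup>2" using gap_nonneg by (intro power_mono) auto
      then have "A i * (gap \<omega>)\<^sup>2 \<le> A i * (norm (gFF ?x) * R)\<^sup>2"
        using \<theta>0[of t i] L by (intro mult_left_mono) auto
      also have "\<dots> = \<theta> t i / (2 * L) * (norm (gFF ?x))\<^sup>2" using R by (simp add: power_mult_distrib)
      finally show ?thesis .
    qed
    moreover have "gap \<omega> - A i * (gap \<omega>)\<^sup>2 \<le> (u - A i * u\<^sup>2) + (1 - 2 * A i * u) * (gap \<omega> - u)"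
      using \<theta>0[of t i] L by (intro concave_tangent) simp
    ultimately show ?thesis by (simp add: right_diff_distrib)
  qed
  have "(\<Sum>i\<in>UNIV. w t i * FF (?x + p i)) - FF xs = (\<Sum>i\<in>UNIV. w t i * (FF (?x + p i) - FF xs))"
    using w1[of t] by (simp add: right_diff_distrib sum_subtractf sum_distrib_right[symmetric])
  also have "\<dots> \<le> (\<Sum>i\<in>UNIV. w t i * ((u - A i * u\<^sup>2) + (1 - 2 * A i * u) * (gap \<omega> - u) + \<theta> t i / (2 * L) * (norm (beta i \<omega>))\<^sup>2))"
    using 5 w0 by (intro sum_mono mult_left_mono) auto
  also have "\<dots> = (\<Sum>i\<in>UNIV. w t i * ((u - A i * u\<^sup>2) + (1 - 2 * A i * u) * (gap \<omega> - u)))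
     + (\<Sum>i\<in>UNIV. w t i * (\<theta> t i / (2 * L)) * (norm (beta i \<omega>))\<^sup>2)"
    by (simp only: distrib_left sum.distrib mult.assoc)
  finally have 6: "(\<Sum>i\<in>UNIV. w t i * FF (?x + p i)) - FF xs \<le>
     (\<Sum>i\<in>UNIV. w t i * ((u - A i * u\<^sup>2) + (1 - 2 * A i * u) * (gap \<omega> - u)))
     + (\<Sum>i\<in>UNIV. w t i * (\<theta> t i / (2 * L)) * (norm (beta i \<omega>))\<^sup>2)" .
  have 7: "L / 2 * (norm (P - P0 \<omega>))\<^sup>2 \<le> L / 2 * (\<Sum>i\<in>UNIV. w t i * (\<theta> t i / L)\<^sup>2 * (norm (dG i \<omega>))\<^sup>2)"
    using 3 L by (intro mult_left_mono) auto
  show ?thesis unfolding xS using 1 2 4 6 7 by linarith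
qed

text \<open>The tangent at \<open>u\<close> has nonnegative slope, so that the bound \<open>u\<close> on the expected gap may be inserted.\<close>

lemma Au_le: "2 * A i * u \<le> 1"
proof -
  have "2 * A i * u \<le> 2 * A i * (L * R\<^sup>2 / 2)" using u \<theta>0[of t i] L by (intro mult_left_mono) auto
  also have "\<dots> = \<theta> t i / 2" using L R by simp
  finally show ?thesis using \<theta>1[of t i] by linarith
qed

lemma expected_descent:
  "(\<integral>\<omega>. (FF (x (Suc t) \<omega>) - FF xs) \<partial>M) \<le>
     (\<Sum>i\<in>UNIV. w t i * (u - A i * u\<^sup>2))
     + (\<Sum>i\<in>UNIV. w t i * (\<theta> t i / (2 * L)) * (\<theta> t i * (Q + s i) + 2 * sqrt X)\<^sup>2)
     + L / 2 * (\<Sum>i\<in>UNIV. w t i * (\<theta> t i / L)\<^sup>2 * (\<theta> t i * (Q + s i))\<^sup>2)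
     + L * (\<Sum>i\<in>UNIV. (w t i * \<theta> t i / L)\<^sup>2 * noise_var i)"
proof -
  let ?T1 = "\<lambda>\<omega>. \<Sum>i\<in>UNIV. w t i * ((u - A i * u\<^sup>2) + (1 - 2 * A i * u) * (gap \<omega> - u))"
  let ?T2 = "\<lambda>\<omega>. \<Sum>i\<in>UNIV. w t i * (\<theta> t i / (2 * L)) * (norm (beta i \<omega>))\<^sup>2"
  let ?T3 = "\<lambda>\<omega>. gFF (x t \<omega> + P0 \<omega>) \<bullet> N \<omega>"
  let ?T4 = "\<lambda>\<omega>. L / 2 * (\<Sum>i\<in>UNIV. w t i * (\<theta> t i / L)\<^sup>2 * (norm (dG i \<omega>))\<^sup>2)"
  let ?T5 = "\<lambda>\<omega>. L * (norm (N \<omega>))\<^sup>2"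
  have I1': "integrable M (\<lambda>\<omega>. (u - A i * u\<^sup>2) + (1 - 2 * A i * u) * (gap \<omega> - u))" for i
    by (intro Bochner_Integration.integrable_add integrable_mult_right Bochner_Integration.integrable_diff gap_integrable) simp_all
  have I1: "integrable M ?T1" using I1' by (intro Bochner_Integration.integrable_sum integrable_mult_right)
  have I2: "integrable M ?T2"
    by (intro Bochner_Integration.integrable_sum integrable_mult_right l2_leD(2)[OF beta_l2])
  obtain a where a: "l2_le M (\<lambda>\<omega>. gFF (x t \<omega> + P0 \<omega>)) a" using gFF_z_l2 by blast
  have I3: "integrable M ?T3" by (rule l2_le_inner_integrable[OF a N_l2])
  have I4: "integrable M ?T4"
    by (intro Bochner_Integration.integrable_sum integrable_mult_right l2_leD(2)[OF dG_l2])
  have I5: "integrable M ?T5" by (intro integrable_mult_right l2_leD(2)[OF N_l2])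
  have "(\<integral>\<omega>. (FF (x (Suc t) \<omega>) - FF xs) \<partial>M) \<le> (\<integral>\<omega>. ?T1 \<omega> + ?T2 \<omega> + ?T3 \<omega> + ?T4 \<omega> + ?T5 \<omega> \<partial>M)"
  proof (rule integral_mono_AE')
    show le: "AE \<omega> in M. FF (x (Suc t) \<omega>) - FF xs \<le> ?T1 \<omega> + ?T2 \<omega> + ?T3 \<omega> + ?T4 \<omega> + ?T5 \<omega>"
      using AE_space ball_x[of t] by eventually_elim (rule pointwise_descent)
    show "AE \<omega> in M. 0 \<le> ?T1 \<omega> + ?T2 \<omega> + ?T3 \<omega> + ?T4 \<omega> + ?T5 \<omega>"
      using le by eventually_elim (rule order_trans[OF gap_nonneg])
    show "integrable M (\<lambda>\<omega>. ?T1 \<omega> + ?T2 \<omega> + ?T3 \<omega> + ?T4 \<omega> + ?T5 \<omega>)"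
      using I1 I2 I3 I4 I5 by (intro Bochner_Integration.integrable_add)
  qed
  also have "\<dots> = (\<integral>\<omega>. ?T1 \<omega> \<partial>M) + (\<integral>\<omega>. ?T2 \<omega> \<partial>M) + (\<integral>\<omega>. ?T3 \<omega> \<partial>M) + (\<integral>\<omega>. ?T4 \<omega> \<partial>M) + (\<integral>\<omega>. ?T5 \<omega> \<partial>M)"
    by (rule integral_add5[OF I1 I2 I3 I4 I5])
  also have "(\<integral>\<omega>. ?T1 \<omega> \<partial>M) \<le> (\<Sum>i\<in>UNIV. w t i * (u - A i * u\<^sup>2))"
  proof -
    have "(\<integral>\<omega>. ?T1 \<omega> \<partial>M) = (\<Sum>i\<in>UNIV. w t i * (\<integral>\<omega>. (u - A i * u\<^sup>2) + (1 - 2 * A i * u) * (gap \<omega> - u) \<partial>M))"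
      by (subst Bochner_Integration.integral_sum) (simp only: integral_mult_right_zero | intro integrable_mult_right I1')+
    also have "\<dots> \<le> (\<Sum>i\<in>UNIV. w t i * (u - A i * u\<^sup>2))"
    proof (intro sum_mono mult_left_mono w0)
      fix i
      have gi: "integrable M (\<lambda>\<omega>. gap \<omega> - u)"
        by (rule Bochner_Integration.integrable_diff[OF gap_integrable]) simp
      have "(\<integral>\<omega>. (u - A i * u\<^sup>2) + (1 - 2 * A i * u) * (gap \<omega> - u) \<partial>M) =
          (u - A i * u\<^sup>2) + (1 - 2 * A i * u) * ((\<integral>\<omega>. gap \<omega> \<partial>M) - u)"
        by (subst Bochner_Integration.integral_add)
          (use gi integrable_mult_right[OF gi] in \<open>simp_all add: Bochner_Integration.integral_diff[OF gap_integrable] prob_space\<close>)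
      also have "\<dots> \<le> u - A i * u\<^sup>2"
        using gap_le Au_le[of i] mult_nonneg_nonpos[of "1 - 2 * A i * u" "(\<integral>\<omega>. gap \<omega> \<partial>M) - u"] by simp
      finally show "(\<integral>\<omega>. (u - A i * u\<^sup>2) + (1 - 2 * A i * u) * (gap \<omega> - u) \<partial>M) \<le> u - A i * u\<^sup>2" .
    qed
    finally show ?thesis .
  qed
  also have "(\<integral>\<omega>. ?T2 \<omega> \<partial>M) \<le> (\<Sum>i\<in>UNIV. w t i * (\<theta> t i / (2 * L)) * (\<theta> t i * (Q + s i) + 2 * sqrt X)\<^sup>2)"
  proof -
    have "(\<integral>\<omega>. ?T2 \<omega> \<partial>M) = (\<Sum>i\<in>UNIV. w t i * (\<theta> t i / (2 * L)) * (\<integral>\<omega>. (norm (beta i \<omega>))\<^sup>2 \<partial>M))"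
      by (subst Bochner_Integration.integral_sum) (auto intro!: integrable_mult_right l2_leD(2)[OF beta_l2])
    also have "\<dots> \<le> (\<Sum>i\<in>UNIV. w t i * (\<theta> t i / (2 * L)) * (\<theta> t i * (Q + s i) + 2 * sqrt X)\<^sup>2)"
      using w0 L \<theta>0 l2_leD(4)[OF beta_l2] by (intro sum_mono mult_left_mono) (auto simp: less_imp_le)
    finally show ?thesis .
  qed
  also have "(\<integral>\<omega>. ?T3 \<omega> \<partial>M) = 0" by (rule gFF_z_N)
  also have "(\<integral>\<omega>. ?T4 \<omega> \<partial>M) \<le> L / 2 * (\<Sum>i\<in>UNIV. w t i * (\<theta> t i / L)\<^sup>2 * (\<theta> t i * (Q + s i))\<^sup>2)"
  proof -
    have "(\<integral>\<omega>. ?T4 \<omega> \<partial>M) = L / 2 * (\<Sum>i\<in>UNIV. w t i * (\<theta> t i / L)\<^sup>2 * (\<integral>\<omega>. (norm (dG i \<omega>))\<^sup>2 \<partial>M))"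
      unfolding integral_mult_right_zero
      by (subst Bochner_Integration.integral_sum) (auto intro!: integrable_mult_right l2_leD(2)[OF dG_l2])
    also have "\<dots> \<le> L / 2 * (\<Sum>i\<in>UNIV. w t i * (\<theta> t i / L)\<^sup>2 * (\<theta> t i * (Q + s i))\<^sup>2)"
      using w0 L l2_leD(4)[OF dG_l2] by (intro sum_mono mult_left_mono) auto
    finally show ?thesis .
  qed
  also have "(\<integral>\<omega>. ?T5 \<omega> \<partial>M) \<le> L * (\<Sum>i\<in>UNIV. (w t i * \<theta> t i / L)\<^sup>2 * noise_var i)"
  proof -
    have "(\<integral>\<omega>. ?T5 \<omega> \<partial>M) = L * (\<integral>\<omega>. (norm (N \<omega>))\<^sup>2 \<partial>M)" by (rule integral_mult_right_zero)
    also have "\<dots> \<le> L * (sqrt (\<Sum>i\<in>UNIV. (w t i * \<theta> t i / L)\<^sup>2 * noise_var i))\<^sup>2"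
      using L l2_leD(4)[OF N_l2] by (intro mult_left_mono) auto
    also have "\<dots> = L * (\<Sum>i\<in>UNIV. (w t i * \<theta> t i / L)\<^sup>2 * noise_var i)"
      using noise_var_nonneg by (simp add: sum_nonneg)
    finally show ?thesis .
  qed
  finally show ?thesis by simp
qed

end

section \<open>Comparison with the surrogate objective\<close>

text \<open>\<open>E\<close> stands for the exponential factor of \<open>rho_fun\<close>, of which only \<open>1 \<le> E\<close> is needed.\<close>

lemma bias_drift_arith:
  fixes \<theta> L E :: real
  assumes \<theta>: "0 < \<theta>" "\<theta> \<le> 1" and L: "0 < L" and E: "1 \<le> E"
    and nn: "0 \<le> u" "0 \<le> X" "0 \<le> v" "v \<le> v'" and Q: "Q\<^sup>2 = 4 * L * u + 8 * X"
  shows "\<theta> / (2 * L) * (\<theta> * (Q + sqrt v) + 2 * sqrt X)\<^sup>2 + L / 2 * ((\<theta> / L)\<^sup>2 * (\<theta> * (Q + sqrt v))\<^sup>2) \<le>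
    32 * E * \<theta> ^ 3 * u + (16 * \<theta> + 64 * E * \<theta> ^ 3) / L * X + 8 * E * (\<theta> ^ 3 * v' / L)"
proof -
  have two: "(a + b)\<^sup>2 \<le> 2 * a\<^sup>2 + 2 * b\<^sup>2" for a b :: real
    using sum_squares_bound[of a b] by (simp add: power2_sum)
  have QS: "(Q + sqrt v)\<^sup>2 \<le> 2 * (Q\<^sup>2 + v)" using two[of Q "sqrt v"] nn by simp
  have D: "(\<theta> * (Q + sqrt v))\<^sup>2 \<le> 2 * \<theta>\<^sup>2 * (Q\<^sup>2 + v)"
    using mult_left_mono[OF QS, of "\<theta>\<^sup>2"] by (simp only: power_mult_distrib mult.assoc mult.left_commute[of 2] zero_le_power2)
  have "(\<theta> * (Q + sqrt v) + 2 * sqrt X)\<^sup>2 \<le> 4 * \<theta>\<^sup>2 * (Q\<^sup>2 + v) + 8 * X"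
    using two[of "\<theta> * (Q + sqrt v)" "2 * sqrt X"] D nn by (simp add: power_mult_distrib)
  then have 1: "\<theta> / (2 * L) * (\<theta> * (Q + sqrt v) + 2 * sqrt X)\<^sup>2 \<le> \<theta> / (2 * L) * (4 * \<theta>\<^sup>2 * (Q\<^sup>2 + v) + 8 * X)"
    using \<theta> L by (intro mult_left_mono) auto
  have "L / 2 * ((\<theta> / L)\<^sup>2 * (\<theta> * (Q + sqrt v))\<^sup>2) \<le> L / 2 * ((\<theta> / L)\<^sup>2 * (2 * \<theta>\<^sup>2 * (Q\<^sup>2 + v)))"
    using D L by (intro mult_left_mono) auto
  also have "\<dots> = \<theta> ^ 4 / L * (Q\<^sup>2 + v)"
    using L by (simp add: power2_eq_square power4_eq_xxxx)
  also have "\<dots> \<le> \<theta> ^ 3 / L * (Q\<^sup>2 + v)"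
    using \<theta> L nn power_decreasing[of 3 4 \<theta>] by (intro mult_right_mono divide_right_mono) auto
  finally have 2: "L / 2 * ((\<theta> / L)\<^sup>2 * (\<theta> * (Q + sqrt v))\<^sup>2) \<le> \<theta> ^ 3 / L * (Q\<^sup>2 + v)" .
  have "\<theta> / (2 * L) * (4 * \<theta>\<^sup>2 * (Q\<^sup>2 + v) + 8 * X) + \<theta> ^ 3 / L * (Q\<^sup>2 + v) =
      12 * \<theta> ^ 3 * u + (4 * \<theta> + 24 * \<theta> ^ 3) / L * X + 3 * (\<theta> ^ 3 * v / L)"
    unfolding Q using L by (simp add: field_simps power2_eq_square power3_eq_cube)
  also have "\<dots> \<le> 32 * E * \<theta> ^ 3 * u + (16 * \<theta> + 64 * E * \<theta> ^ 3) / L * X + 8 * E * (\<theta> ^ 3 * v' / L)"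
  proof (intro add_mono)
    have t3: "0 \<le> \<theta> ^ 3" using \<theta> by simp
    have Et: "\<theta> ^ 3 \<le> E * \<theta> ^ 3" using mult_right_mono[OF E t3] by simp
    then have "12 * \<theta> ^ 3 \<le> 32 * E * \<theta> ^ 3" using t3 by linarith
    then show "12 * \<theta> ^ 3 * u \<le> 32 * E * \<theta> ^ 3 * u" using nn(1) by (rule mult_right_mono)
    have "4 * \<theta> + 24 * \<theta> ^ 3 \<le> 16 * \<theta> + 64 * E * \<theta> ^ 3" using Et t3 \<theta> by linarith
    then show "(4 * \<theta> + 24 * \<theta> ^ 3) / L * X \<le> (16 * \<theta> + 64 * E * \<theta> ^ 3) / L * X"
      using nn L by (intro mult_right_mono divide_right_mono) auto
    have "\<theta> ^ 3 * v / L \<le> \<theta> ^ 3 * v' / L" using t3 nn L by (intro divide_right_mono mult_left_mono) auto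
    moreover have "0 \<le> \<theta> ^ 3 * v / L" using t3 nn L by simp
    ultimately show "3 * (\<theta> ^ 3 * v / L) \<le> 8 * E * (\<theta> ^ 3 * v' / L)"
      using E by (intro mult_mono) auto
  qed
  finally show ?thesis using 1 2 by linarith
qed

lemma T_map_lower_bound:
  assumes "0 \<le> a" "0 \<le> u"
  shows "u - a * u\<^sup>2 \<le> T_map a u"
proof -
  have "(u - a * u\<^sup>2) * (1 + a * u) = u - a * a * (u * u * u)" by (simp add: power2_eq_square algebra_simps)
  also have "\<dots> \<le> u" using assms by simp
  finally have "(u - a * u\<^sup>2) * (1 + a * u) \<le> u" .
  moreover have "0 < 1 + a * u" using assms by (simp add: add_pos_nonneg)
  ultimately show ?thesis by (simp add: T_map_def pos_le_divide_eq)
qed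

context hew_round begin

lemma surrogate_descent:
  assumes V: "\<And>i. node_var \<phi> m xs R i \<le> V i"
  shows "(\<integral>\<omega>. (FF (x (Suc t) \<omega>) - FF xs) \<partial>M) \<le> surrogate_obj L R H b V (w t) (\<theta> t) u X"
proof -
  have v: "noise_var i \<le> V i / (real (H i) * real (b i))" for i
    unfolding noise_var_def using V by (intro divide_right_mono) auto
  have one: "(u - A i * u\<^sup>2) + (\<theta> t i / (2 * L) * (\<theta> t i * (Q + s i) + 2 * sqrt X)\<^sup>2
      + L / 2 * ((\<theta> t i / L)\<^sup>2 * (\<theta> t i * (Q + s i))\<^sup>2)) \<le>
      u - (s_fun L R (\<theta> t i) u - rho_fun L H b V i (\<theta> t i) u X)" for i
  proof -
    have "u - A i * u\<^sup>2 \<le> T_map (A i) u"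
      using \<theta>0[of t i] L u by (intro T_map_lower_bound) auto
    moreover have "\<theta> t i / (2 * L) * (\<theta> t i * (Q + s i) + 2 * sqrt X)\<^sup>2
      + L / 2 * ((\<theta> t i / L)\<^sup>2 * (\<theta> t i * (Q + s i))\<^sup>2) \<le> 
      32 * exp (2 * \<theta> t i) * \<theta> t i ^ 3 * u + (16 * \<theta> t i + 64 * exp (2 * \<theta> t i) * \<theta> t i ^ 3) / L * X
      + 8 * exp (2 * \<theta> t i) * (\<theta> t i ^ 3 * (V i / (real (H i) * real (b i))) / L)"
      using \<theta>0[of t i]
      by (intro bias_drift_arith[OF \<theta>0 \<theta>1 L _ u(1) X noise_var_nonneg v Q_sq]) simp
    moreover have "rho_fun L H b V i (\<theta> t i) u X =
      32 * exp (2 * \<theta> t i) * \<theta> t i ^ 3 * u + (16 * \<theta> t i + 64 * exp (2 * \<theta> t i) * \<theta> t i ^ 3) / L * X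
      + 8 * exp (2 * \<theta> t i) * (\<theta> t i ^ 3 * (V i / (real (H i) * real (b i))) / L)"
      by (simp only: rho_fun_def times_divide_eq_right times_divide_eq_left divide_divide_eq_left mult_ac)
    ultimately show ?thesis unfolding s_fun_def by linarith
  qed
  have two: "L * ((w t i * \<theta> t i / L)\<^sup>2 * noise_var i) \<le> L / 2 * ((w t i)\<^sup>2 * kappa_fun L H b V i (\<theta> t i) u X)" for i
  proof -
    have v0: "0 \<le> V i / (L\<^sup>2 * real (H i) * real (b i))"
      using order_trans[OF node_var_nonneg V, of i] by simp
    have "2 * (\<theta> t i)\<^sup>2 * (noise_var i / L\<^sup>2) \<le> 2 * (\<theta> t i)\<^sup>2 * (V i / (real (H i) * real (b i)) / L\<^sup>2)"
      using v by (intro mult_left_mono divide_right_mono) auto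
    also have "\<dots> = 2 * (\<theta> t i)\<^sup>2 * (V i / (L\<^sup>2 * real (H i) * real (b i)))" by (simp add: mult_ac)
    also have "\<dots> \<le> kappa_fun L H b V i (\<theta> t i) u X"
    proof -
      have "0 \<le> 16 * exp (2 * \<theta> t i) * (\<theta> t i ^ 4 / L) * u" "0 \<le> 32 * exp (2 * \<theta> t i) * (\<theta> t i ^ 4 / L\<^sup>2) * X"
        "0 \<le> 4 * exp (2 * \<theta> t i) * \<theta> t i ^ 4 * (V i / (L\<^sup>2 * real (H i) * real (b i)))"
        using u X L by (auto intro!: mult_nonneg_nonneg v0 simp del: times_divide_eq_right)
      then show ?thesis unfolding kappa_fun_def distrib_right by linarith
    qed
    finally have "L / 2 * ((w t i)\<^sup>2 * (2 * (\<theta> t i)\<^sup>2 * (noise_var i / L\<^sup>2))) \<le> L / 2 * ((w t i)\<^sup>2 * kappa_fun L H b V i (\<theta> t i) u X)"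
      using L by (intro mult_left_mono) auto
    then show ?thesis by (simp add: power_mult_distrib power_divide mult_ac)
  qed
  have "(\<integral>\<omega>. (FF (x (Suc t) \<omega>) - FF xs) \<partial>M) \<le>
     (\<Sum>i\<in>UNIV. w t i * ((u - A i * u\<^sup>2) + (\<theta> t i / (2 * L) * (\<theta> t i * (Q + s i) + 2 * sqrt X)\<^sup>2
      + L / 2 * ((\<theta> t i / L)\<^sup>2 * (\<theta> t i * (Q + s i))\<^sup>2))))
     + (\<Sum>i\<in>UNIV. L * ((w t i * \<theta> t i / L)\<^sup>2 * noise_var i))"
    using expected_descent
    by (simp add: distrib_left sum.distrib sum_distrib_left mult_ac add_ac)
  also have "\<dots> \<le> (\<Sum>i\<in>UNIV. w t i * (u - (s_fun L R (\<theta> t i) u - rho_fun L H b V i (\<theta> t i) u X)))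
     + (\<Sum>i\<in>UNIV. L / 2 * ((w t i)\<^sup>2 * kappa_fun L H b V i (\<theta> t i) u X))"
    using one two w0 by (intro add_mono sum_mono mult_left_mono) auto
  also have "\<dots> = surrogate_obj L R H b V (w t) (\<theta> t) u X"
    unfolding surrogate_obj_def using w1[of t]
    by (simp only: right_diff_distrib sum_subtractf sum_distrib_left[symmetric] sum_distrib_right[symmetric] mult_1)
  finally show ?thesis .
qed

end

section \<open>The control error\<close>

lemma two_mult_le_weighted_squares:
  fixes S p :: real
  shows "41 / 8 * (S * p) \<le> 3 / 10 * S\<^sup>2 + 32 * p\<^sup>2" and "7 * (S * p) \<le> 67 / 100 * S\<^sup>2 + 32 * p\<^sup>2"
proof -
  have "0 \<le> (1 / 2 * S - 41 / 8 * p)\<^sup>2" by simp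
  then have "41 / 8 * (S * p) \<le> 1 / 4 * S\<^sup>2 + 1681 / 64 * p\<^sup>2"
    by (simp add: power2_eq_square algebra_simps)
  then show "41 / 8 * (S * p) \<le> 3 / 10 * S\<^sup>2 + 32 * p\<^sup>2"
    using zero_le_power2[of S] zero_le_power2[of p] by linarith
  have "0 \<le> (7 / 10 * S - 5 * p)\<^sup>2" by simp
  then have "7 * (S * p) \<le> 49 / 100 * S\<^sup>2 + 25 * p\<^sup>2"
    by (simp add: power2_eq_square algebra_simps)
  then show "7 * (S * p) \<le> 67 / 100 * S\<^sup>2 + 32 * p\<^sup>2"
    using zero_le_power2[of S] zero_le_power2[of p] by linarith
qed

text \<open>
  The next two lemmas bound the second moment of the control error at elapsed fraction \<open>\<tau>\<close> when all the
  server weight lies on other nodes, and when it lies on the node itself. Here \<open>S\<close> bounds the \<open>L\<^sup>2\<close> norms of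
  the averaged noises and \<open>p\<close> the rescaled directions. The first bound is kept affine in \<open>\<tau>\<close>, because it
  exceeds the target \<open>6 S\<^sup>2 + 36 p\<^sup>2\<close> at \<open>\<tau> = 1\<close> and meets it only on average.
\<close>

lemma other_node_arith:
  fixes S p \<tau> :: real
  assumes "0 \<le> S" "0 \<le> p" "0 \<le> \<tau>" "\<tau> \<le> 1"
  shows "S\<^sup>2 + 2 * (S * (\<tau> * p + sqrt \<tau> * S)) + ((\<tau> + 1) * p + (sqrt \<tau> + 1) * S)\<^sup>2 \<le>
     S\<^sup>2 * ((24 / 7) + 19 / 5 * \<tau>) + S * p * (6 * \<tau> + 4) + 4 * p\<^sup>2"
proof -
  define r where "r = sqrt \<tau>"
  have r: "0 \<le> r" "r \<le> 1" "r\<^sup>2 = \<tau>" using assms by (auto simp: r_def)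
  have "0 \<le> (7 / 5 * r - 1)\<^sup>2" by simp
  then have "14 / 5 * r \<le> 49 / 25 * r\<^sup>2 + 1" by (simp add: power2_eq_square algebra_simps)
  then have a: "2 + 4 * r + \<tau> \<le> (24 / 7) + 19 / 5 * \<tau>" unfolding r(3) using assms by linarith
  have b: "2 * \<tau> + 2 * ((\<tau> + 1) * (r + 1)) \<le> 6 * \<tau> + 4"
    using mult_left_mono[OF r(2), of "\<tau> + 1"] assms by (simp add: algebra_simps)
  have c: "(\<tau> + 1)\<^sup>2 \<le> 4" using power_mono[of "\<tau> + 1" 2 2] assms by simp
  have "S\<^sup>2 + 2 * (S * (\<tau> * p + r * S)) + ((\<tau> + 1) * p + (r + 1) * S)\<^sup>2 =
     S\<^sup>2 * (2 + 4 * r + r\<^sup>2) + S * p * (2 * \<tau> + 2 * ((\<tau> + 1) * (r + 1))) + (\<tau> + 1)\<^sup>2 * p\<^sup>2"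
    by (simp add: power2_eq_square algebra_simps)
  also have "\<dots> \<le> S\<^sup>2 * ((24 / 7) + 19 / 5 * \<tau>) + S * p * (6 * \<tau> + 4) + 4 * p\<^sup>2"
    unfolding r(3) using assms
    by (intro add_mono mult_left_mono[OF a] mult_left_mono[OF b] mult_right_mono[OF c]) simp_all
  finally show ?thesis by (simp add: r_def)
qed

lemma same_node_arith:
  fixes S p \<tau> :: real
  assumes "0 \<le> S" "0 \<le> p" "0 \<le> \<tau>" "\<tau> \<le> 1"
  shows "S\<^sup>2 + 2 * (S * (\<tau> * p + sqrt \<tau> * S)) + 2 * (S * (p + S))
     + (p + ((1 - \<tau>) * sqrt \<tau> + sqrt (1 - \<tau>)) * S)\<^sup>2 \<le> 6 * S\<^sup>2 + 36 * p\<^sup>2"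
proof -
  define r q where "r = sqrt \<tau>" and "q = sqrt (1 - \<tau>)"
  define k where "k = (1 - \<tau>) * r + q"
  have r: "0 \<le> r" "r\<^sup>2 = \<tau>" and q: "0 \<le> q" "q\<^sup>2 = 1 - \<tau>" using assms by (auto simp: r_def q_def)
  have "2 * r * q \<le> r\<^sup>2 + q\<^sup>2" by (rule sum_squares_bound)
  then have rq: "r * q \<le> (1 / 2)" unfolding r(2) q(2) by simp
  have "k = q * (r * q + 1)" unfolding k_def q(2)[symmetric] by (simp add: power2_eq_square algebra_simps)
  also have "\<dots> \<le> q * (3 / 2)" using rq q by (intro mult_left_mono) auto
  finally have k: "k \<le> 3 / 2 * q" by simp
  have k0: "0 \<le> k" using assms r q by (simp add: k_def)
  have "k\<^sup>2 \<le> (3 / 2 * q)\<^sup>2" using k k0 by (intro power_mono)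
  then have k2: "k\<^sup>2 \<le> 9 / 4 * (1 - \<tau>)" unfolding power_mult_distrib q(2) by (simp add: power2_eq_square)
  have "0 \<le> (3 / 2 * r - 2 / 3)\<^sup>2" by simp
  then have "2 * r \<le> 9 / 4 * r\<^sup>2 + (9 / 20)" by (simp add: power2_eq_square algebra_simps)
  then have a: "3 + 2 * r + k\<^sup>2 \<le> (57 / 10)" using k2 unfolding r(2) by simp
  have "0 \<le> (q - (3 / 4))\<^sup>2" by simp
  then have "3 / 2 * q \<le> q\<^sup>2 + (9 / 16)" by (simp add: power2_eq_square algebra_simps)
  then have b: "2 * \<tau> + 2 + 2 * k \<le> (41 / 8)" using k unfolding q(2) by simp
  have "S\<^sup>2 + 2 * (S * (\<tau> * p + r * S)) + 2 * (S * (p + S)) + (p + k * S)\<^sup>2 =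
     S\<^sup>2 * (3 + 2 * r + k\<^sup>2) + S * p * (2 * \<tau> + 2 + 2 * k) + p\<^sup>2"
    by (simp add: power2_eq_square algebra_simps)
  also have "\<dots> \<le> S\<^sup>2 * (57 / 10) + S * p * (41 / 8) + p\<^sup>2"
    using a b assms by (intro add_mono mult_left_mono) auto
  also have "\<dots> \<le> 6 * S\<^sup>2 + 36 * p\<^sup>2"
    using two_mult_le_weighted_squares(1)[of S p] zero_le_power2[of p] by linarith
  finally show ?thesis by (simp add: r_def q_def k_def)
qed

text \<open>
  A convex combination of the two bounds above, averaged over the elapsed fractions
  \<open>\<tau> = l / h\<close> of the horizon.
\<close>

lemma averaged_arith:
  fixes S p \<omega> :: real
  assumes "0 \<le> S" "0 \<le> p" "0 \<le> \<omega>" "\<omega> \<le> 1" and h: "0 < h"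
  shows "(\<Sum>l<h. (1 / real h) * ((1 - \<omega>) * (S\<^sup>2 * ((24 / 7) + 19 / 5 * (real l / real h)) + S * p * (6 * (real l / real h) + 4) + 4 * p\<^sup>2)
     + \<omega> * (6 * S\<^sup>2 + 36 * p\<^sup>2))) \<le> 6 * S\<^sup>2 + 36 * p\<^sup>2"
proof -
  define \<alpha> where "\<alpha> = (1 - \<omega>) * (24 / 7 * S\<^sup>2 + 4 * (S * p) + 4 * p\<^sup>2) + \<omega> * (6 * S\<^sup>2 + 36 * p\<^sup>2)"
  define \<beta> where "\<beta> = (1 - \<omega>) * (19 / 5 * S\<^sup>2 + 6 * (S * p))"
  have b0: "0 \<le> \<beta>" using assms by (simp add: \<beta>_def)
  have sum: "(\<Sum>l<h. real l) \<le> real h * real h / 2" for h :: nat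
    by (induction h) (auto simp: field_simps)
  have "(\<Sum>l<h. (1 / real h) * ((1 - \<omega>) * (S\<^sup>2 * ((24 / 7) + 19 / 5 * (real l / real h)) + S * p * (6 * (real l / real h) + 4) + 4 * p\<^sup>2)
     + \<omega> * (6 * S\<^sup>2 + 36 * p\<^sup>2))) = (\<Sum>l<h. \<alpha> / real h + \<beta> / (real h * real h) * real l)"
    using h by (intro sum.cong) (auto simp: \<alpha>_def \<beta>_def field_simps)
  also have "\<dots> = \<alpha> + \<beta> / (real h * real h) * (\<Sum>l<h. real l)"
    using h by (simp add: sum.distrib sum_distrib_left)
  also have "\<dots> \<le> \<alpha> + \<beta> / (real h * real h) * (real h * real h / 2)"
    using sum[of h] b0 by (intro add_left_mono mult_left_mono) auto
  also have "\<dots> = \<alpha> + \<beta> / 2" using h by simp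
  also have "\<dots> = (1 - \<omega>) * (373 / 70 * S\<^sup>2 + 7 * (S * p) + 4 * p\<^sup>2) + \<omega> * (6 * S\<^sup>2 + 36 * p\<^sup>2)"
    by (simp add: \<alpha>_def \<beta>_def field_simps)
  also have "\<dots> \<le> (1 - \<omega>) * (6 * S\<^sup>2 + 36 * p\<^sup>2) + \<omega> * (6 * S\<^sup>2 + 36 * p\<^sup>2)"
    using two_mult_le_weighted_squares(2)[of S p] zero_le_power2[of S] assms
    by (intro add_right_mono mult_left_mono) linarith+
  also have "\<dots> = 6 * S\<^sup>2 + 36 * p\<^sup>2" by (simp add: algebra_simps)
  finally show ?thesis .
qed

context hew_round begin

text \<open>The bound on the amplitudes times the bound on the directions.\<close>

definition "pp = \<theta>hi * Q"

lemma \<theta>hi0: "0 < \<theta>hi" using \<theta>0 \<theta>hi less_le_trans by blast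

lemma pp0: "0 \<le> pp" using \<theta>hi0 Q_nonneg by (simp add: pp_def)

lemma \<theta>Q: "\<theta> t i * Q \<le> pp" unfolding pp_def using \<theta>hi Q_nonneg by (intro mult_right_mono)

text \<open>The change of the gradient of node \<open>i\<close> between a local iterate and the new server iterate.\<close>

definition "Z i l \<omega> = gF i (y t i l \<omega>) - gF i (x (Suc t) \<omega>)"

text \<open>For the rest of the section, \<open>S\<close> bounds the \<open>L\<^sup>2\<close> norms of the averaged noises of all nodes.\<close>

context
  fixes S :: real
  assumes S0: "0 \<le> S" and S: "\<And>i. noise_var i \<le> S\<^sup>2"
begin

lemma s_le: "s i \<le> S" using S S0 by (simp add: real_le_lsqrt)

lemma \<theta>s: "\<theta> t i * s i \<le> S"
  using mult_left_le_one_le[OF s_nonneg less_imp_le[OF \<theta>0] \<theta>1] s_le order_trans by blast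

lemma drift_arith:
  assumes "0 \<le> \<tau>"
  shows "\<theta> t i * (\<tau> * Q + sqrt \<tau> * s i) \<le> \<tau> * pp + sqrt \<tau> * S"
  using mult_left_mono[OF \<theta>Q assms, of i] mult_left_mono[OF \<theta>s, of "sqrt \<tau>" i] assms
  by (simp add: distrib_left mult_ac)

lemma drift_S:
  assumes "l \<le> H i"
  shows "l2_le M (\<lambda>\<omega>. y t i l \<omega> - x t \<omega>)
     ((real l / real (H i) * pp + sqrt (real l / real (H i)) * S) / L)"
proof (rule l2_le_mono[OF drift[OF assms]])
  show "\<theta> t i / L * (real l / real (H i) * Q + sqrt (real l / real (H i)) * s i) \<le>
    (real l / real (H i) * pp + sqrt (real l / real (H i)) * S) / L"
    using drift_arith[of "real l / real (H i)" i] L by (simp add: divide_right_mono)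
qed

lemma final_drift_S: "l2_le M (\<lambda>\<omega>. y t i (H i) \<omega> - x t \<omega>) ((pp + S) / L)"
  using drift_S[of "H i" i] Hpos[of i] by simp

lemma distance_other_node:
  assumes "l \<le> H i"
  shows "l2_le M (\<lambda>\<omega>. y t i l \<omega> - y t j (H j) \<omega>)
     (((real l / real (H i) + 1) * pp + (sqrt (real l / real (H i)) + 1) * S) / L)"
  using l2_le_diff[OF drift_S[OF assms] final_drift_S[of j]]
  by (simp add: add_divide_distrib[symmetric] distrib_right add_ac)

text \<open>
  Restarting the drift estimate at step \<open>l\<close> gives a better bound than going back to \<open>x t\<close>: the noise drawn
  before step \<open>l\<close> matters only through the change of direction.
\<close>

lemma distance_same_node:
  assumes l: "l \<le> H i" and \<tau>: "\<tau> = real l / real (H i)"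
  shows "l2_le M (\<lambda>\<omega>. y t i l \<omega> - y t i (H i) \<omega>)
     ((pp + ((1 - \<tau>) * sqrt \<tau> + sqrt (1 - \<tau>)) * S) / L)"
proof -
  define q where "q = Q + \<theta> t i * (\<tau> * Q + sqrt \<tau> * s i)"
  have t01: "0 \<le> \<tau>" "\<tau> \<le> 1" using l Hpos(1)[of i] by (auto simp: \<tau>)
  have "l2_le M (\<lambda>\<omega>. dir i \<omega> + (gF i (y t i l \<omega>) - gF i (x t \<omega>))) q"
    unfolding q_def \<tau> by (intro l2_le_add dir_l2 gF_drift l)
  then have "l2_le M (\<lambda>\<omega>. gF i (y t i l \<omega>) + cb t \<omega> - c t i \<omega>) q"
    by (rule l2_le_cong) (simp add: dir_def)
  from drift_from_fraction[OF this, of "H i - l"]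
  have D: "l2_le M (\<lambda>\<omega>. y t i (H i) \<omega> - y t i l \<omega>)
     (\<theta> t i / L * (real (H i - l) / real (H i) * q + sqrt (real (H i - l) / real (H i)) * s i))"
    using l by simp
  have frac: "real (H i - l) / real (H i) = 1 - \<tau>"
    using l Hpos(1)[of i] by (simp add: \<tau> of_nat_diff diff_divide_distrib)
  have "\<theta> t i * q \<le> pp + (\<tau> * pp + sqrt \<tau> * S)"
  proof -
    have "\<theta> t i * (\<theta> t i * (\<tau> * Q + sqrt \<tau> * s i)) \<le> 1 * (\<tau> * pp + sqrt \<tau> * S)"
      using \<theta>0[of t i] \<theta>1[of t i] t01 Q_nonneg s_nonneg[of i]
      by (intro mult_mono drift_arith) auto
    then show ?thesis using \<theta>Q[of i] by (simp add: q_def distrib_left)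
  qed
  then have "(1 - \<tau>) * (\<theta> t i * q) \<le> (1 - \<tau>) * (pp + (\<tau> * pp + sqrt \<tau> * S))"
    using t01 by (intro mult_left_mono) auto
  also have "\<dots> = pp - \<tau>\<^sup>2 * pp + (1 - \<tau>) * sqrt \<tau> * S"
    by (simp add: power2_eq_square algebra_simps)
  also have "\<dots> \<le> pp + (1 - \<tau>) * sqrt \<tau> * S" using pp0 by simp
  finally have "(1 - \<tau>) * (\<theta> t i * q) + sqrt (1 - \<tau>) * (\<theta> t i * s i) \<le>
     pp + ((1 - \<tau>) * sqrt \<tau> + sqrt (1 - \<tau>)) * S"
    using mult_left_mono[OF \<theta>s, of "sqrt (1 - \<tau>)" i] t01 by (simp add: distrib_right)
  then have "\<theta> t i / L * ((1 - \<tau>) * q + sqrt (1 - \<tau>) * s i) \<le> (pp + ((1 - \<tau>) * sqrt \<tau> + sqrt (1 - \<tau>)) * S) / L"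
  proof -
    assume "(1 - \<tau>) * (\<theta> t i * q) + sqrt (1 - \<tau>) * (\<theta> t i * s i) \<le> pp + ((1 - \<tau>) * sqrt \<tau> + sqrt (1 - \<tau>)) * S"
    then have "((1 - \<tau>) * (\<theta> t i * q) + sqrt (1 - \<tau>) * (\<theta> t i * s i)) / L \<le> (pp + ((1 - \<tau>) * sqrt \<tau> + sqrt (1 - \<tau>)) * S) / L"
      using L by (intro divide_right_mono) auto
    moreover have "((1 - \<tau>) * (\<theta> t i * q) + sqrt (1 - \<tau>) * (\<theta> t i * s i)) / L =
        \<theta> t i / L * ((1 - \<tau>) * q + sqrt (1 - \<tau>) * s i)"
      using L by (simp add: field_simps)
    ultimately show ?thesis by simp
  qed
  with D have "l2_le M (\<lambda>\<omega>. y t i (H i) \<omega> - y t i l \<omega>) ((pp + ((1 - \<tau>) * sqrt \<tau> + sqrt (1 - \<tau>)) * S) / L)"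
    unfolding frac by (rule l2_le_mono)
  from l2_le_minus[OF this] show ?thesis by simp
qed

text \<open>The new server iterate is a convex combination of the final local iterates, with weight \<open>w t i\<close> on the node itself.\<close>

lemma Z_l2:
  assumes l: "l \<le> H i" and \<tau>: "\<tau> = real l / real (H i)"
  shows "\<exists>a. l2_le M (Z i l) a"
    and "(\<integral>\<omega>. (norm (Z i l \<omega>))\<^sup>2 \<partial>M) \<le> (1 - w t i) * ((\<tau> + 1) * pp + (sqrt \<tau> + 1) * S)\<^sup>2
      + w t i * (pp + ((1 - \<tau>) * sqrt \<tau> + sqrt (1 - \<tau>)) * S)\<^sup>2"
proof -
  define d where "d j \<omega> = y t i l \<omega> - y t j (H j) \<omega>" for j \<omega>
  have eq: "y t i l \<omega> - x (Suc t) \<omega> = (\<Sum>j\<in>UNIV. w t j *\<^sub>R d j \<omega>)" if "\<omega> \<in> space M" for \<omega>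
  proof -
    have "(\<Sum>j\<in>UNIV. w t j *\<^sub>R d j \<omega>) = (\<Sum>j\<in>UNIV. w t j *\<^sub>R (y t i l \<omega> - x t \<omega>) - w t j *\<^sub>R (y t j (H j) \<omega> - x t \<omega>))"
      by (intro sum.cong) (simp_all add: d_def algebra_simps)
    also have "\<dots> = (y t i l \<omega> - x t \<omega>) - (\<Sum>j\<in>UNIV. w t j *\<^sub>R (y t j (H j) \<omega> - x t \<omega>))"
      by (simp only: sum_subtractf scaleR_left.sum[symmetric] w1 scaleR_one)
    finally show ?thesis unfolding x_Suc[OF that] by simp
  qed
  have meas: "Z i l \<in> borel_measurable M"
    unfolding Z_def[abs_def] by (intro borel_measurable_diff gF_measurable y_M x_M l)
  let ?o = "((\<tau> + 1) * pp + (sqrt \<tau> + 1) * S) / L"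
  have d: "l2_le M (d j) ?o" for j
    using distance_other_node[OF l, of j] unfolding d_def[abs_def] \<tau> .
  have di: "l2_le M (d i) ((pp + ((1 - \<tau>) * sqrt \<tau> + sqrt (1 - \<tau>)) * S) / L)"
    using distance_same_node[OF l \<tau>] unfolding d_def[abs_def] .
  have "l2_le M (\<lambda>\<omega>. \<Sum>j\<in>UNIV. w t j *\<^sub>R d j \<omega>) (\<Sum>j\<in>UNIV. \<bar>w t j\<bar> * ?o)"
    by (intro l2_le_sum l2_le_scaleR d)
  from l2_le_dominated[OF this meas less_imp_le[OF L]]
  have Z: "l2_le M (Z i l) (L * (\<Sum>j\<in>UNIV. \<bar>w t j\<bar> * ?o))"
    using gF_lipschitz[of i] by (auto intro!: AE_I2 simp: Z_def eq[symmetric])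
  then show "\<exists>a. l2_le M (Z i l) a" ..
  have "(norm (Z i l \<omega>))\<^sup>2 \<le> (\<Sum>j\<in>UNIV. w t j * (L\<^sup>2 * (norm (d j \<omega>))\<^sup>2))" if "\<omega> \<in> space M" for \<omega>
  proof -
    have "(norm (Z i l \<omega>))\<^sup>2 \<le> (L * norm (y t i l \<omega> - x (Suc t) \<omega>))\<^sup>2"
      unfolding Z_def by (intro power_mono gF_lipschitz) auto
    also have "\<dots> = L\<^sup>2 * (norm (\<Sum>j\<in>UNIV. w t j *\<^sub>R d j \<omega>))\<^sup>2" by (simp add: power_mult_distrib eq[OF that])
    also have "\<dots> \<le> L\<^sup>2 * (\<Sum>j\<in>UNIV. w t j * (norm (d j \<omega>))\<^sup>2)"
      using w0 w1 by (intro mult_left_mono norm_sq_weighted_sum_le) auto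
    finally show ?thesis by (simp add: sum_distrib_left mult_ac)
  qed
  then have "(\<integral>\<omega>. (norm (Z i l \<omega>))\<^sup>2 \<partial>M) \<le> (\<integral>\<omega>. (\<Sum>j\<in>UNIV. w t j * (L\<^sup>2 * (norm (d j \<omega>))\<^sup>2)) \<partial>M)"
    by (intro integral_mono Bochner_Integration.integrable_sum integrable_mult_right l2_leD(2)[OF d] l2_leD(2)[OF Z])
  also have "\<dots> = (\<Sum>j\<in>UNIV. w t j * (L\<^sup>2 * (\<integral>\<omega>. (norm (d j \<omega>))\<^sup>2 \<partial>M)))"
    by (subst Bochner_Integration.integral_sum) 
      (simp only: integral_mult_right_zero | intro integrable_mult_right l2_leD(2)[OF d])+
  also have "\<dots> = (\<Sum>j\<in>UNIV - {i}. w t j * (L\<^sup>2 * (\<integral>\<omega>. (norm (d j \<omega>))\<^sup>2 \<partial>M))) + w t i * (L\<^sup>2 * (\<integral>\<omega>. (norm (d i \<omega>))\<^sup>2 \<partial>M))"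
    by (simp add: sum.remove[of UNIV i])
  also have "\<dots> \<le> (\<Sum>j\<in>UNIV - {i}. w t j * (L\<^sup>2 * ?o\<^sup>2)) + w t i * (L\<^sup>2 * ((pp + ((1 - \<tau>) * sqrt \<tau> + sqrt (1 - \<tau>)) * S) / L)\<^sup>2)"
    using w0 l2_leD(4)[OF d] l2_leD(4)[OF di] by (intro add_mono sum_mono mult_left_mono) auto
  also have "(\<Sum>j\<in>UNIV - {i}. w t j * (L\<^sup>2 * ?o\<^sup>2)) = (1 - w t i) * (L\<^sup>2 * ?o\<^sup>2)"
    using w1[of t] by (simp add: sum_distrib_right[symmetric] sum.remove[of UNIV i])
  finally show "(\<integral>\<omega>. (norm (Z i l \<omega>))\<^sup>2 \<partial>M) \<le> (1 - w t i) * ((\<tau> + 1) * pp + (sqrt \<tau> + 1) * S)\<^sup>2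
      + w t i * (pp + ((1 - \<tau>) * sqrt \<tau> + sqrt (1 - \<tau>)) * S)\<^sup>2"
    using L by (simp add: power_divide)
qed

lemma noise_bar_S: "l2_le M (noise_bar t i) S"
  using noise_bar_l2 s_le by (rule l2_le_mono)

text \<open>
  The point \<open>x'\<close> is the new server iterate without the contribution of node \<open>i\<close>; it is computed from the
  other nodes only, so the part \<open>?Z2\<close> is orthogonal to the averaged noise of node \<open>i\<close>.
\<close>

lemma noise_Z:
  assumes l: "l \<le> H i" and \<tau>: "\<tau> = real l / real (H i)"
  shows "(\<integral>\<omega>. noise_bar t i \<omega> \<bullet> Z i l \<omega> \<partial>M) \<le> S * (\<tau> * pp + sqrt \<tau> * S) + w t i * (S * (pp + S))"
proof -
  define x' where "x' \<omega> = x t \<omega> + (\<Sum>j\<in>UNIV - {i}. w t j *\<^sub>R (y t j (H j) \<omega> - x t \<omega>))" for \<omega>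
  let ?Z1 = "\<lambda>\<omega>. gF i (y t i l \<omega>) - gF i (x t \<omega>)"
  let ?Z2 = "\<lambda>\<omega>. gF i (x t \<omega>) - gF i (x' \<omega>)"
  let ?Z3 = "\<lambda>\<omega>. gF i (x' \<omega>) - gF i (x (Suc t) \<omega>)"
  have t0: "0 \<le> \<tau>" by (simp add: \<tau>)
  have RHo: "sets (RH t) \<subseteq> sets (others_history i t 0)" using RH_LH LH_others by blast
  have xo: "x t \<in> borel_measurable (others_history i t 0)"
    using state_measurable[of t] by (auto intro: measurable_mono_sets[OF _ RHo])
  have yo: "y t j (H j) \<in> borel_measurable (others_history i t 0)" if "j \<noteq> i" for j
    using that by (intro measurable_mono_sets[OF y_LH LH_others_other]) auto
  have x'o: "x' \<in> borel_measurable (others_history i t 0)"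
    unfolding x'_def[abs_def]
    by (intro borel_measurable_add borel_measurable_sum borel_measurable_scaleR borel_measurable_diff
        borel_measurable_const xo yo) auto
  have x'M: "x' \<in> borel_measurable M"
    using measurable_from_subalg[OF subalg_others_history x'o] by simp
  have Z1: "l2_le M ?Z1 (\<tau> * pp + sqrt \<tau> * S)"
    using l2_le_mono[OF gF_drift[OF l]] drift_arith[OF t0, of i] unfolding \<tau> by blast
  have "l2_le M (\<lambda>\<omega>. \<Sum>j\<in>UNIV - {i}. w t j *\<^sub>R (y t j (H j) \<omega> - x t \<omega>)) (\<Sum>j\<in>UNIV - {i}. \<bar>w t j\<bar> * ((pp + S) / L))"
    by (intro l2_le_sum l2_le_scaleR final_drift_S)
  then have Z2: "l2_le M ?Z2 (L * (\<Sum>j\<in>UNIV - {i}. \<bar>w t j\<bar> * ((pp + S) / L)))"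
  proof (rule l2_le_dominated)
    show "?Z2 \<in> borel_measurable M" by (intro borel_measurable_diff gF_measurable x_M x'M)
    show "AE \<omega> in M. norm (?Z2 \<omega>) \<le> L * norm (\<Sum>j\<in>UNIV - {i}. w t j *\<^sub>R (y t j (H j) \<omega> - x t \<omega>))"
    proof (rule AE_I2)
      fix \<omega>
      have "norm (?Z2 \<omega>) = norm (gF i (x' \<omega>) - gF i (x t \<omega>))" by (rule norm_minus_commute)
      also have "\<dots> \<le> L * norm (x' \<omega> - x t \<omega>)" by (rule gF_lipschitz)
      finally show "norm (?Z2 \<omega>) \<le> L * norm (\<Sum>j\<in>UNIV - {i}. w t j *\<^sub>R (y t j (H j) \<omega> - x t \<omega>))"
        by (simp add: x'_def)
    qed
  qed (use L in simp)
  have Z2o: "?Z2 \<in> borel_measurable (others_history i t 0)"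
    by (intro borel_measurable_diff gF_measurable xo x'o)
  have "l2_le M ?Z3 ((L * w t i) * ((pp + S) / L))"
  proof (rule l2_le_dominated[OF final_drift_S])
    show "?Z3 \<in> borel_measurable M" by (intro borel_measurable_diff gF_measurable x_M x'M)
    show "AE \<omega> in M. norm (?Z3 \<omega>) \<le> L * w t i * norm (y t i (H i) \<omega> - x t \<omega>)"
    proof (rule AE_I2)
      fix \<omega> assume "\<omega> \<in> space M"
      then have "x' \<omega> - x (Suc t) \<omega> = - (w t i *\<^sub>R (y t i (H i) \<omega> - x t \<omega>))"
        by (simp add: x'_def x_Suc sum.remove[of UNIV i])
      then have "norm (x' \<omega> - x (Suc t) \<omega>) = w t i * norm (y t i (H i) \<omega> - x t \<omega>)"
        using w0 by simp
      then show "norm (?Z3 \<omega>) \<le> L * w t i * norm (y t i (H i) \<omega> - x t \<omega>)"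
        using gF_lipschitz[of i "x' \<omega>" "x (Suc t) \<omega>"] by simp
    qed
  qed (use L w0 in simp)
  then have Z3: "l2_le M ?Z3 (w t i * (pp + S))" using L by simp
  note N = noise_bar_S[of i]
  have z2: "(\<integral>\<omega>. noise_bar t i \<omega> \<bullet> ?Z2 \<omega> \<partial>M) = 0"
    using noise_bar_orthogonal[OF Z2 Z2o] by (simp add: inner_commute)
  have "(\<integral>\<omega>. noise_bar t i \<omega> \<bullet> Z i l \<omega> \<partial>M) =
      (\<integral>\<omega>. noise_bar t i \<omega> \<bullet> ?Z1 \<omega> + noise_bar t i \<omega> \<bullet> ?Z2 \<omega> + noise_bar t i \<omega> \<bullet> ?Z3 \<omega> \<partial>M)"
    by (simp add: Z_def inner_add_right[symmetric])
  also have "\<dots> = (\<integral>\<omega>. noise_bar t i \<omega> \<bullet> ?Z1 \<omega> \<partial>M) + (\<integral>\<omega>. noise_bar t i \<omega> \<bullet> ?Z2 \<omega> \<partial>M) + (\<integral>\<omega>. noise_bar t i \<omega> \<bullet> ?Z3 \<omega> \<partial>M)"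
    using l2_le_inner_integrable[OF N Z1] l2_le_inner_integrable[OF N Z2] l2_le_inner_integrable[OF N Z3]
    by (simp only: Bochner_Integration.integral_add Bochner_Integration.integrable_add)
  also have "\<dots> \<le> S * (\<tau> * pp + sqrt \<tau> * S) + 0 + S * (w t i * (pp + S))"
    unfolding z2 by (intro add_mono l2_le_inner[OF N Z1] l2_le_inner[OF N Z3] order_refl)
  finally show ?thesis by (simp add: mult.left_commute)
qed

lemma control_error:
  "l2_le M (\<lambda>\<omega>. c (Suc t) i \<omega> - gF i (x (Suc t) \<omega>)) (sqrt (6 * S\<^sup>2 + 36 * pp\<^sup>2))"
proof -
  let ?h = "real (H i)"
  let ?e = "\<lambda>\<omega>. c (Suc t) i \<omega> - gF i (x (Suc t) \<omega>)"
  let ?f = "\<lambda>l \<omega>. noise_bar t i \<omega> + Z i l \<omega>"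
  have w01: "0 \<le> w t i" "w t i \<le> 1"
    using w0 w1[of t] member_le_sum[of i UNIV "w t"] by auto
  \<comment> \<open>Every summand carries the whole averaged noise, so that Jensen's inequality loses nothing on it.\<close>
  have eq: "?e \<omega> = (\<Sum>l<H i. (1 / ?h) *\<^sub>R ?f l \<omega>)" if "\<omega> \<in> space M" for \<omega>
  proof -
    have "(\<Sum>l<H i. ?f l \<omega>) = (\<Sum>l<H i. noise_bar t i \<omega> - \<xi> t i l \<omega> + gs t i l \<omega> - gF i (x (Suc t) \<omega>))"
      by (intro sum.cong) (simp_all add: Z_def \<xi>_def)
    also have "\<dots> = (?h *\<^sub>R noise_bar t i \<omega> - (\<Sum>l<H i. \<xi> t i l \<omega>)) + (\<Sum>l<H i. gs t i l \<omega>) - ?h *\<^sub>R gF i (x (Suc t) \<omega>)"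
      by (simp add: sum.distrib sum_subtractf sum_constant_scaleR)
    also have "?h *\<^sub>R noise_bar t i \<omega> - (\<Sum>l<H i. \<xi> t i l \<omega>) = 0"
      using Hpos(1)[of i] by (simp add: noise_bar_def)
    finally show ?thesis
      using Hpos(1)[of i] unfolding scaleR_sum_right[symmetric] c_Suc_eq[OF that] by (simp add: scaleR_diff_right)
  qed
  have If: "integrable M (\<lambda>\<omega>. (norm (?f l \<omega>))\<^sup>2)"
    and Ef: "(\<integral>\<omega>. (norm (?f l \<omega>))\<^sup>2 \<partial>M) \<le>
      (1 - w t i) * (S\<^sup>2 * ((24 / 7) + 19 / 5 * (real l / ?h)) + S * pp * (6 * (real l / ?h) + 4) + 4 * pp\<^sup>2) + w t i * (6 * S\<^sup>2 + 36 * pp\<^sup>2)"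
    if "l < H i" for l
  proof -
    define \<tau> where "\<tau> = real l / ?h"
    have l: "l \<le> H i" and t01: "0 \<le> \<tau>" "\<tau> \<le> 1" using that by (auto simp: \<tau>_def)
    obtain a where a: "l2_le M (Z i l) a" using Z_l2(1)[OF l \<tau>_def] by blast
    show "integrable M (\<lambda>\<omega>. (norm (?f l \<omega>))\<^sup>2)" by (rule l2_le_add_integrable[OF noise_bar_S a])
    have "(\<integral>\<omega>. (norm (?f l \<omega>))\<^sup>2 \<partial>M) \<le> S\<^sup>2 + 2 * (S * (\<tau> * pp + sqrt \<tau> * S) + w t i * (S * (pp + S)))
       + ((1 - w t i) * ((\<tau> + 1) * pp + (sqrt \<tau> + 1) * S)\<^sup>2
      + w t i * (pp + ((1 - \<tau>) * sqrt \<tau> + sqrt (1 - \<tau>)) * S)\<^sup>2)"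
      unfolding l2_le_add_integral[OF noise_bar_S a]
      by (intro add_mono mult_left_mono l2_leD(4)[OF noise_bar_S] noise_Z[OF l \<tau>_def] Z_l2(2)[OF l \<tau>_def]) simp
    also have "\<dots> = (1 - w t i) * (S\<^sup>2 + 2 * (S * (\<tau> * pp + sqrt \<tau> * S)) + ((\<tau> + 1) * pp + (sqrt \<tau> + 1) * S)\<^sup>2)
      + w t i * (S\<^sup>2 + 2 * (S * (\<tau> * pp + sqrt \<tau> * S)) + 2 * (S * (pp + S)) + (pp + ((1 - \<tau>) * sqrt \<tau> + sqrt (1 - \<tau>)) * S)\<^sup>2)"
      by (simp add: distrib_left left_diff_distrib)
    also have "\<dots> \<le> (1 - w t i) * (S\<^sup>2 * ((24 / 7) + 19 / 5 * \<tau>) + S * pp * (6 * \<tau> + 4) + 4 * pp\<^sup>2) + w t i * (6 * S\<^sup>2 + 36 * pp\<^sup>2)"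
      using w01 by (intro add_mono mult_left_mono other_node_arith same_node_arith S0 pp0 t01) auto
    finally show "(\<integral>\<omega>. (norm (?f l \<omega>))\<^sup>2 \<partial>M) \<le>
      (1 - w t i) * (S\<^sup>2 * ((24 / 7) + 19 / 5 * (real l / ?h)) + S * pp * (6 * (real l / ?h) + 4) + 4 * pp\<^sup>2) + w t i * (6 * S\<^sup>2 + 36 * pp\<^sup>2)"
      unfolding \<tau>_def .
  qed
  have meas: "?e \<in> borel_measurable M" by (intro borel_measurable_diff c_M gF_measurable x_M)
  have IR: "integrable M (\<lambda>\<omega>. \<Sum>l<H i. (1 / ?h) * (norm (?f l \<omega>))\<^sup>2)"
    using If by (intro Bochner_Integration.integrable_sum integrable_mult_right) auto
  have le: "(norm (?e \<omega>))\<^sup>2 \<le> (\<Sum>l<H i. (1 / ?h) * (norm (?f l \<omega>))\<^sup>2)" if "\<omega> \<in> space M" for \<omega>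
    unfolding eq[OF that] using Hpos(1)[of i] by (intro norm_sq_weighted_sum_le) auto
  have I: "integrable M (\<lambda>\<omega>. (norm (?e \<omega>))\<^sup>2)"
  proof (rule Bochner_Integration.integrable_bound[OF IR])
    show "(\<lambda>\<omega>. (norm (?e \<omega>))\<^sup>2) \<in> borel_measurable M" using meas by measurable
    show "AE \<omega> in M. norm ((norm (?e \<omega>))\<^sup>2) \<le> norm (\<Sum>l<H i. (1 / ?h) * (norm (?f l \<omega>))\<^sup>2)"
    proof (rule AE_I2)
      fix \<omega> assume "\<omega> \<in> space M"
      from le[OF this] show "norm ((norm (?e \<omega>))\<^sup>2) \<le> norm (\<Sum>l<H i. (1 / ?h) * (norm (?f l \<omega>))\<^sup>2)"
        unfolding real_norm_def by (intro order_trans[OF _ abs_ge_self]) simp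
    qed
  qed
  have "(\<integral>\<omega>. (norm (?e \<omega>))\<^sup>2 \<partial>M) \<le> (\<integral>\<omega>. (\<Sum>l<H i. (1 / ?h) * (norm (?f l \<omega>))\<^sup>2) \<partial>M)"
    using I IR le by (rule integral_mono)
  also have "\<dots> = (\<Sum>l<H i. (1 / ?h) * (\<integral>\<omega>. (norm (?f l \<omega>))\<^sup>2 \<partial>M))"
  proof -
    have "(\<integral>\<omega>. (\<Sum>l<H i. (1 / ?h) * (norm (?f l \<omega>))\<^sup>2) \<partial>M) = (\<Sum>l<H i. \<integral>\<omega>. (1 / ?h) * (norm (?f l \<omega>))\<^sup>2 \<partial>M)"
      using If by (intro Bochner_Integration.integral_sum integrable_mult_right) auto
    then show ?thesis by (simp only: integral_mult_right_zero)
  qed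
  also have "\<dots> \<le> (\<Sum>l<H i. (1 / ?h) * ((1 - w t i) * (S\<^sup>2 * ((24 / 7) + 19 / 5 * (real l / ?h)) + S * pp * (6 * (real l / ?h) + 4) + 4 * pp\<^sup>2)
     + w t i * (6 * S\<^sup>2 + 36 * pp\<^sup>2)))"
    using Ef by (intro sum_mono mult_left_mono) auto
  also have "\<dots> \<le> 6 * S\<^sup>2 + 36 * pp\<^sup>2"
    by (rule averaged_arith[OF S0 pp0 w01 Hpos(2)])
  finally show ?thesis using I meas by (simp add: l2_le_def)
qed

end

end

section \<open>Upper states\<close>

lemma nn_integral_le_imp_l2_le:
  assumes m: "X \<in> borel_measurable M" and le: "(\<integral>\<^sup>+\<omega>. ennreal ((norm (X \<omega>))\<^sup>2) \<partial>M) \<le> ennreal a" and a: "0 \<le> a"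
  shows "l2_le M X (sqrt a)"
proof -
  have I: "integrable M (\<lambda>\<omega>. (norm (X \<omega>))\<^sup>2)"
    using m le by (intro integrableI_nonneg) (auto simp: less_top[symmetric] top_unique)
  have "ennreal (\<integral>\<omega>. (norm (X \<omega>))\<^sup>2 \<partial>M) \<le> ennreal a"
    using le by (simp add: nn_integral_eq_integral[OF I])
  then show ?thesis using m I a by (simp add: l2_le_def)
qed

lemma l2_le_imp_nn_integral_le:
  assumes "l2_le M X (sqrt a)" "0 \<le> a"
  shows "(\<integral>\<^sup>+\<omega>. ennreal ((norm (X \<omega>))\<^sup>2) \<partial>M) \<le> ennreal a"
  using l2_leD(4)[OF assms(1)] assms(2) by (simp add: nn_integral_eq_integral[OF l2_leD(2)[OF assms(1)]] ennreal_leI)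

text \<open>
  The inductive step. The bound by \<open>L R\<^sup>2 / 2\<close> on the gap holds pointwise in the ball, so that taking the
  minimum in the recursion is harmless.
\<close>

lemma (in hew_run) upper_state_Suc:
  assumes us: "upper_state \<phi> m L xs R M x c t u X"
    and V: "\<And>i. node_var \<phi> m xs R i \<le> V i"
    and u': "u' = min (L * R\<^sup>2 / 2) (surrogate_obj L R H b V (w t) (\<theta> t) u X)"
    and X': "X' = 6 * (MAX i. node_var \<phi> m xs R i / (real (H i) * real (b i)))
                          + 144 * L * \<theta>hi\<^sup>2 * u + 288 * \<theta>hi\<^sup>2 * X"
  shows "upper_state \<phi> m L xs R M x c (Suc t) u' X'"
proof -
  have err: "l2_le M (\<lambda>\<omega>. c t i \<omega> - gF i (x t \<omega>)) (sqrt X)" for i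
  proof (rule nn_integral_le_imp_l2_le)
    have "(\<integral>\<^sup>+\<omega>. ennreal ((norm (c t i \<omega> - gF i (x t \<omega>)))\<^sup>2) \<partial>M) \<le> max_ctrl_err \<phi> m M x c t"
      unfolding max_ctrl_err_def by (intro Max_ge) auto
    then show "(\<integral>\<^sup>+\<omega>. ennreal ((norm (c t i \<omega> - gF i (x t \<omega>)))\<^sup>2) \<partial>M) \<le> ennreal X"
      using us order_trans unfolding upper_state_def by blast
    show "(\<lambda>\<omega>. c t i \<omega> - gF i (x t \<omega>)) \<in> borel_measurable M" by (intro borel_measurable_diff c_M gF_measurable x_M)
  qed (use us in \<open>simp add: upper_state_def\<close>)
  interpret hew_round M \<phi> m H b L R \<theta>hi xs B x cb y c w \<theta> t u X
    by unfold_locales (use us err in \<open>auto simp: upper_state_def opt_gap_def\<close>)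
  define S where "S = sqrt (MAX i. noise_var i)"
  have nv: "noise_var i \<le> (MAX i. noise_var i)" for i by (intro Max_ge) auto
  have S2: "S\<^sup>2 = (MAX i. noise_var i)"
    using order_trans[OF noise_var_nonneg nv] by (simp add: S_def)
  have X'_eq: "X' = 6 * S\<^sup>2 + 36 * (pp)\<^sup>2"
    unfolding X' S2 noise_var_def pp_def power_mult_distrib Q_sq by (simp add: algebra_simps)
  have "l2_le M (\<lambda>\<omega>. c (Suc t) i \<omega> - gF i (x (Suc t) \<omega>)) (sqrt X')" for i
    unfolding X'_eq
  proof (rule control_error)
    show "0 \<le> S" using order_trans[OF noise_var_nonneg nv] by (simp add: S_def)
    show "noise_var i \<le> S\<^sup>2" for i unfolding S2 by (rule nv)
  qed
  moreover have X'0: "0 \<le> X'" unfolding X'_eq by simp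
  ultimately have "max_ctrl_err \<phi> m M x c (Suc t) \<le> ennreal X'"
    unfolding max_ctrl_err_def by (intro Max.boundedI) (auto intro: l2_le_imp_nn_integral_le)
  moreover have gle: "opt_gap \<phi> m xs M x (Suc t) \<le> u'"
  proof -
    have "opt_gap \<phi> m xs M x (Suc t) \<le> (\<integral>\<omega>. L * R\<^sup>2 / 2 \<partial>M)"
      unfolding opt_gap_def
    proof (rule integral_mono_AE')
      show "AE \<omega> in M. FF (x (Suc t) \<omega>) - FF xs \<le> L * R\<^sup>2 / 2"
        using ball_x[of "Suc t"]
      proof eventually_elim
        case (elim \<omega>)
        have "FF (x (Suc t) \<omega>) - FF xs \<le> L / 2 * (norm (x (Suc t) \<omega> - xs))\<^sup>2" by (rule gap_le_quadratic)
        also have "\<dots> \<le> L / 2 * R\<^sup>2"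
          using elim L by (intro mult_left_mono power_mono) (auto simp: dist_norm norm_minus_commute)
        finally show ?case by simp
      qed
    qed (use L in auto)
    then show ?thesis
      using surrogate_descent[OF V] unfolding u' opt_gap_def by (simp add: prob_space)
  qed
  moreover have "0 \<le> opt_gap \<phi> m xs M x (Suc t)"
    unfolding opt_gap_def using gap_nonneg by (intro integral_nonneg_AE) auto
  ultimately show ?thesis using X'0 by (auto simp: upper_state_def u')
qed

theorem theoremB12:
  fixes \<phi> :: "'n::finite \<Rightarrow> nat \<Rightarrow> real ^ 'd \<Rightarrow> real"
    and m H b :: "'n \<Rightarrow> nat"
    and L R \<theta>lo \<theta>hi :: real
    and xs :: "real ^ 'd"
    and M :: "'w measure"
    and B :: "nat \<Rightarrow> 'n \<Rightarrow> nat \<Rightarrow> 'w \<Rightarrow> nat set"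
    and x cb :: "nat \<Rightarrow> 'w \<Rightarrow> real ^ 'd"
    and y :: "nat \<Rightarrow> 'n \<Rightarrow> nat \<Rightarrow> 'w \<Rightarrow> real ^ 'd"
    and c :: "nat \<Rightarrow> 'n \<Rightarrow> 'w \<Rightarrow> real ^ 'd"
    and w \<theta> vhat2 :: "nat \<Rightarrow> 'n \<Rightarrow> real"
    and u chi :: "nat \<Rightarrow> real"
  assumes "L > 0" and "R > 0"
    and "\<And>i. 1 \<le> H i" and "\<And>i. 1 \<le> b i" and "\<And>i. b i \<le> m i"
    and "0 < \<theta>lo" and "\<theta>lo \<le> \<theta>hi" and "\<theta>hi \<le> 1"
    and "\<And>i j. j < m i \<Longrightarrow> convex_on UNIV (\<phi> i j)"
    and "\<And>i j. j < m i \<Longrightarrow> smooth_fun L (\<phi> i j)"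
    and "is_arg_min (global_obj \<phi> m) (\<lambda>_. True) xs"
    and "prob_space M"
    and "x 0 \<in> borel_measurable M" and "\<And>i. c 0 i \<in> borel_measurable M"
    and "\<And>t i l. l < H i \<Longrightarrow> B t i l \<in> M \<rightarrow>\<^sub>M count_space (minibatches m b i)"
    and "hew_local_sgd \<phi> H b L M w \<theta> B x y c cb"
    and "AE \<omega> in M. \<forall>t i l. l \<le> H i \<longrightarrow> x t \<omega> \<in> cball xs R \<and> y t i l \<omega> \<in> cball xs R"
    and "minibatch_sampling \<phi> m H b xs R M B x y c"
    and "opt_gap \<phi> m xs M x 0 \<le> u 0" and "u 0 \<le> L * R\<^sup>2 / 2"
    and "0 \<le> chi 0" and "max_ctrl_err \<phi> m M x c 0 \<le> ennreal (chi 0)"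
    and "\<And>t. chi (Suc t) = 6 * (MAX i. node_var \<phi> m xs R i / (real (H i) * real (b i)))
                          + 144 * L * \<theta>hi\<^sup>2 * u t + 288 * \<theta>hi\<^sup>2 * chi t"
  shows
    "((\<forall>t. optimal_controls L R H b (node_var \<phi> m xs R) \<theta>lo \<theta>hi (u t) (chi t) (w t) (\<theta> t) \<and>
           u (Suc t) = min (L * R\<^sup>2 / 2)
             (surrogate_obj L R H b (node_var \<phi> m xs R) (w t) (\<theta> t) (u t) (chi t)))
      \<longrightarrow> (\<forall>t. upper_state \<phi> m L xs R M x c t (u t) (chi t)))
     \<and>
     ((\<forall>t i. node_var \<phi> m xs R i \<le> vhat2 t i) \<and>
      (\<forall>t. optimal_controls L R H b (vhat2 t) \<theta>lo \<theta>hi (u t) (chi t) (w t) (\<theta> t) \<and>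
           u (Suc t) = min (L * R\<^sup>2 / 2)
             (surrogate_obj L R H b (vhat2 t) (w t) (\<theta> t) (u t) (chi t)))
      \<longrightarrow> (\<forall>t. upper_state \<phi> m L xs R M x c t (u t) (chi t)))"
proof -
  have main: "upper_state \<phi> m L xs R M x c t (u t) (chi t)"
    if V: "\<And>t i. node_var \<phi> m xs R i \<le> V t i"
      and ctrl: "\<And>t. optimal_controls L R H b (V t) \<theta>lo \<theta>hi (u t) (chi t) (w t) (\<theta> t)"
      and step: "\<And>t. u (Suc t) = min (L * R\<^sup>2 / 2) (surrogate_obj L R H b (V t) (w t) (\<theta> t) (u t) (chi t))"
    for V t
  proof -
    have w: "w t \<in> prob_simplex" and th: "\<theta>lo \<le> \<theta> t i" "\<theta> t i \<le> \<theta>hi" for t i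
      using ctrl[of t] by (auto simp: optimal_controls_def is_arg_min_def)
    interpret P: prob_space M by fact
    interpret hew_run M \<phi> m H b L R \<theta>hi xs B x cb y c w \<theta>
      by unfold_locales (fact assms | use w th assms(6) order.strict_trans2 in \<open>fastforce simp: prob_simplex_def\<close>)+
    show ?thesis
    proof (induction t)
      case 0
      have "0 \<le> opt_gap \<phi> m xs M x 0"
        unfolding opt_gap_def using gap_nonneg by (intro integral_nonneg_AE) auto
      then show ?case using assms by (auto simp: upper_state_def)
    next
      case (Suc t)
      then show ?case by (rule upper_state_Suc[OF _ V step assms(23)])
    qed
  qed
  show ?thesis using main[of "\<lambda>_. node_var \<phi> m xs R"] main[of vhat2] by blast
qed

end
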